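(* Let $N\ge 2$, let $q\in k$ be a primitive $N$-th root of unity and let $A=(a_{ij})\in\mathbb Z_N^{2\times 2}$ be a parameter matrix. The generalised Taft algebra $H_q(A)$ has a pair in involution if and only if there exist $c,d\in\mathbb Z_N$ such that in $\mathbb Z_N$ $$a_{11}c+a_{12}d=a_{11}a_{12},\qquad a_{21}c+a_{22}d=a_{21}a_{22}.$$ The pair in involution $(g^d,\xi^{-c})$ corresponding to such $c,d$ is modular if and only if additionally $cd=0$ in $\mathbb Z_N$.
   Context: $k$ is an algebraically closed field of characteristic zero; $\mathbb Z_N=\mathbb Z/N\mathbb Z$. Pair in involution: for a Hopf algebra $H$ over $k$ with antipode $S$, a pair $(l,\beta)$ of a group-like element $l\in H$ and a group-like element $\beta$ of the finite dual $H^\circ$ (i.e. a character $\beta:H\to k$) with $S^2(h)=\beta(h_{(3)})\,\beta^{-1}(h_{(1)})\; l\,h_{(2)}\,l^{-1}$ for all $h\in H$ (Sweedler notation, $\beta^{-1}=\beta\circ S$). It is modular if in addition $\beta(l)=1$. Parameter matrix: a matrix $(a_{ij})\in\mathbb Z_N^{2\times2}$ with $a_{11}a_{12}\neq0$, $a_{21}a_{22}\ne0$, $a_{11}a_{22}+a_{12}a_{21}=0$ in $\mathbb Z_N$. Generalised Taft algebra $H_q(A)$: let $N_x$ and $N_y$ be the additive orders of $a_{11}a_{12}$ and $a_{21}a_{22}$ in $\mathbb Z_N$. Then $H_q(A)$ is the Hopf algebra over $k$ generated by $g,x,y$ subject to $x^{N_x}=0$, $y^{N_y}=0$, $xy=q^{a_{11}a_{22}}yx$,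 $g^N=1$, $gx=q^{a_{12}}xg$, $gy=q^{a_{22}}yg$, with coproduct $\Delta(g)=g\otimes g$, $\Delta(x)=1\otimes x+x\otimes g^{a_{11}}$, $\Delta(y)=1\otimes y+y\otimes g^{a_{21}}$ and antipode $S(g)=g^{-1}$, $S(x)=-xg^{-a_{11}}$, $S(y)=-yg^{-a_{21}}$. The character $\xi: H_q(A)\to k$ is defined on the basis $x^iy^jg^l$ ($0\le i<N_x$, $0\le j<N_y$, $0\le l<N$) by $\xi(x^iy^jg^l)=q^{-l}$ if $i=j=0$ and $0$ otherwise. Every group-like element of $H_q(A)$ is uniquely of the form $g^d$ and every character uniquely of the form $\xi^{-c}$ (powers in the group of group-likes of $H_q(A)^\circ$), with $c,d\in\mathbb Z_N$. *)

theory Defs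
  imports
    "HOL-Algebra.QuotRing"
    "HOL-Algebra.Module"
    "HOL-Library.Poly_Mapping"
    "HOL-Library.FuncSet"
    "HOL-Computational_Algebra.Polynomial"
    "HOL-Number_Theory.Cong"
    "HOL-Analysis.Finite_Cartesian_Product"
begin

section \<open>Algebras over a field and free constructions\<close>

text \<open>The ground field is a type of class \<open>field\<close>; an algebra over it is a \<open>module\<close> record
  of HOL-Algebra whose scalars have that type.\<close>

definition base_alg :: "('k::field, 'k) module" where
  "base_alg = \<lparr>carrier = UNIV, monoid.mult = (*), one = 1, zero = 0, add = (+), module.smult = (*)\<rparr>"

definition opp_alg :: "('k, 'a, 'z) module_scheme \<Rightarrow> ('k, 'a, 'z) module_scheme" where
  "opp_alg A = A\<lparr>monoid.mult := (\<lambda>a b. b \<otimes>\<^bsub>A\<^esub> a)\<rparr>"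

abbreviation pm_scale :: "'k::field \<Rightarrow> ('m \<Rightarrow>\<^sub>0 'k) \<Rightarrow> ('m \<Rightarrow>\<^sub>0 'k)" where
  "pm_scale c \<equiv> Poly_Mapping.map ((*) c)"

abbreviation pm_span :: "('m \<Rightarrow>\<^sub>0 'k::field) set \<Rightarrow> ('m \<Rightarrow>\<^sub>0 'k) set" where
  "pm_span \<equiv> Modules.module.span pm_scale"

lemma lookup_pm_scale:
  "Poly_Mapping.lookup (pm_scale c f) m = c * Poly_Mapping.lookup f m"
  by (simp add: map.rep_eq when_def)

lemma pm_scale_vector_space:
  "Vector_Spaces.vector_space (pm_scale :: 'k::field \<Rightarrow> ('m \<Rightarrow>\<^sub>0 'k) \<Rightarrow> _)"
  by unfold_locales
    (auto intro!: poly_mapping_eqI simp: lookup_add lookup_pm_scale algebra_simps)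

text \<open>The monoid algebra: finitely supported formal linear combinations of elements of a monoid.\<close>

definition monoid_alg :: "('m, 'z) monoid_scheme \<Rightarrow> ('k::field, 'm \<Rightarrow>\<^sub>0 'k) module" where
  "monoid_alg M =
    \<lparr>carrier = {f. Poly_Mapping.keys f \<subseteq> carrier M},
     monoid.mult = (\<lambda>f h. \<Sum>a\<in>Poly_Mapping.keys f. \<Sum>b\<in>Poly_Mapping.keys h.
        Poly_Mapping.single (a \<otimes>\<^bsub>M\<^esub> b) (Poly_Mapping.lookup f a * Poly_Mapping.lookup h b)),
     one = Poly_Mapping.single \<one>\<^bsub>M\<^esub> 1, zero = 0, add = (+), module.smult = pm_scale\<rparr>"

definition lin_ext :: "('k::field, 'b, 'z) module_scheme \<Rightarrow> ('m \<Rightarrow> 'b) \<Rightarrow> ('m \<Rightarrow>\<^sub>0 'k) \<Rightarrow> 'b" where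
  "lin_ext B \<phi> f =
    (\<Oplus>\<^bsub>B\<^esub>m\<in>Poly_Mapping.keys f. Poly_Mapping.lookup f m \<odot>\<^bsub>B\<^esub> \<phi> m)"

definition free_monoid :: "'s list monoid" where
  "free_monoid = \<lparr>carrier = UNIV, monoid.mult = (@), one = []\<rparr>"

abbreviation free_alg :: "('k::field, 's list \<Rightarrow>\<^sub>0 'k) module" where
  "free_alg \<equiv> monoid_alg free_monoid"

definition free_gen :: "'s \<Rightarrow> ('s list \<Rightarrow>\<^sub>0 'k::field)" where
  "free_gen s = Poly_Mapping.single [s] 1"

text \<open>The algebra homomorphism from the free algebra to \<open>B\<close> with prescribed values on generators.\<close>

definition free_hom :: "('k::field, 'b, 'z) module_scheme \<Rightarrow> ('s \<Rightarrow> 'b) \<Rightarrow> ('s list \<Rightarrow>\<^sub>0 'k) \<Rightarrow> 'b" where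
  "free_hom B \<phi> = lin_ext B (\<lambda>w. foldr (\<lambda>s b. \<phi> s \<otimes>\<^bsub>B\<^esub> b) w \<one>\<^bsub>B\<^esub>)"

text \<open>The quotient by a two-sided ideal, with its scalar multiplication.\<close>

definition quot_alg :: "('k, 'a, 'z) module_scheme \<Rightarrow> 'a set \<Rightarrow> ('k, 'a set) module" where
  "quot_alg A J = ring.extend (A Quot J)
     (module.fields (\<lambda>c X. \<Union>x\<in>X. J +>\<^bsub>A\<^esub> (c \<odot>\<^bsub>A\<^esub> x)))"

text \<open>The map on cosets induced by a map that is constant on each coset.\<close>

definition quot_map :: "('a \<Rightarrow> 'b) \<Rightarrow> 'a set \<Rightarrow> 'b" where
  "quot_map f X = the_elem (f ` X)"

section \<open>Tensor products\<close>

text \<open>\<open>A \<otimes> B\<close> is the free vector space on \<open>A \<times> B\<close> modulo the subspace spanned by the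
  bilinearity relations. That subspace is an ideal of the monoid algebra of the product monoid,
  which yields the multiplication \<open>(a \<otimes> b)(a' \<otimes> b') = aa' \<otimes> bb'\<close>.\<close>

definition bilin_rels ::
  "('k::field, 'a, 'y) module_scheme \<Rightarrow> ('k, 'b, 'z) module_scheme \<Rightarrow> ('a \<times> 'b \<Rightarrow>\<^sub>0 'k) set" where
  "bilin_rels A B = pm_span (let e = (\<lambda>a b. Poly_Mapping.single (a, b) (1::'k)) in
      {e (a \<oplus>\<^bsub>A\<^esub> a') b - e a b - e a' b | a a' b. a \<in> carrier A \<and> a' \<in> carrier A \<and> b \<in> carrier B}
    \<union> {e a (b \<oplus>\<^bsub>B\<^esub> b') - e a b - e a b' | a b b'. a \<in> carrier A \<and> b \<in> carrier B \<and> b' \<in> carrier B}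
    \<union> {e (c \<odot>\<^bsub>A\<^esub> a) b - pm_scale c (e a b) | c a b. a \<in> carrier A \<and> b \<in> carrier B}
    \<union> {e a (c \<odot>\<^bsub>B\<^esub> b) - pm_scale c (e a b) | c a b. a \<in> carrier A \<and> b \<in> carrier B})"

definition tensor_alg ::
  "('k::field, 'a, 'y) module_scheme \<Rightarrow> ('k, 'b, 'z) module_scheme
    \<Rightarrow> ('k, ('a \<times> 'b \<Rightarrow>\<^sub>0 'k) set) module" where
  "tensor_alg A B = quot_alg (monoid_alg (A \<times>\<times> B)) (bilin_rels A B)"

definition tens ::
  "('k::field, 'a, 'y) module_scheme \<Rightarrow> ('k, 'b, 'z) module_scheme
    \<Rightarrow> 'a \<Rightarrow> 'b \<Rightarrow> ('a \<times> 'b \<Rightarrow>\<^sub>0 'k) set" where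
  "tens A B a b =
    bilin_rels A B +>\<^bsub>monoid_alg (A \<times>\<times> B)\<^esub> Poly_Mapping.single (a, b) 1"

text \<open>The linear map to \<open>U\<close> sending \<open>a \<otimes> b\<close> to \<open>\<phi> a b\<close>, for bilinear \<open>\<phi>\<close>.\<close>

definition tensor_lift ::
  "('k::field, 'u, 'z) module_scheme \<Rightarrow> ('a \<Rightarrow> 'b \<Rightarrow> 'u) \<Rightarrow> ('a \<times> 'b \<Rightarrow>\<^sub>0 'k) set \<Rightarrow> 'u" where
  "tensor_lift U \<phi> = quot_map (lin_ext U (\<lambda>(a, b). \<phi> a b))"

section \<open>Hopf algebra structures and pairs in involution\<close>

record (overloaded) ('k::zero, 'a) hopf = "('k, 'a) module" +
  comult :: "'a \<Rightarrow> ('a \<times> 'a \<Rightarrow>\<^sub>0 'k) set"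
  counit :: "'a \<Rightarrow> 'k"
  antipode :: "'a \<Rightarrow> 'a"

text \<open>The element \<open>h\<^sub>1 \<otimes> h\<^sub>2 \<otimes> h\<^sub>3 = (\<Delta> \<otimes> id)(\<Delta> h)\<close> of \<open>(H \<otimes> H) \<otimes> H\<close>.\<close>

definition comult3 ::
  "('k::field, 'a, 'z) hopf_scheme
    \<Rightarrow> 'a \<Rightarrow> (('a \<times> 'a \<Rightarrow>\<^sub>0 'k) set \<times> 'a \<Rightarrow>\<^sub>0 'k) set" where
  "comult3 H h = tensor_lift (tensor_alg (tensor_alg H H) H)
     (\<lambda>a b. tens (tensor_alg H H) H (comult H a) b) (comult H h)"

definition group_likes :: "('k::field, 'a, 'z) hopf_scheme \<Rightarrow> 'a set" where
  "group_likes H = {l \<in> carrier H. comult H l = tens H H l l \<and> counit H l = 1}"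

text \<open>Functions on the carrier are made unique by taking the value \<open>undefined\<close> outside of it.\<close>

definition lin_functionals :: "('k::field, 'a, 'z) module_scheme \<Rightarrow> ('a \<Rightarrow> 'k) set" where
  "lin_functionals H = {f \<in> extensional (carrier H).
     (\<forall>a\<in>carrier H. \<forall>b\<in>carrier H. f (a \<oplus>\<^bsub>H\<^esub> b) = f a + f b) \<and>
     (\<forall>c. \<forall>a\<in>carrier H. f (c \<odot>\<^bsub>H\<^esub> a) = c * f a)}"

definition characters :: "('k::field, 'a, 'z) module_scheme \<Rightarrow> ('a \<Rightarrow> 'k) set" where
  "characters H = {\<beta> \<in> lin_functionals H. \<beta> \<one>\<^bsub>H\<^esub> = 1 \<and>
     (\<forall>a\<in>carrier H. \<forall>b\<in>carrier H. \<beta> (a \<otimes>\<^bsub>H\<^esub> b) = \<beta> a * \<beta> b)}"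

text \<open>The characters are the group-like elements of the finite dual; they form a group under
  the convolution \<open>(\<beta> * \<gamma>)(h) = \<beta>(h\<^sub>1) \<gamma>(h\<^sub>2)\<close>.\<close>

definition character_group :: "('k::field, 'a, 'z) hopf_scheme \<Rightarrow> ('a \<Rightarrow> 'k) monoid" where
  "character_group H =
    \<lparr>carrier = characters H,
     monoid.mult = (\<lambda>\<beta> \<gamma>. \<lambda>h\<in>carrier H. tensor_lift base_alg (\<lambda>a b. \<beta> a * \<gamma> b) (comult H h)),
     one = (\<lambda>h\<in>carrier H. counit H h)\<rparr>"

text \<open>\<open>S\<^sup>2(h) = \<beta>(h\<^sub>3) \<beta>\<inverse>(h\<^sub>1) l h\<^sub>2 l\<inverse>\<close>, where \<open>\<beta>\<inverse> = \<beta> \<circ> S\<close>.\<close>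

definition pair_in_involution ::
  "('k::field, 'a, 'z) hopf_scheme \<Rightarrow> 'a \<Rightarrow> ('a \<Rightarrow> 'k) \<Rightarrow> bool" where
  "pair_in_involution H l \<beta> \<longleftrightarrow> l \<in> group_likes H \<and> \<beta> \<in> characters H \<and>
     (\<forall>h\<in>carrier H. antipode H (antipode H h) =
        tensor_lift H (\<lambda>t h3. tensor_lift H
            (\<lambda>h1 h2. (\<beta> h3 * \<beta> (antipode H h1)) \<odot>\<^bsub>H\<^esub> (l \<otimes>\<^bsub>H\<^esub> h2 \<otimes>\<^bsub>H\<^esub> inv\<^bsub>H\<^esub> l)) t)
          (comult3 H h))"

definition modular_pair ::
  "('k::field, 'a, 'z) hopf_scheme \<Rightarrow> 'a \<Rightarrow> ('a \<Rightarrow> 'k) \<Rightarrow> bool" where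
  "modular_pair H l \<beta> \<longleftrightarrow> pair_in_involution H l \<beta> \<and> \<beta> l = 1"

section \<open>Generalised Taft algebras\<close>

text \<open>Residue classes modulo \<open>N\<close> are represented by arbitrary integers.\<close>

definition primitive_root_of_unity :: "nat \<Rightarrow> 'k::field \<Rightarrow> bool" where
  "primitive_root_of_unity N q \<longleftrightarrow> N > 0 \<and> q ^ N = 1 \<and> (\<forall>m. 0 < m \<and> m < N \<longrightarrow> q ^ m \<noteq> 1)"

definition parameter_matrix :: "nat \<Rightarrow> int^2^2 \<Rightarrow> bool" where
  "parameter_matrix N A \<longleftrightarrow>
     \<not> [A$1$1 * A$1$2 = 0] (mod int N) \<and> \<not> [A$2$1 * A$2$2 = 0] (mod int N) \<and>
     [A$1$1 * A$2$2 + A$1$2 * A$2$1 = 0] (mod int N)"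

definition add_order :: "nat \<Rightarrow> int \<Rightarrow> nat" where
  "add_order N a = (LEAST n. 0 < n \<and> [int n * a = 0] (mod int N))"

definition taft_Nx :: "nat \<Rightarrow> int^2^2 \<Rightarrow> nat" where
  "taft_Nx N A = add_order N (A$1$1 * A$1$2)"

definition taft_Ny :: "nat \<Rightarrow> int^2^2 \<Rightarrow> nat" where
  "taft_Ny N A = add_order N (A$2$1 * A$2$2)"

datatype gen = Gen_g | Gen_x | Gen_y

type_synonym 'k taft = "(gen list \<Rightarrow>\<^sub>0 'k) set"

text \<open>The relations \<open>u = v\<close> are listed as the elements \<open>u - v\<close> of the free algebra.\<close>

definition taft_ideal :: "nat \<Rightarrow> 'k::field \<Rightarrow> int^2^2 \<Rightarrow> (gen list \<Rightarrow>\<^sub>0 'k) set" where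
  "taft_ideal N q A =
    (let F = free_alg :: ('k, gen list \<Rightarrow>\<^sub>0 'k) module;
         g = free_gen Gen_g; x = free_gen Gen_x; y = free_gen Gen_y
     in Idl\<^bsub>F\<^esub> {x [^]\<^bsub>F\<^esub> taft_Nx N A,
               y [^]\<^bsub>F\<^esub> taft_Ny N A,
               x \<otimes>\<^bsub>F\<^esub> y \<ominus>\<^bsub>F\<^esub> (q powi (A$1$1 * A$2$2)) \<odot>\<^bsub>F\<^esub> (y \<otimes>\<^bsub>F\<^esub> x),
               g [^]\<^bsub>F\<^esub> N \<ominus>\<^bsub>F\<^esub> \<one>\<^bsub>F\<^esub>,
               g \<otimes>\<^bsub>F\<^esub> x \<ominus>\<^bsub>F\<^esub> (q powi (A$1$2)) \<odot>\<^bsub>F\<^esub> (x \<otimes>\<^bsub>F\<^esub> g),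
               g \<otimes>\<^bsub>F\<^esub> y \<ominus>\<^bsub>F\<^esub> (q powi (A$2$2)) \<odot>\<^bsub>F\<^esub> (y \<otimes>\<^bsub>F\<^esub> g)})"

definition taft_alg :: "nat \<Rightarrow> 'k::field \<Rightarrow> int^2^2 \<Rightarrow> ('k, 'k taft) module" where
  "taft_alg N q A = quot_alg free_alg (taft_ideal N q A)"

definition taft_gen :: "nat \<Rightarrow> 'k::field \<Rightarrow> int^2^2 \<Rightarrow> gen \<Rightarrow> 'k taft" where
  "taft_gen N q A s = taft_ideal N q A +>\<^bsub>free_alg\<^esub> free_gen s"

abbreviation taft_g :: "nat \<Rightarrow> 'k::field \<Rightarrow> int^2^2 \<Rightarrow> 'k taft" where
  "taft_g N q A \<equiv> taft_gen N q A Gen_g"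

abbreviation taft_x :: "nat \<Rightarrow> 'k::field \<Rightarrow> int^2^2 \<Rightarrow> 'k taft" where
  "taft_x N q A \<equiv> taft_gen N q A Gen_x"

abbreviation taft_y :: "nat \<Rightarrow> 'k::field \<Rightarrow> int^2^2 \<Rightarrow> 'k taft" where
  "taft_y N q A \<equiv> taft_gen N q A Gen_y"

text \<open>Comultiplication and counit are the algebra homomorphisms, and the antipode is the algebra
  antihomomorphism (a homomorphism to the opposite algebra), with the following values on
  generators.\<close>

primrec taft_comult_gen ::
  "nat \<Rightarrow> 'k::field \<Rightarrow> int^2^2 \<Rightarrow> gen \<Rightarrow> ('k taft \<times> 'k taft \<Rightarrow>\<^sub>0 'k) set" where
  "taft_comult_gen N q A Gen_g =
    (let H = taft_alg N q A; g = taft_g N q A in tens H H g g)"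
| "taft_comult_gen N q A Gen_x =
    (let H = taft_alg N q A; g = taft_g N q A; x = taft_x N q A in
      tens H H \<one>\<^bsub>H\<^esub> x \<oplus>\<^bsub>tensor_alg H H\<^esub> tens H H x (g [^]\<^bsub>H\<^esub> (A$1$1)))"
| "taft_comult_gen N q A Gen_y =
    (let H = taft_alg N q A; g = taft_g N q A; y = taft_y N q A in
      tens H H \<one>\<^bsub>H\<^esub> y \<oplus>\<^bsub>tensor_alg H H\<^esub> tens H H y (g [^]\<^bsub>H\<^esub> (A$2$1)))"

primrec taft_counit_gen :: "gen \<Rightarrow> 'k::field" where
  "taft_counit_gen Gen_g = 1"
| "taft_counit_gen Gen_x = 0"
| "taft_counit_gen Gen_y = 0"

primrec taft_antipode_gen :: "nat \<Rightarrow> 'k::field \<Rightarrow> int^2^2 \<Rightarrow> gen \<Rightarrow> 'k taft" where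
  "taft_antipode_gen N q A Gen_g = inv\<^bsub>taft_alg N q A\<^esub> (taft_g N q A)"
| "taft_antipode_gen N q A Gen_x =
    (let H = taft_alg N q A in \<ominus>\<^bsub>H\<^esub> (taft_x N q A \<otimes>\<^bsub>H\<^esub> taft_g N q A [^]\<^bsub>H\<^esub> (- (A$1$1))))"
| "taft_antipode_gen N q A Gen_y =
    (let H = taft_alg N q A in \<ominus>\<^bsub>H\<^esub> (taft_y N q A \<otimes>\<^bsub>H\<^esub> taft_g N q A [^]\<^bsub>H\<^esub> (- (A$2$1))))"

definition taft_hopf :: "nat \<Rightarrow> 'k::field \<Rightarrow> int^2^2 \<Rightarrow> ('k, 'k taft) hopf" where
  "taft_hopf N q A =
    (let H = taft_alg N q A in module.extend H (hopf.fields
      (quot_map (free_hom (tensor_alg H H) (taft_comult_gen N q A)))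
      (quot_map (free_hom base_alg taft_counit_gen))
      (quot_map (free_hom (opp_alg H) (taft_antipode_gen N q A)))))"

definition taft_xi :: "nat \<Rightarrow> 'k::field \<Rightarrow> int^2^2 \<Rightarrow> 'k taft \<Rightarrow> 'k" where
  "taft_xi N q A =
    (let H = taft_hopf N q A; g = taft_g N q A; x = taft_x N q A; y = taft_y N q A in
     THE f. f \<in> lin_functionals H \<and>
       (\<forall>i<taft_Nx N A. \<forall>j<taft_Ny N A. \<forall>l<N.
          f (x [^]\<^bsub>H\<^esub> i \<otimes>\<^bsub>H\<^esub> y [^]\<^bsub>H\<^esub> j \<otimes>\<^bsub>H\<^esub> g [^]\<^bsub>H\<^esub> l) =
            (if i = 0 \<and> j = 0 then q powi (- int l) else 0)))"

end

theory Submission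
  imports Defs
begin

text \<open>
  A pair \<open>(l, \<beta>)\<close> is in involution if two maps of \<open>h\<close> agree: the square \<open>S\<^sup>2\<close> of the antipode and
  \<open>h \<mapsto> \<beta>(h\<^sub>3) \<beta>(S h\<^sub>1) l h\<^sub>2 l\<inverse>\<close>. Both are algebra endomorphisms, so it suffices to compare them
  at the generators \<open>g\<close>, \<open>x\<close>, \<open>y\<close> (lemma \<open>pair_condition_iff\<close>). The square of the antipode fixes \<open>g\<close> and
  multiplies \<open>x\<close> by \<open>q powi (a11 a12)\<close>. A character \<open>\<beta>\<close> vanishes at \<open>x\<close>, so of the threefold coproduct
  \<open>1 \<otimes> 1 \<otimes> x + 1 \<otimes> x \<otimes> w + x \<otimes> w \<otimes> w\<close>, where \<open>w\<close> is the power \<open>a11\<close> of \<open>g\<close>, only the middle term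
  contributes, and the second map sends \<open>x\<close> to \<open>\<beta>(w) l x l\<inverse>\<close>. For \<open>\<beta>(g) = q powi c\<close> and for the power
  \<open>l\<close> of \<open>g\<close> with exponent \<open>d\<close> this is \<open>q powi (a11 c + a12 d)\<close> times \<open>x\<close>. The comparison at \<open>x\<close> is thus the
  first congruence and, with the second row of the matrix, the comparison at \<open>y\<close> is the second one.
  The pair is modular if \<open>\<beta>(l) = q powi (c d)\<close> is 1, that is, if \<open>N\<close> divides \<open>c d\<close>.

  For the converse of the first part, a character is determined by its value at \<open>g\<close>, a power of \<open>q\<close>.
  For a group-like element \<open>l\<close> the comparison says that \<open>l x = s x l\<close> for a known scalar \<open>s\<close>, and likewise
  for \<open>y\<close>.
  Evaluation of characters at \<open>l\<close> is multiplicative, so there is an integer \<open>d\<close> such that the character with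
  value \<open>q powi z\<close> at \<open>g\<close> has the value \<open>q powi (d z)\<close> at \<open>l\<close> (lemma \<open>chi_group_like\<close>). A
  representation by triangular two by two matrices, with \<open>x\<close> going to the off-diagonal matrix unit and \<open>g\<close> to the
  diagonal matrix with entries \<open>q powi a12\<close> and 1, then gives \<open>s = q powi (d a12)\<close> (lemma \<open>tri_commute\<close>):
  as far as the condition can see, \<open>l\<close> is the power of \<open>g\<close> with exponent \<open>d\<close>.

  The remaining work is to construct the maps involved. They come from the universal properties of free
  algebras, quotients and tensor products. That the coproduct respects \<open>x ^ Nx = 0\<close> is the binomial
  theorem for elements that commute up to a root of unity of order \<open>Nx\<close> (lemma
  \<open>q_commuting_nilpotent_sum\<close>); the relation between \<open>x\<close> and \<open>y\<close> is respected because of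
  \<open>a11 a22 + a12 a21 = 0\<close>. Group-like elements are invertible by the antipode axiom. The functional \<open>\<xi>\<close> is
  the character with value \<open>q powi (- 1)\<close> at \<open>g\<close>, and it is unique because the monomials span.
\<close>

section \<open>Algebras over a field\<close>

text \<open>Algebras are associative and unital, possibly noncommutative. The scalars are the elements of a
  type, as in the constructions to which this locale is applied.\<close>

locale k_algebra = ring A for A :: "('k::field, 'a, 'z) module_scheme" (structure) +
  assumes smult_closed [simp, intro]: "a \<in> carrier A \<Longrightarrow> c \<odot> a \<in> carrier A"
    and smult_r_distr: "\<lbrakk>a \<in> carrier A; b \<in> carrier A\<rbrakk> \<Longrightarrow> c \<odot> (a \<oplus> b) = c \<odot> a \<oplus> c \<odot> b"
    and smult_l_distr: "a \<in> carrier A \<Longrightarrow> (c + d) \<odot> a = c \<odot> a \<oplus> d \<odot> a"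
    and smult_smult: "a \<in> carrier A \<Longrightarrow> c \<odot> (d \<odot> a) = (c * d) \<odot> a"
    and smult_one [simp]: "a \<in> carrier A \<Longrightarrow> 1 \<odot> a = a"
    and smult_mult_l: "\<lbrakk>a \<in> carrier A; b \<in> carrier A\<rbrakk> \<Longrightarrow> (c \<odot> a) \<otimes> b = c \<odot> (a \<otimes> b)"
    and smult_mult_r: "\<lbrakk>a \<in> carrier A; b \<in> carrier A\<rbrakk> \<Longrightarrow> a \<otimes> (c \<odot> b) = c \<odot> (a \<otimes> b)"

text \<open>The law \<open>0 \<odot> a = \<zero>\<close> takes the place of additive inverses: it makes \<open>(- 1) \<odot> a\<close> an inverse
  of \<open>a\<close>.\<close>

lemma k_algebraI:
  fixes A :: "('k::field, 'a, 'z) module_scheme" (structure)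
  assumes carr: "\<zero> \<in> carrier A" "\<one> \<in> carrier A"
      "\<And>a b. \<lbrakk>a \<in> carrier A; b \<in> carrier A\<rbrakk> \<Longrightarrow> a \<oplus> b \<in> carrier A"
      "\<And>a b. \<lbrakk>a \<in> carrier A; b \<in> carrier A\<rbrakk> \<Longrightarrow> a \<otimes> b \<in> carrier A"
      "\<And>c a. a \<in> carrier A \<Longrightarrow> c \<odot> a \<in> carrier A"
    and add: "\<And>a b c. \<lbrakk>a \<in> carrier A; b \<in> carrier A; c \<in> carrier A\<rbrakk> \<Longrightarrow> (a \<oplus> b) \<oplus> c = a \<oplus> (b \<oplus> c)"
      "\<And>a b. \<lbrakk>a \<in> carrier A; b \<in> carrier A\<rbrakk> \<Longrightarrow> a \<oplus> b = b \<oplus> a"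
      "\<And>a. a \<in> carrier A \<Longrightarrow> \<zero> \<oplus> a = a"
      "\<And>a. a \<in> carrier A \<Longrightarrow> 0 \<odot> a = \<zero>"
    and mult: "\<And>a b c. \<lbrakk>a \<in> carrier A; b \<in> carrier A; c \<in> carrier A\<rbrakk> \<Longrightarrow> (a \<otimes> b) \<otimes> c = a \<otimes> (b \<otimes> c)"
      "\<And>a. a \<in> carrier A \<Longrightarrow> \<one> \<otimes> a = a"
      "\<And>a. a \<in> carrier A \<Longrightarrow> a \<otimes> \<one> = a"
      "\<And>a b c. \<lbrakk>a \<in> carrier A; b \<in> carrier A; c \<in> carrier A\<rbrakk> \<Longrightarrow> (a \<oplus> b) \<otimes> c = a \<otimes> c \<oplus> b \<otimes> c"
      "\<And>a b c. \<lbrakk>a \<in> carrier A; b \<in> carrier A; c \<in> carrier A\<rbrakk> \<Longrightarrow> c \<otimes> (a \<oplus> b) = c \<otimes> a \<oplus> c \<otimes> b"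
    and smult: "\<And>a b c. \<lbrakk>a \<in> carrier A; b \<in> carrier A\<rbrakk> \<Longrightarrow> c \<odot> (a \<oplus> b) = c \<odot> a \<oplus> c \<odot> b"
      "\<And>a c d. a \<in> carrier A \<Longrightarrow> (c + d) \<odot> a = c \<odot> a \<oplus> d \<odot> a"
      "\<And>a c d. a \<in> carrier A \<Longrightarrow> c \<odot> (d \<odot> a) = (c * d) \<odot> a"
      "\<And>a. a \<in> carrier A \<Longrightarrow> 1 \<odot> a = a"
      "\<And>a b c. \<lbrakk>a \<in> carrier A; b \<in> carrier A\<rbrakk> \<Longrightarrow> (c \<odot> a) \<otimes> b = c \<odot> (a \<otimes> b)"
      "\<And>a b c. \<lbrakk>a \<in> carrier A; b \<in> carrier A\<rbrakk> \<Longrightarrow> a \<otimes> (c \<odot> b) = c \<odot> (a \<otimes> b)"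
  shows "k_algebra A"
proof -
  have neg: "(- 1) \<odot> a \<oplus> a = \<zero>" if "a \<in> carrier A" for a
    using that smult(2)[of a "-1" 1] add(4) smult(4) by simp
  have "abelian_group A"
  proof (rule abelian_groupI)
    show "\<exists>y\<in>carrier A. y \<oplus> x = \<zero>" if "x \<in> carrier A" for x
      using neg[OF that] carr(5)[OF that] by blast
  qed (use carr add in auto)
  moreover have "monoid A"
    by (rule monoidI) (use carr mult in auto)
  ultimately have "ring A"
    by (rule ringI) (use mult in auto)
  then show ?thesis
    by (intro k_algebra.intro k_algebra_axioms.intro) (use carr smult in auto)
qed

context k_algebra
begin

lemma zero_smult [simp]: "a \<in> carrier A \<Longrightarrow> 0 \<odot> a = \<zero>"
  using smult_l_distr[of a 0 0] smult_closed[of a 0] by (simp add: add.l_cancel_one)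

lemma smult_zero [simp]: "c \<odot> \<zero> = \<zero>"
  using smult_r_distr[of \<zero> \<zero> c] smult_closed[of \<zero> c] by (simp add: add.l_cancel_one)

lemma a_inv_eq_smult: "a \<in> carrier A \<Longrightarrow> \<ominus> a = (- 1) \<odot> a"
proof -
  assume a: "a \<in> carrier A"
  have "(- 1) \<odot> a \<oplus> a = \<zero>"
    using smult_l_distr[OF a, of "-1" 1] a by simp
  then show ?thesis
    using a by (metis minus_equality smult_closed)
qed

lemma a_minus_eq_smult: "a \<in> carrier A \<Longrightarrow> b \<in> carrier A \<Longrightarrow> a \<ominus> b = a \<oplus> (- 1) \<odot> b"
  by (simp add: a_minus_def a_inv_eq_smult)

lemma smult_finsum:
  assumes "finite X" "f \<in> X \<rightarrow> carrier A"
  shows "c \<odot> (\<Oplus>i\<in>X. f i) = (\<Oplus>i\<in>X. c \<odot> f i)"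
  using assms
proof (induction rule: finite_induct)
  case empty
  then show ?case by simp
next
  case (insert x F)
  then have "f \<in> F \<rightarrow> carrier A" "f x \<in> carrier A" "(\<lambda>i. c \<odot> f i) \<in> F \<rightarrow> carrier A"
    by auto
  with insert show ?case
    by (simp add: finsum_insert smult_r_distr finsum_closed)
qed

lemma nat_pow_smult:
  "a \<in> carrier A \<Longrightarrow> (c \<odot> a) [^] (n::nat) = (c ^ n) \<odot> (a [^] n)"
  by (induction n) (auto simp: smult_mult_l smult_mult_r smult_smult mult.commute)

end

lemma k_algebra_base_alg: "k_algebra (base_alg :: ('k::field, 'k) module)"
  by (rule k_algebraI) (auto simp: base_alg_def algebra_simps)

lemma k_algebra_opp_alg:
  assumes "k_algebra A"
  shows "k_algebra (opp_alg A)"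
proof -
  interpret k_algebra A by fact
  show ?thesis
    by (rule k_algebraI)
      (auto simp: opp_alg_def a_assoc m_assoc l_distr r_distr smult_r_distr smult_l_distr smult_smult
        smult_mult_l smult_mult_r a_comm a_lcomm)
qed

lemma opp_alg_simps [simp]:
  "carrier (opp_alg A) = carrier A" "a \<otimes>\<^bsub>opp_alg A\<^esub> b = b \<otimes>\<^bsub>A\<^esub> a" "\<one>\<^bsub>opp_alg A\<^esub> = \<one>\<^bsub>A\<^esub>"
  "\<zero>\<^bsub>opp_alg A\<^esub> = \<zero>\<^bsub>A\<^esub>" "a \<oplus>\<^bsub>opp_alg A\<^esub> b = a \<oplus>\<^bsub>A\<^esub> b" "c \<odot>\<^bsub>opp_alg A\<^esub> a = c \<odot>\<^bsub>A\<^esub> a"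
  by (simp_all add: opp_alg_def)

lemma base_alg_simps [simp]:
  "carrier base_alg = UNIV" "a \<otimes>\<^bsub>base_alg\<^esub> b = a * b" "\<one>\<^bsub>base_alg\<^esub> = 1"
  "\<zero>\<^bsub>base_alg\<^esub> = 0" "a \<oplus>\<^bsub>base_alg\<^esub> b = a + b" "c \<odot>\<^bsub>base_alg\<^esub> a = c * a"
  by (simp_all add: base_alg_def)

lemma base_alg_pow [simp]: "a [^]\<^bsub>base_alg\<^esub> (n::nat) = a ^ n"
  by (induction n) (simp_all add: mult.commute nat_pow_def base_alg_def)

lemma opp_alg_pow:
  assumes "k_algebra A" "a \<in> carrier A"
  shows "a [^]\<^bsub>opp_alg A\<^esub> (n::nat) = a [^]\<^bsub>A\<^esub> n"
proof -
  interpret k_algebra A by fact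
  interpret O: k_algebra "opp_alg A" by (rule k_algebra_opp_alg) fact
  show ?thesis
  proof (induction n)
    case (Suc n)
    then show ?case using assms(2) nat_pow_Suc2[OF assms(2), of n] by simp
  qed simp
qed

section \<open>Linear maps and algebra homomorphisms\<close>

definition k_linear ::
  "('k::field, 'a, 'y) module_scheme \<Rightarrow> ('k, 'b, 'z) module_scheme \<Rightarrow> ('a \<Rightarrow> 'b) \<Rightarrow> bool" where
  "k_linear A B f \<longleftrightarrow> f \<in> carrier A \<rightarrow> carrier B \<and>
     (\<forall>a\<in>carrier A. \<forall>b\<in>carrier A. f (a \<oplus>\<^bsub>A\<^esub> b) = f a \<oplus>\<^bsub>B\<^esub> f b) \<and>
     (\<forall>c. \<forall>a\<in>carrier A. f (c \<odot>\<^bsub>A\<^esub> a) = c \<odot>\<^bsub>B\<^esub> f a)"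

definition k_alg_hom ::
  "('k::field, 'a, 'y) module_scheme \<Rightarrow> ('k, 'b, 'z) module_scheme \<Rightarrow> ('a \<Rightarrow> 'b) \<Rightarrow> bool" where
  "k_alg_hom A B f \<longleftrightarrow> k_linear A B f \<and> f \<one>\<^bsub>A\<^esub> = \<one>\<^bsub>B\<^esub> \<and>
     (\<forall>a\<in>carrier A. \<forall>b\<in>carrier A. f (a \<otimes>\<^bsub>A\<^esub> b) = f a \<otimes>\<^bsub>B\<^esub> f b)"

lemma k_linearI:
  assumes "\<And>a. a \<in> carrier A \<Longrightarrow> f a \<in> carrier B"
    "\<And>a b. \<lbrakk>a \<in> carrier A; b \<in> carrier A\<rbrakk> \<Longrightarrow> f (a \<oplus>\<^bsub>A\<^esub> b) = f a \<oplus>\<^bsub>B\<^esub> f b"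
    "\<And>c a. a \<in> carrier A \<Longrightarrow> f (c \<odot>\<^bsub>A\<^esub> a) = c \<odot>\<^bsub>B\<^esub> f a"
  shows "k_linear A B f"
  using assms by (auto simp: k_linear_def)

lemma k_linearD:
  assumes "k_linear A B f"
  shows "a \<in> carrier A \<Longrightarrow> f a \<in> carrier B"
    "\<lbrakk>a \<in> carrier A; b \<in> carrier A\<rbrakk> \<Longrightarrow> f (a \<oplus>\<^bsub>A\<^esub> b) = f a \<oplus>\<^bsub>B\<^esub> f b"
    "a \<in> carrier A \<Longrightarrow> f (c \<odot>\<^bsub>A\<^esub> a) = c \<odot>\<^bsub>B\<^esub> f a"
  using assms by (auto simp: k_linear_def)

lemma k_alg_homI:
  assumes "k_linear A B f" "f \<one>\<^bsub>A\<^esub> = \<one>\<^bsub>B\<^esub>"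
    "\<And>a b. \<lbrakk>a \<in> carrier A; b \<in> carrier A\<rbrakk> \<Longrightarrow> f (a \<otimes>\<^bsub>A\<^esub> b) = f a \<otimes>\<^bsub>B\<^esub> f b"
  shows "k_alg_hom A B f"
  using assms by (auto simp: k_alg_hom_def)

lemma k_alg_homD:
  assumes "k_alg_hom A B f"
  shows "k_linear A B f" "f \<one>\<^bsub>A\<^esub> = \<one>\<^bsub>B\<^esub>"
    "\<lbrakk>a \<in> carrier A; b \<in> carrier A\<rbrakk> \<Longrightarrow> f (a \<otimes>\<^bsub>A\<^esub> b) = f a \<otimes>\<^bsub>B\<^esub> f b"
    "a \<in> carrier A \<Longrightarrow> f a \<in> carrier B"
    "\<lbrakk>a \<in> carrier A; b \<in> carrier A\<rbrakk> \<Longrightarrow> f (a \<oplus>\<^bsub>A\<^esub> b) = f a \<oplus>\<^bsub>B\<^esub> f b"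
    "a \<in> carrier A \<Longrightarrow> f (c \<odot>\<^bsub>A\<^esub> a) = c \<odot>\<^bsub>B\<^esub> f a"
  using assms by (auto simp: k_alg_hom_def k_linear_def)

lemma k_linear_comp:
  "\<lbrakk>k_linear A B f; k_linear B C h\<rbrakk> \<Longrightarrow> k_linear A C (\<lambda>a. h (f a))"
  by (auto simp: k_linear_def Pi_def)

lemma k_alg_hom_comp:
  "\<lbrakk>k_alg_hom A B f; k_alg_hom B C h\<rbrakk> \<Longrightarrow> k_alg_hom A C (\<lambda>a. h (f a))"
  by (auto simp: k_alg_hom_def k_linear_def Pi_def)

lemma k_linear_zero:
  assumes "k_algebra A" "k_algebra B" "k_linear A B f"
  shows "f \<zero>\<^bsub>A\<^esub> = \<zero>\<^bsub>B\<^esub>"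
proof -
  interpret A: k_algebra A by fact
  interpret B: k_algebra B by fact
  have "f (0 \<odot>\<^bsub>A\<^esub> \<zero>\<^bsub>A\<^esub>) = 0 \<odot>\<^bsub>B\<^esub> f \<zero>\<^bsub>A\<^esub>"
    using k_linearD(3)[OF assms(3), of "\<zero>\<^bsub>A\<^esub>" 0] by simp
  then show ?thesis
    using k_linearD(1)[OF assms(3)] by simp
qed

lemma k_linear_minus:
  assumes "k_algebra A" "k_algebra B" "k_linear A B f" "a \<in> carrier A" "b \<in> carrier A"
  shows "f (a \<ominus>\<^bsub>A\<^esub> b) = f a \<ominus>\<^bsub>B\<^esub> f b"
proof -
  interpret A: k_algebra A by fact
  interpret B: k_algebra B by fact
  show ?thesis
    using k_linearD[OF assms(3)] assms(4,5) by (simp add: A.a_minus_eq_smult B.a_minus_eq_smult)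
qed

lemma k_alg_hom_pow:
  assumes "k_algebra A" "k_algebra B" "k_alg_hom A B f" "a \<in> carrier A"
  shows "f (a [^]\<^bsub>A\<^esub> (n::nat)) = f a [^]\<^bsub>B\<^esub> n"
proof -
  interpret A: k_algebra A by fact
  interpret B: k_algebra B by fact
  show ?thesis
    by (induction n) (use k_alg_homD[OF assms(3)] assms(4) in simp_all)
qed

section \<open>Linear combinations of monoid elements\<close>

text \<open>The single terms and the partial sums all keep their keys in \<open>X\<close>, so that carrier conditions are
  available in every case of the induction.\<close>

lemma pm_induct_on [consumes 1, case_names zero single add]:
  fixes f :: "'m \<Rightarrow>\<^sub>0 'k::field"
  assumes "Poly_Mapping.keys f \<subseteq> X"
    and zero: "P 0"
    and single: "\<And>m c. m \<in> X \<Longrightarrow> P (Poly_Mapping.single m c)"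
    and add: "\<And>f h. \<lbrakk>Poly_Mapping.keys f \<subseteq> X; Poly_Mapping.keys h \<subseteq> X; P f; P h\<rbrakk> \<Longrightarrow> P (f + h)"
  shows "P f"
proof -
  have "P (\<Sum>m\<in>Y. Poly_Mapping.single m (Poly_Mapping.lookup f m)) \<and>
      Poly_Mapping.keys (\<Sum>m\<in>Y. Poly_Mapping.single m (Poly_Mapping.lookup f m)) \<subseteq> X"
    if "finite Y" "Y \<subseteq> X" for Y
    using that
  proof (induction rule: finite_induct)
    case empty
    then show ?case by (simp add: zero)
  next
    case (insert x F)
    let ?s = "Poly_Mapping.single x (Poly_Mapping.lookup f x)"
    have "Poly_Mapping.keys ?s \<subseteq> X"
      using insert by auto
    then show ?case
      using insert by (auto intro!: add single dest!: subsetD[OF keys_add])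
  qed
  from this[of "Poly_Mapping.keys f"] assms(1)
  have "P (\<Sum>m\<in>Poly_Mapping.keys f. Poly_Mapping.single m (Poly_Mapping.lookup f m))"
    by simp
  moreover have "(\<Sum>m\<in>Poly_Mapping.keys f. Poly_Mapping.single m (Poly_Mapping.lookup f m)) = f"
    by (rule poly_mapping_eqI)
      (auto simp: lookup_sum lookup_single when_def in_keys_iff)
  ultimately show ?thesis by simp
qed

lemma keys_pm_scale: "Poly_Mapping.keys (pm_scale c f) \<subseteq> Poly_Mapping.keys f"
  by (auto simp: in_keys_iff lookup_pm_scale)

lemma pm_scale_simps:
  "pm_scale c (f + h) = pm_scale c f + pm_scale c h"
  "pm_scale (c + d) f = pm_scale c f + pm_scale d f"
  "pm_scale c (pm_scale d f) = pm_scale (c * d) f"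
  "pm_scale 1 f = f" "pm_scale 0 f = 0" "pm_scale c 0 = 0"
  "pm_scale c (Poly_Mapping.single m d) = Poly_Mapping.single m (c * d)"
  by (auto intro!: poly_mapping_eqI simp: lookup_add lookup_pm_scale algebra_simps lookup_single when_def)

lemma monoid_alg_simps [simp]:
  "carrier (monoid_alg M) = {f. Poly_Mapping.keys f \<subseteq> carrier M}"
  "\<one>\<^bsub>monoid_alg M\<^esub> = Poly_Mapping.single \<one>\<^bsub>M\<^esub> 1" "\<zero>\<^bsub>monoid_alg M\<^esub> = 0"
  "f \<oplus>\<^bsub>monoid_alg M\<^esub> h = f + h" "c \<odot>\<^bsub>monoid_alg M\<^esub> f = pm_scale c f"
  by (simp_all add: monoid_alg_def)

lemma monoid_alg_mult:
  "f \<otimes>\<^bsub>monoid_alg M\<^esub> h = (\<Sum>a\<in>Poly_Mapping.keys f. \<Sum>b\<in>Poly_Mapping.keys h.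
        Poly_Mapping.single (a \<otimes>\<^bsub>M\<^esub> b) (Poly_Mapping.lookup f a * Poly_Mapping.lookup h b))"
  by (simp add: monoid_alg_def)

lemma monoid_alg_mult_single [simp]:
  "Poly_Mapping.single a c \<otimes>\<^bsub>monoid_alg M\<^esub> Poly_Mapping.single b d =
    Poly_Mapping.single (a \<otimes>\<^bsub>M\<^esub> b) (c * d)"
  by (simp add: monoid_alg_mult)

lemma monoid_alg_mult_add_left:
  "(f + f') \<otimes>\<^bsub>monoid_alg M\<^esub> h = f \<otimes>\<^bsub>monoid_alg M\<^esub> h + f' \<otimes>\<^bsub>monoid_alg M\<^esub> h"
  unfolding monoid_alg_mult
  by (rule setsum_keys_plus_distrib)
    (simp_all add: distrib_right single_add sum.distrib)

lemma monoid_alg_mult_add_right: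
  "h \<otimes>\<^bsub>monoid_alg M\<^esub> (f + f') = h \<otimes>\<^bsub>monoid_alg M\<^esub> f + h \<otimes>\<^bsub>monoid_alg M\<^esub> f'"
  unfolding monoid_alg_mult sum.distrib[symmetric]
  by (rule sum.cong[OF refl], rule setsum_keys_plus_distrib)
    (simp_all add: distrib_left single_add)

lemma monoid_alg_mult_zero [simp]:
  "0 \<otimes>\<^bsub>monoid_alg M\<^esub> f = 0" "f \<otimes>\<^bsub>monoid_alg M\<^esub> 0 = 0"
  by (simp_all add: monoid_alg_mult)

text \<open>Each law is additive in every argument, which reduces it to singletons, where it is a law of the
  monoid.\<close>

lemma k_algebra_monoid_alg:
  fixes M :: "('m, 'z) monoid_scheme"
  assumes "monoid M"
  shows "k_algebra (monoid_alg M :: ('k::field, 'm \<Rightarrow>\<^sub>0 'k) module)"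
proof -
  interpret monoid M by fact
  let ?A = "monoid_alg M :: ('k, 'm \<Rightarrow>\<^sub>0 'k) module"
  note dist = monoid_alg_mult_add_left monoid_alg_mult_add_right
  let ?K = "\<lambda>f :: 'm \<Rightarrow>\<^sub>0 'k. Poly_Mapping.keys f \<subseteq> carrier M"
  have closed: "?K (f \<otimes>\<^bsub>?A\<^esub> h)" if "?K f" "?K h" for f h
    using that(1)
  proof (induction rule: pm_induct_on)
    case (single m c)
    show ?case using that(2)
      by (induction rule: pm_induct_on)
        (use single in \<open>auto simp: dist dest!: subsetD[OF keys_add] split: if_splits\<close>)
  qed (auto simp: dist dest!: subsetD[OF keys_add])
  have assoc: "(f \<otimes>\<^bsub>?A\<^esub> h) \<otimes>\<^bsub>?A\<^esub> k = f \<otimes>\<^bsub>?A\<^esub> (h \<otimes>\<^bsub>?A\<^esub> k)" if "?K f" "?K h" "?K k" for f h k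
    using that(1)
  proof (induction rule: pm_induct_on)
    case (single m c)
    show ?case using that(2)
    proof (induction rule: pm_induct_on)
      case (single m' c')
      show ?case using that(3)
        by (induction rule: pm_induct_on)
          (use \<open>m \<in> carrier M\<close> single in \<open>auto simp: dist m_assoc mult.assoc\<close>)
    qed (auto simp: dist)
  qed (auto simp: dist)
  have scale_left: "pm_scale c f \<otimes>\<^bsub>?A\<^esub> h = pm_scale c (f \<otimes>\<^bsub>?A\<^esub> h)" if "?K f" "?K h" for c f h
    using that(1)
  proof (induction rule: pm_induct_on)
    case (single m d)
    show ?case using that(2)
      by (induction rule: pm_induct_on) (auto simp: dist pm_scale_simps mult.assoc)
  qed (auto simp: dist pm_scale_simps)
  have scale_right: "f \<otimes>\<^bsub>?A\<^esub> pm_scale c h = pm_scale c (f \<otimes>\<^bsub>?A\<^esub> h)" if "?K f" "?K h" for c f h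
    using that(1)
  proof (induction rule: pm_induct_on)
    case (single m d)
    show ?case using that(2)
      by (induction rule: pm_induct_on) (auto simp: dist pm_scale_simps mult.left_commute)
  qed (auto simp: dist pm_scale_simps)
  have one: "Poly_Mapping.single \<one>\<^bsub>M\<^esub> 1 \<otimes>\<^bsub>?A\<^esub> f = f" "f \<otimes>\<^bsub>?A\<^esub> Poly_Mapping.single \<one>\<^bsub>M\<^esub> 1 = f"
    if "?K f" for f
    using that by (induction rule: pm_induct_on) (auto simp: dist)
  show ?thesis
    by (rule k_algebraI)
      (auto simp: closed assoc one dist scale_left scale_right pm_scale_simps algebra_simps
        subsetD[OF keys_pm_scale] dest!: subsetD[OF keys_add] subsetD[OF keys_pm_scale] split: if_splits
        intro: subsetD[OF closed, rotated 2])
qed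

text \<open>The sum over the keys may be extended to any finite superset of them. On the union of the keys
  of two elements additivity holds term by term.\<close>

lemma (in k_algebra) lin_ext_linear:
  assumes "\<phi> \<in> carrier M \<rightarrow> carrier A"
  shows "k_linear (monoid_alg M) A (lin_ext A \<phi>)"
proof (rule k_linearI)
  have ext: "lin_ext A \<phi> f = (\<Oplus>m\<in>Y. Poly_Mapping.lookup f m \<odot> \<phi> m)"
    if "Poly_Mapping.keys f \<subseteq> Y" "finite Y" "Y \<subseteq> carrier M" for f Y
    unfolding lin_ext_def
    using that assms
    by (intro add.finprod_mono_neutral_cong_left) (auto simp: in_keys_iff subset_iff Pi_iff)
  show closed: "lin_ext A \<phi> f \<in> carrier A" if "f \<in> carrier (monoid_alg M)" for f
    unfolding lin_ext_def using that assms by (intro finsum_closed) auto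
  show "lin_ext A \<phi> (f \<oplus>\<^bsub>monoid_alg M\<^esub> h) = lin_ext A \<phi> f \<oplus> lin_ext A \<phi> h"
    if "f \<in> carrier (monoid_alg M)" "h \<in> carrier (monoid_alg M)" for f h
  proof -
    let ?Y = "Poly_Mapping.keys f \<union> Poly_Mapping.keys h"
    have Y: "finite ?Y" "?Y \<subseteq> carrier M" "Poly_Mapping.keys f \<subseteq> ?Y" "Poly_Mapping.keys h \<subseteq> ?Y"
        "Poly_Mapping.keys (f + h) \<subseteq> ?Y"
      using that keys_add[of f h] by auto
    have P: "(\<lambda>m. Poly_Mapping.lookup f m \<odot> \<phi> m) \<in> ?Y \<rightarrow> carrier A"
       "(\<lambda>m. Poly_Mapping.lookup h m \<odot> \<phi> m) \<in> ?Y \<rightarrow> carrier A"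
      using Y assms by (auto simp: subset_iff)
    have "lin_ext A \<phi> (f + h) = (\<Oplus>m\<in>?Y. Poly_Mapping.lookup f m \<odot> \<phi> m \<oplus> Poly_Mapping.lookup h m \<odot> \<phi> m)"
      unfolding ext[OF Y(5,1,2)]
      using Y assms
      by (intro finsum_cong') (auto simp: subset_iff lookup_add Pi_iff intro!: smult_l_distr)
    then show ?thesis
      using ext[OF Y(3,1,2)] ext[OF Y(4,1,2)] finsum_addf[OF P] by simp
  qed
  show "lin_ext A \<phi> (c \<odot>\<^bsub>monoid_alg M\<^esub> f) = c \<odot> lin_ext A \<phi> f"
    if "f \<in> carrier (monoid_alg M)" for c f
  proof -
    let ?Y = "Poly_Mapping.keys f"
    have Y: "finite ?Y" "?Y \<subseteq> carrier M" using that by auto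
    have "lin_ext A \<phi> (pm_scale c f) = (\<Oplus>m\<in>?Y. c \<odot> (Poly_Mapping.lookup f m \<odot> \<phi> m))"
      unfolding ext[OF keys_pm_scale Y]
      using Y assms by (intro finsum_cong') (auto simp: subset_iff lookup_pm_scale Pi_iff smult_smult)
    also have "\<dots> = c \<odot> lin_ext A \<phi> f"
      unfolding lin_ext_def using Y assms by (intro smult_finsum[symmetric]) (auto simp: subset_iff)
    finally show ?thesis by simp
  qed
qed

lemma (in k_algebra) lin_ext_single [simp]:
  assumes "\<phi> m \<in> carrier A"
  shows "lin_ext A \<phi> (Poly_Mapping.single m c) = c \<odot> \<phi> m"
  using assms by (simp add: lin_ext_def)

text \<open>Monoid elements span the monoid algebra.\<close>

lemma monoid_alg_linear_eqI:
  assumes "k_algebra B" "k_linear (monoid_alg M) B f" "k_linear (monoid_alg M) B h"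
    and "monoid M"
    and eq: "\<And>m. m \<in> carrier M \<Longrightarrow> f (Poly_Mapping.single m 1) = h (Poly_Mapping.single m 1)"
    and v: "v \<in> carrier (monoid_alg M)"
  shows "f v = h v"
proof -
  have "Poly_Mapping.keys v \<subseteq> carrier M"
    using v by simp
  then show ?thesis
  proof (induction rule: pm_induct_on)
    case zero
    show ?case
      using k_linear_zero[OF k_algebra_monoid_alg[OF assms(4)] assms(1)] assms(2,3)
      by (metis monoid_alg_simps(3))
  next
    case (single m c)
    then have s: "Poly_Mapping.single m 1 \<in> carrier (monoid_alg M)"
      by simp
    have "Poly_Mapping.single m c = c \<odot>\<^bsub>monoid_alg M\<^esub> Poly_Mapping.single m 1"
      by (simp add: pm_scale_simps)
    then show ?case
      using k_linearD(3)[OF assms(2) s] k_linearD(3)[OF assms(3) s] eq[OF single] by metis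
  next
    case (add f' h')
    then show ?case
      using k_linearD(2)[OF assms(2), of f' h'] k_linearD(2)[OF assms(3), of f' h'] by simp
  qed
qed

text \<open>Both sides of multiplicativity are linear in each factor, so monoid elements suffice.\<close>

lemma (in k_algebra) lin_ext_alg_hom:
  fixes M :: "('m, 'w) monoid_scheme"
  assumes "monoid M" and \<phi>: "\<phi> \<in> carrier M \<rightarrow> carrier A" and one: "\<phi> \<one>\<^bsub>M\<^esub> = \<one>"
    and mult: "\<And>a b. \<lbrakk>a \<in> carrier M; b \<in> carrier M\<rbrakk> \<Longrightarrow> \<phi> (a \<otimes>\<^bsub>M\<^esub> b) = \<phi> a \<otimes> \<phi> b"
  shows "k_alg_hom (monoid_alg M) A (lin_ext A \<phi>)"
proof (rule k_alg_homI)
  interpret M: monoid M by fact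
  interpret MA: k_algebra "monoid_alg M :: ('k, 'm \<Rightarrow>\<^sub>0 'k) module" by (rule k_algebra_monoid_alg) fact
  show lin: "k_linear (monoid_alg M) A (lin_ext A \<phi>)"
    by (rule lin_ext_linear) fact
  note L = k_linearD[OF lin]
  show "lin_ext A \<phi> \<one>\<^bsub>monoid_alg M\<^esub> = \<one>"
    using one by simp
  fix f h :: "'m \<Rightarrow>\<^sub>0 'k" assume f: "f \<in> carrier (monoid_alg M)" and h: "h \<in> carrier (monoid_alg M)"
  have single: "lin_ext A \<phi> (Poly_Mapping.single m 1 \<otimes>\<^bsub>monoid_alg M\<^esub> h) =
      lin_ext A \<phi> (Poly_Mapping.single m 1) \<otimes> lin_ext A \<phi> h" if m: "m \<in> carrier M" for m
  proof (rule monoid_alg_linear_eqI[OF k_algebra_axioms _ _ assms(1) _ h])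
    have [simp]: "Poly_Mapping.single m 1 \<in> carrier (monoid_alg M)"
      using m by simp
    show "k_linear (monoid_alg M) A (\<lambda>h. lin_ext A \<phi> (Poly_Mapping.single m 1 \<otimes>\<^bsub>monoid_alg M\<^esub> h))"
      by (rule k_linearI)
        (simp_all only: MA.r_distr MA.smult_mult_r L MA.m_closed \<open>Poly_Mapping.single m 1 \<in> _\<close>)
    show "k_linear (monoid_alg M) A (\<lambda>h. lin_ext A \<phi> (Poly_Mapping.single m 1) \<otimes> lin_ext A \<phi> h)"
      by (rule k_linearI)
        (simp_all only: r_distr smult_mult_r L m_closed \<open>Poly_Mapping.single m 1 \<in> _\<close>)
  qed (use m mult \<phi> in \<open>auto simp: Pi_iff\<close>)
  show "lin_ext A \<phi> (f \<otimes>\<^bsub>monoid_alg M\<^esub> h) = lin_ext A \<phi> f \<otimes> lin_ext A \<phi> h"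
  proof (rule monoid_alg_linear_eqI[OF k_algebra_axioms _ _ assms(1) _ f])
    show "k_linear (monoid_alg M) A (\<lambda>f. lin_ext A \<phi> (f \<otimes>\<^bsub>monoid_alg M\<^esub> h))"
      by (rule k_linearI) (simp_all only: MA.l_distr MA.smult_mult_l L MA.m_closed h)
    show "k_linear (monoid_alg M) A (\<lambda>f. lin_ext A \<phi> f \<otimes> lin_ext A \<phi> h)"
      by (rule k_linearI) (simp_all only: l_distr smult_mult_l L m_closed h)
  qed (rule single)
qed

section \<open>Quotients by ideals\<close>

locale k_algebra_ideal = k_algebra A + ideal J A
  for A :: "('k::field, 'a, 'z) module_scheme" (structure) and J
begin

lemma quot_alg_simps [simp]:
  "carrier (quot_alg A J) = (\<lambda>a. J +> a) ` carrier A"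
  "\<one>\<^bsub>quot_alg A J\<^esub> = J +> \<one>" "\<zero>\<^bsub>quot_alg A J\<^esub> = J +> \<zero>"
  "\<lbrakk>a \<in> carrier A; b \<in> carrier A\<rbrakk> \<Longrightarrow> (J +> a) \<oplus>\<^bsub>quot_alg A J\<^esub> (J +> b) = J +> (a \<oplus> b)"
  "\<lbrakk>a \<in> carrier A; b \<in> carrier A\<rbrakk> \<Longrightarrow> (J +> a) \<otimes>\<^bsub>quot_alg A J\<^esub> (J +> b) = J +> (a \<otimes> b)"
  using a_rcos_zero[OF is_ideal additive_subgroup.zero_closed[OF is_additive_subgroup]]
  by (auto simp: quot_alg_def ring.extend_def FactRing_def A_RCOSETS_def RCOSETS_def
      a_r_coset_def[symmetric] rcoset_mult_add a_rcos_sum)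

lemma smult_in_ideal: "a \<in> J \<Longrightarrow> c \<odot> a \<in> J"
  using I_l_closed[of a "c \<odot> \<one>"] Icarr[of a] by (simp add: smult_mult_l)

lemma coset_eq_iff: "\<lbrakk>a \<in> carrier A; b \<in> carrier A\<rbrakk> \<Longrightarrow> J +> a = J +> b \<longleftrightarrow> a \<ominus> b \<in> J"
  using quotient_eq_iff_same_a_r_cos[OF is_ideal] by blast

text \<open>Scalar multiplication of a coset is a union over all its representatives; these all give the same
  coset because an ideal is closed under scalars.\<close>

lemma quot_alg_smult [simp]:
  assumes "a \<in> carrier A"
  shows "c \<odot>\<^bsub>quot_alg A J\<^esub> (J +> a) = J +> (c \<odot> a)"
proof -
  have "J +> (c \<odot> x) = J +> (c \<odot> a)" if "x \<in> J +> a" for x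
  proof -
    from that obtain j where j: "j \<in> J" "x = j \<oplus> a"
      by (auto simp: a_r_coset_def r_coset_def)
    then have "c \<odot> x \<in> J +> (c \<odot> a)"
      using assms by (auto simp: smult_r_distr Icarr a_r_coset_def r_coset_def intro!: smult_in_ideal)
    then show ?thesis
      using assms a_repr_independence' by blast
  qed
  moreover have "a \<in> J +> a"
    using assms a_rcos_self by blast
  ultimately have "(\<Union>x\<in>J +> a. J +> (c \<odot> x)) = J +> (c \<odot> a)"
    by blast
  then show ?thesis
    by (simp add: quot_alg_def ring.extend_def module.fields_def)
qed

lemma k_algebra_quot_alg: "k_algebra (quot_alg A J)"
  by (rule k_algebraI)
    (auto simp: a_ac m_assoc l_distr r_distr smult_r_distr smult_l_distr smult_smult
      smult_mult_l smult_mult_r)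

lemma coset_alg_hom: "k_alg_hom A (quot_alg A J) (\<lambda>a. J +> a)"
  by (intro k_alg_homI k_linearI) auto

lemma quot_map_coset:
  assumes "k_algebra B" "k_linear A B f" "\<And>j. j \<in> J \<Longrightarrow> f j = \<zero>\<^bsub>B\<^esub>" "a \<in> carrier A"
  shows "quot_map f (J +> a) = f a"
proof -
  interpret B: k_algebra B by fact
  note L = k_linearD[OF assms(2)]
  have "f x = f a" if "x \<in> J +> a" for x
  proof -
    from that obtain j where "j \<in> J" "x = j \<oplus> a"
      by (auto simp: a_r_coset_def r_coset_def)
    then show ?thesis
      using assms(3,4) L by (simp add: Icarr)
  qed
  moreover have "a \<in> J +> a"
    using assms a_rcos_self by blast
  ultimately have "f ` (J +> a) = {f a}"
    by blast
  then show ?thesis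
    by (simp add: quot_map_def)
qed

lemma quot_map_linear:
  assumes "k_algebra B" "k_linear A B f" "\<And>j. j \<in> J \<Longrightarrow> f j = \<zero>\<^bsub>B\<^esub>"
  shows "k_linear (quot_alg A J) B (quot_map f)"
  using k_linearD[OF assms(2)]
  by (intro k_linearI) (auto simp: quot_map_coset[OF assms])

lemma quot_map_alg_hom:
  assumes "k_algebra B" "k_alg_hom A B f" "\<And>j. j \<in> J \<Longrightarrow> f j = \<zero>\<^bsub>B\<^esub>"
  shows "k_alg_hom (quot_alg A J) B (quot_map f)"
proof -
  note lin = k_alg_homD(1)[OF assms(2)]
  show ?thesis
    using k_alg_homD[OF assms(2)]
    by (intro k_alg_homI quot_map_linear[OF assms(1) lin assms(3)])
      (auto simp: quot_map_coset[OF assms(1) lin assms(3)])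
qed

end

section \<open>Tensor products\<close>

definition k_bilinear ::
  "('k::field, 'a, 'x) module_scheme \<Rightarrow> ('k, 'b, 'y) module_scheme \<Rightarrow> ('k, 'u, 'z) module_scheme
    \<Rightarrow> ('a \<Rightarrow> 'b \<Rightarrow> 'u) \<Rightarrow> bool" where
  "k_bilinear A B U \<phi> \<longleftrightarrow> (\<forall>a\<in>carrier A. k_linear B U (\<phi> a)) \<and>
     (\<forall>b\<in>carrier B. k_linear A U (\<lambda>a. \<phi> a b))"

lemma monoid_alg_minus:
  assumes "monoid M" "f \<in> carrier (monoid_alg M)" "h \<in> carrier (monoid_alg M)"
  shows "f \<ominus>\<^bsub>monoid_alg M\<^esub> h = f - (h :: 'm \<Rightarrow>\<^sub>0 'k::field)"
proof -
  interpret k_algebra "monoid_alg M :: ('k, 'm \<Rightarrow>\<^sub>0 'k) module"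
    by (rule k_algebra_monoid_alg) fact
  have "pm_scale (- 1) h = - h"
    by (rule poly_mapping_eqI) (simp add: lookup_pm_scale)
  then show ?thesis
    using a_minus_eq_smult[OF assms(2,3)] by simp
qed

locale k_algebra_pair = A: k_algebra A + B: k_algebra B
  for A :: "('k::field, 'a, 'y) module_scheme" and B :: "('k, 'b, 'z) module_scheme"
begin

abbreviation "T \<equiv> monoid_alg (A \<times>\<times> B) :: ('k, 'a \<times> 'b \<Rightarrow>\<^sub>0 'k) module"
abbreviation e :: "'a \<Rightarrow> 'b \<Rightarrow> ('a \<times> 'b \<Rightarrow>\<^sub>0 'k)" where "e a b \<equiv> Poly_Mapping.single (a, b) 1"

definition bilin_gens :: "('a \<times> 'b \<Rightarrow>\<^sub>0 'k) set" where
  "bilin_gens =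
      {e (a \<oplus>\<^bsub>A\<^esub> a') b - e a b - e a' b | a a' b. a \<in> carrier A \<and> a' \<in> carrier A \<and> b \<in> carrier B}
    \<union> {e a (b \<oplus>\<^bsub>B\<^esub> b') - e a b - e a b' | a b b'. a \<in> carrier A \<and> b \<in> carrier B \<and> b' \<in> carrier B}
    \<union> {e (c \<odot>\<^bsub>A\<^esub> a) b - pm_scale c (e a b) | c a b. a \<in> carrier A \<and> b \<in> carrier B}
    \<union> {e a (c \<odot>\<^bsub>B\<^esub> b) - pm_scale c (e a b) | c a b. a \<in> carrier A \<and> b \<in> carrier B}"

lemma bilin_rels_eq: "bilin_rels A B = pm_span bilin_gens"
  unfolding bilin_rels_def bilin_gens_def Let_def ..

sublocale V: vector_space "pm_scale :: 'k \<Rightarrow> ('a \<times> 'b \<Rightarrow>\<^sub>0 'k) \<Rightarrow> _"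
  by (rule pm_scale_vector_space)

lemma monoid_prod: "monoid (A \<times>\<times> B)"
  by (intro DirProd_monoid A.monoid_axioms B.monoid_axioms)

sublocale T: k_algebra T
  by (rule k_algebra_monoid_alg) (rule monoid_prod)

lemma e_carrier: "a \<in> carrier A \<Longrightarrow> b \<in> carrier B \<Longrightarrow> e a b \<in> carrier T"
  by (simp add: DirProd_def)

text \<open>The generators are rewritten with the subtraction of the algebra, through which homomorphisms can
  be moved.\<close>

lemma bilin_gens_cases:
  assumes "g \<in> bilin_gens"
  obtains (add_l) a a' b where "a \<in> carrier A" "a' \<in> carrier A" "b \<in> carrier B"
      "g = (e (a \<oplus>\<^bsub>A\<^esub> a') b \<ominus>\<^bsub>T\<^esub> e a b) \<ominus>\<^bsub>T\<^esub> e a' b"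
    | (add_r) a b b' where "a \<in> carrier A" "b \<in> carrier B" "b' \<in> carrier B"
      "g = (e a (b \<oplus>\<^bsub>B\<^esub> b') \<ominus>\<^bsub>T\<^esub> e a b) \<ominus>\<^bsub>T\<^esub> e a b'"
    | (smult_l) c a b where "a \<in> carrier A" "b \<in> carrier B"
      "g = e (c \<odot>\<^bsub>A\<^esub> a) b \<ominus>\<^bsub>T\<^esub> c \<odot>\<^bsub>T\<^esub> e a b"
    | (smult_r) c a b where "a \<in> carrier A" "b \<in> carrier B"
      "g = e a (c \<odot>\<^bsub>B\<^esub> b) \<ominus>\<^bsub>T\<^esub> c \<odot>\<^bsub>T\<^esub> e a b"
proof -
  have m: "x - y = x \<ominus>\<^bsub>T\<^esub> y" if "x \<in> carrier T" "y \<in> carrier T" for x y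
    using monoid_alg_minus[OF monoid_prod that] by simp
  have s: "pm_scale c x = c \<odot>\<^bsub>T\<^esub> x" for c x
    by simp
  from assms show ?thesis
    unfolding bilin_gens_def s
    using that
    by (elim UnE CollectE exE conjE)
      (simp_all only: m e_carrier T.minus_closed T.smult_closed A.a_closed B.a_closed
        A.smult_closed B.smult_closed)
qed

lemma bilin_gens_carrier: "g \<in> bilin_gens \<Longrightarrow> g \<in> carrier T"
  by (cases rule: bilin_gens_cases[of g])
    (simp_all only: e_carrier T.minus_closed T.smult_closed A.a_closed B.a_closed
        A.smult_closed B.smult_closed)

text \<open>For \<open>S = {\<zero>}\<close> this says that \<open>F\<close> vanishes on the relations as soon as it does so on the
  generators; with the relations themselves for \<open>S\<close> it shows that they form an ideal.\<close>

lemma bilin_rels_image: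
  assumes "k_algebra U" "k_linear T U F"
    and S: "\<zero>\<^bsub>U\<^esub> \<in> S" "\<And>u v. u \<in> S \<Longrightarrow> v \<in> S \<Longrightarrow> u \<oplus>\<^bsub>U\<^esub> v \<in> S" "\<And>c u. u \<in> S \<Longrightarrow> c \<odot>\<^bsub>U\<^esub> u \<in> S"
    and gens: "\<And>g. g \<in> bilin_gens \<Longrightarrow> F g \<in> S"
    and h: "h \<in> bilin_rels A B"
  shows "h \<in> carrier T \<and> F h \<in> S"
  using h unfolding bilin_rels_eq
proof (induction rule: V.span_induct_alt)
  case base
  then show ?case
    using S(1) k_linear_zero[OF T.k_algebra_axioms assms(1,2)] T.zero_closed by simp
next
  case (step c x y)
  then have x: "x \<in> carrier T" "F x \<in> S"
    by (auto simp only: gens bilin_gens_carrier)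
  have "pm_scale c x + y = c \<odot>\<^bsub>T\<^esub> x \<oplus>\<^bsub>T\<^esub> y"
    by simp
  then show ?case
    using x step k_linearD[OF assms(2)] S by (simp only: T.a_closed T.smult_closed)
qed

lemma bilin_rels_carrier: "h \<in> bilin_rels A B \<Longrightarrow> h \<in> carrier T"
  using bilin_rels_image[OF T.k_algebra_axioms, of "\<lambda>x. x" "carrier T"]
  by (auto simp only: k_linear_def T.zero_closed T.a_closed T.smult_closed bilin_gens_carrier Pi_iff)

lemma bilin_gensI:
  "\<lbrakk>a \<in> carrier A; a' \<in> carrier A; b \<in> carrier B\<rbrakk> \<Longrightarrow>
    (e (a \<oplus>\<^bsub>A\<^esub> a') b \<ominus>\<^bsub>T\<^esub> e a b) \<ominus>\<^bsub>T\<^esub> e a' b \<in> bilin_gens"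
  "\<lbrakk>a \<in> carrier A; b \<in> carrier B; b' \<in> carrier B\<rbrakk> \<Longrightarrow>
    (e a (b \<oplus>\<^bsub>B\<^esub> b') \<ominus>\<^bsub>T\<^esub> e a b) \<ominus>\<^bsub>T\<^esub> e a b' \<in> bilin_gens"
  "\<lbrakk>a \<in> carrier A; b \<in> carrier B\<rbrakk> \<Longrightarrow> e (c \<odot>\<^bsub>A\<^esub> a) b \<ominus>\<^bsub>T\<^esub> c \<odot>\<^bsub>T\<^esub> e a b \<in> bilin_gens"
  "\<lbrakk>a \<in> carrier A; b \<in> carrier B\<rbrakk> \<Longrightarrow> e a (c \<odot>\<^bsub>B\<^esub> b) \<ominus>\<^bsub>T\<^esub> c \<odot>\<^bsub>T\<^esub> e a b \<in> bilin_gens"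
proof -
  have m: "x \<ominus>\<^bsub>T\<^esub> y = x - y" if "x \<in> carrier T" "y \<in> carrier T" for x y
    using monoid_alg_minus[OF monoid_prod that] by simp
  have s: "c \<odot>\<^bsub>T\<^esub> x = pm_scale c x" for c x
    by simp
  note c = m e_carrier T.minus_closed T.smult_closed A.a_closed B.a_closed A.smult_closed B.smult_closed
  show "(e (a \<oplus>\<^bsub>A\<^esub> a') b \<ominus>\<^bsub>T\<^esub> e a b) \<ominus>\<^bsub>T\<^esub> e a' b \<in> bilin_gens"
    if "a \<in> carrier A" "a' \<in> carrier A" "b \<in> carrier B"
  proof -
    have "(e (a \<oplus>\<^bsub>A\<^esub> a') b \<ominus>\<^bsub>T\<^esub> e a b) \<ominus>\<^bsub>T\<^esub> e a' b = e (a \<oplus>\<^bsub>A\<^esub> a') b - e a b - e a' b"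
      using that by (metis c)
    then show ?thesis
      unfolding bilin_gens_def using that by blast
  qed
  show "(e a (b \<oplus>\<^bsub>B\<^esub> b') \<ominus>\<^bsub>T\<^esub> e a b) \<ominus>\<^bsub>T\<^esub> e a b' \<in> bilin_gens"
    if "a \<in> carrier A" "b \<in> carrier B" "b' \<in> carrier B"
  proof -
    have "(e a (b \<oplus>\<^bsub>B\<^esub> b') \<ominus>\<^bsub>T\<^esub> e a b) \<ominus>\<^bsub>T\<^esub> e a b' = e a (b \<oplus>\<^bsub>B\<^esub> b') - e a b - e a b'"
      using that by (metis c)
    then show ?thesis
      unfolding bilin_gens_def using that by blast
  qed
  show "e (c \<odot>\<^bsub>A\<^esub> a) b \<ominus>\<^bsub>T\<^esub> c \<odot>\<^bsub>T\<^esub> e a b \<in> bilin_gens" if "a \<in> carrier A" "b \<in> carrier B"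
  proof -
    have "e (c \<odot>\<^bsub>A\<^esub> a) b \<ominus>\<^bsub>T\<^esub> c \<odot>\<^bsub>T\<^esub> e a b = e (c \<odot>\<^bsub>A\<^esub> a) b - pm_scale c (e a b)"
      using that by (metis c s)
    then show ?thesis
      unfolding bilin_gens_def using that by blast
  qed
  show "e a (c \<odot>\<^bsub>B\<^esub> b) \<ominus>\<^bsub>T\<^esub> c \<odot>\<^bsub>T\<^esub> e a b \<in> bilin_gens" if "a \<in> carrier A" "b \<in> carrier B"
  proof -
    have "e a (c \<odot>\<^bsub>B\<^esub> b) \<ominus>\<^bsub>T\<^esub> c \<odot>\<^bsub>T\<^esub> e a b = e a (c \<odot>\<^bsub>B\<^esub> b) - pm_scale c (e a b)"
      using that by (metis c s)
    then show ?thesis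
      unfolding bilin_gens_def using that by blast
  qed
qed

lemma bilin_rels_closed:
  "\<zero>\<^bsub>T\<^esub> \<in> bilin_rels A B"
  "u \<in> bilin_rels A B \<Longrightarrow> v \<in> bilin_rels A B \<Longrightarrow> u \<oplus>\<^bsub>T\<^esub> v \<in> bilin_rels A B"
  "u \<in> bilin_rels A B \<Longrightarrow> c \<odot>\<^bsub>T\<^esub> u \<in> bilin_rels A B"
  by (simp_all add: bilin_rels_eq V.span_zero V.span_add V.span_scale)

lemma e_mult:
  "e a b \<otimes>\<^bsub>T\<^esub> e a' b' = e (a \<otimes>\<^bsub>A\<^esub> a') (b \<otimes>\<^bsub>B\<^esub> b')"
  by (simp add: DirProd_def)

text \<open>Multiplication in \<open>A\<close> and in \<open>B\<close> is bilinear, so a pure tensor carries each bilinearity relation to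
  another one of the same kind.\<close>

lemma e_mult_gens:
  assumes a: "a \<in> carrier A" and b: "b \<in> carrier B" and g: "g \<in> bilin_gens"
  shows "e a b \<otimes>\<^bsub>T\<^esub> g \<in> bilin_gens" "g \<otimes>\<^bsub>T\<^esub> e a b \<in> bilin_gens"
proof -
  have dl: "x \<otimes>\<^bsub>T\<^esub> (y \<ominus>\<^bsub>T\<^esub> z) = x \<otimes>\<^bsub>T\<^esub> y \<ominus>\<^bsub>T\<^esub> x \<otimes>\<^bsub>T\<^esub> z"
    and dr: "(y \<ominus>\<^bsub>T\<^esub> z) \<otimes>\<^bsub>T\<^esub> x = y \<otimes>\<^bsub>T\<^esub> x \<ominus>\<^bsub>T\<^esub> z \<otimes>\<^bsub>T\<^esub> x"
    if "x \<in> carrier T" "y \<in> carrier T" "z \<in> carrier T" for x y z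
    using that
    by (simp_all only: T.a_minus_eq_smult T.r_distr T.l_distr T.smult_mult_l T.smult_mult_r
        T.smult_closed T.m_closed)
  note c = dl dr e_carrier T.minus_closed T.smult_closed A.a_closed B.a_closed A.smult_closed
    B.smult_closed T.smult_mult_l T.smult_mult_r e_mult A.m_closed B.m_closed A.r_distr A.l_distr
    B.r_distr B.l_distr A.smult_mult_l B.smult_mult_l A.smult_mult_r B.smult_mult_r a b
  show "e a b \<otimes>\<^bsub>T\<^esub> g \<in> bilin_gens"
    by (cases rule: bilin_gens_cases[OF g]) (simp_all only: c bilin_gensI)
  show "g \<otimes>\<^bsub>T\<^esub> e a b \<in> bilin_gens"
    by (cases rule: bilin_gens_cases[OF g]) (simp_all only: c bilin_gensI)
qed

lemma bilin_rels_ideal: "ideal (bilin_rels A B) T"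
proof (rule idealI)
  show "ring T" by (rule T.ring_axioms)
  have "\<ominus>\<^bsub>T\<^esub> u \<in> bilin_rels A B" if "u \<in> bilin_rels A B" for u
    using T.a_inv_eq_smult[OF bilin_rels_carrier[OF that]] bilin_rels_closed(3)[OF that]
    by (simp only:)
  then show "subgroup (bilin_rels A B) (add_monoid T)"
    using bilin_rels_carrier bilin_rels_closed
    by (intro T.add.subgroupI) (auto simp: a_inv_def simp del: monoid_alg_simps)
  note S = bilin_rels_closed
  have gens: "g \<in> bilin_gens \<Longrightarrow> g \<in> bilin_rels A B" for g
    by (simp add: bilin_rels_eq V.span_base)
  fix h r assume h: "h \<in> bilin_rels A B" and r: "r \<in> carrier T"
  note hc = bilin_rels_carrier[OF h]
  have l: "e a b \<otimes>\<^bsub>T\<^esub> h \<in> bilin_rels A B" if "a \<in> carrier A" "b \<in> carrier B" for a b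
  proof -
    have "k_linear T T (\<lambda>h. e a b \<otimes>\<^bsub>T\<^esub> h)"
      by (rule k_linearI) (simp_all only: T.m_closed T.r_distr T.smult_mult_r e_carrier that)
    from bilin_rels_image[OF T.k_algebra_axioms this S _ h] that show ?thesis
      using e_mult_gens(1) gens by blast
  qed
  have r': "h \<otimes>\<^bsub>T\<^esub> e a b \<in> bilin_rels A B" if "a \<in> carrier A" "b \<in> carrier B" for a b
  proof -
    have "k_linear T T (\<lambda>h. h \<otimes>\<^bsub>T\<^esub> e a b)"
      by (rule k_linearI) (simp_all only: T.m_closed T.l_distr T.smult_mult_l e_carrier that)
    from bilin_rels_image[OF T.k_algebra_axioms this S _ h] that show ?thesis
      using e_mult_gens(2) gens by blast
  qed
  have k: "Poly_Mapping.keys r \<subseteq> carrier (A \<times>\<times> B)"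
    using r by simp
  have single: "Poly_Mapping.single (a, b) c = c \<odot>\<^bsub>T\<^esub> e a b" for a b c
    by (simp add: pm_scale_simps)
  show "r \<otimes>\<^bsub>T\<^esub> h \<in> bilin_rels A B" using k
  proof (induction rule: pm_induct_on)
    case (single m c)
    then obtain a b where m: "m = (a, b)" "a \<in> carrier A" "b \<in> carrier B"
      by (auto simp: DirProd_def)
    then show ?case
      using S(3)[OF l[OF m(2,3)], of c] \<open>\<And>a b c. Poly_Mapping.single (a, b) c = c \<odot>\<^bsub>T\<^esub> e a b\<close>
        T.smult_mult_l[OF e_carrier[OF m(2,3)] hc] by metis
  qed (use S in \<open>auto simp: monoid_alg_mult_add_left\<close>)
  show "h \<otimes>\<^bsub>T\<^esub> r \<in> bilin_rels A B" using k
  proof (induction rule: pm_induct_on)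
    case (single m c)
    then obtain a b where m: "m = (a, b)" "a \<in> carrier A" "b \<in> carrier B"
      by (auto simp: DirProd_def)
    then show ?case
      using S(3)[OF r'[OF m(2,3)], of c] \<open>\<And>a b c. Poly_Mapping.single (a, b) c = c \<odot>\<^bsub>T\<^esub> e a b\<close>
        T.smult_mult_r[OF hc e_carrier[OF m(2,3)]] by metis
  qed (use S in \<open>auto simp: monoid_alg_mult_add_right\<close>)
qed

sublocale Q: k_algebra_ideal T "bilin_rels A B"
  by (intro k_algebra_ideal.intro T.k_algebra_axioms bilin_rels_ideal)

lemma k_algebra_tensor_alg: "k_algebra (tensor_alg A B)"
  unfolding tensor_alg_def by (rule Q.k_algebra_quot_alg)

lemma tens_closed: "a \<in> carrier A \<Longrightarrow> b \<in> carrier B \<Longrightarrow> tens A B a b \<in> carrier (tensor_alg A B)"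
  using e_carrier by (simp add: tensor_alg_def tens_def del: monoid_alg_simps)

lemma tens_one: "\<one>\<^bsub>tensor_alg A B\<^esub> = tens A B \<one>\<^bsub>A\<^esub> \<one>\<^bsub>B\<^esub>"
proof -
  have "\<one>\<^bsub>T\<^esub> = e \<one>\<^bsub>A\<^esub> \<one>\<^bsub>B\<^esub>"
    by (simp add: DirProd_def)
  then show ?thesis
    unfolding tensor_alg_def tens_def Q.quot_alg_simps by (simp only:)
qed

lemma tens_mult:
  "\<lbrakk>a \<in> carrier A; b \<in> carrier B; a' \<in> carrier A; b' \<in> carrier B\<rbrakk> \<Longrightarrow>
    tens A B a b \<otimes>\<^bsub>tensor_alg A B\<^esub> tens A B a' b' = tens A B (a \<otimes>\<^bsub>A\<^esub> a') (b \<otimes>\<^bsub>B\<^esub> b')"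
  unfolding tensor_alg_def tens_def by (simp only: Q.quot_alg_simps e_carrier e_mult)

lemma coset_eqI: "\<lbrakk>x \<in> carrier T; y \<in> carrier T; x \<ominus>\<^bsub>T\<^esub> y \<in> bilin_gens\<rbrakk> \<Longrightarrow>
    bilin_rels A B +>\<^bsub>T\<^esub> x = bilin_rels A B +>\<^bsub>T\<^esub> y"
  by (simp only: Q.coset_eq_iff) (simp add: bilin_rels_eq V.span_base)

lemma tens_bilinear: "k_bilinear A B (tensor_alg A B) (tens A B)"
proof -
  have d: "x \<ominus>\<^bsub>T\<^esub> (y \<oplus>\<^bsub>T\<^esub> z) = x \<ominus>\<^bsub>T\<^esub> y \<ominus>\<^bsub>T\<^esub> z"
    if "x \<in> carrier T" "y \<in> carrier T" "z \<in> carrier T" for x y z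
    using that by (simp only: a_minus_def T.minus_add T.a_assoc T.a_inv_closed)
  note c = e_carrier T.a_closed T.smult_closed A.a_closed B.a_closed A.smult_closed B.smult_closed
  show ?thesis
    unfolding k_bilinear_def
  proof (intro conjI ballI k_linearI)
    show "tens A B a (b \<oplus>\<^bsub>B\<^esub> b') = tens A B a b \<oplus>\<^bsub>tensor_alg A B\<^esub> tens A B a b'"
      if "a \<in> carrier A" "b \<in> carrier B" "b' \<in> carrier B" for a b b'
      unfolding tensor_alg_def tens_def using that
      by (simp only: Q.quot_alg_simps e_carrier)
        (rule coset_eqI; simp only: c d bilin_gensI that)
    show "tens A B (a \<oplus>\<^bsub>A\<^esub> a') b = tens A B a b \<oplus>\<^bsub>tensor_alg A B\<^esub> tens A B a' b"
      if "b \<in> carrier B" "a \<in> carrier A" "a' \<in> carrier A" for a a' b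
      unfolding tensor_alg_def tens_def using that
      by (simp only: Q.quot_alg_simps e_carrier)
        (rule coset_eqI; simp only: c d bilin_gensI that)
    show "tens A B a (k \<odot>\<^bsub>B\<^esub> b) = k \<odot>\<^bsub>tensor_alg A B\<^esub> tens A B a b"
      if "a \<in> carrier A" "b \<in> carrier B" for a b k
      unfolding tensor_alg_def tens_def using that
      by (simp only: Q.quot_alg_smult e_carrier)
        (rule coset_eqI; simp only: c bilin_gensI that)
    show "tens A B (k \<odot>\<^bsub>A\<^esub> a) b = k \<odot>\<^bsub>tensor_alg A B\<^esub> tens A B a b"
      if "b \<in> carrier B" "a \<in> carrier A" for a b k
      unfolding tensor_alg_def tens_def using that
      by (simp only: Q.quot_alg_smult e_carrier)
        (rule coset_eqI; simp only: c bilin_gensI that)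
  qed (simp_all only: tens_closed)
qed

text \<open>Pure tensors span the tensor product.\<close>

lemma tensor_linear_eqI:
  assumes "k_algebra U" "k_linear (tensor_alg A B) U f" "k_linear (tensor_alg A B) U h"
    and eq: "\<And>a b. \<lbrakk>a \<in> carrier A; b \<in> carrier B\<rbrakk> \<Longrightarrow> f (tens A B a b) = h (tens A B a b)"
    and t: "t \<in> carrier (tensor_alg A B)"
  shows "f t = h t"
proof -
  let ?p = "\<lambda>v. bilin_rels A B +>\<^bsub>T\<^esub> v"
  have p: "k_linear T (tensor_alg A B) ?p"
    unfolding tensor_alg_def by (rule k_alg_homD(1)[OF Q.coset_alg_hom])
  from t obtain v where v: "v \<in> carrier T" "t = ?p v"
    unfolding tensor_alg_def Q.quot_alg_simps by blast
  have "f (?p v) = h (?p v)"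
  proof (rule monoid_alg_linear_eqI[OF assms(1) k_linear_comp[OF p assms(2)]
        k_linear_comp[OF p assms(3)] monoid_prod _ v(1)])
    fix m assume "m \<in> carrier (A \<times>\<times> B)"
    then obtain a b where "m = (a, b)" "a \<in> carrier A" "b \<in> carrier B"
      by (auto simp: DirProd_def)
    then show "f (?p (Poly_Mapping.single m 1)) = h (?p (Poly_Mapping.single m 1))"
      using eq[of a b] by (simp add: tens_def)
  qed
  then show ?thesis using v by simp
qed

context
  fixes U :: "('k, 'u, 'w) module_scheme" and \<phi> :: "'a \<Rightarrow> 'b \<Rightarrow> 'u"
  assumes U: "k_algebra U" and \<phi>: "k_bilinear A B U \<phi>"
begin

interpretation U: k_algebra U by (rule U)

lemma bilinD:
  "\<lbrakk>a \<in> carrier A; b \<in> carrier B\<rbrakk> \<Longrightarrow> \<phi> a b \<in> carrier U"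
  "\<lbrakk>a \<in> carrier A; b \<in> carrier B; b' \<in> carrier B\<rbrakk> \<Longrightarrow> \<phi> a (b \<oplus>\<^bsub>B\<^esub> b') = \<phi> a b \<oplus>\<^bsub>U\<^esub> \<phi> a b'"
  "\<lbrakk>a \<in> carrier A; a' \<in> carrier A; b \<in> carrier B\<rbrakk> \<Longrightarrow> \<phi> (a \<oplus>\<^bsub>A\<^esub> a') b = \<phi> a b \<oplus>\<^bsub>U\<^esub> \<phi> a' b"
  "\<lbrakk>a \<in> carrier A; b \<in> carrier B\<rbrakk> \<Longrightarrow> \<phi> a (c \<odot>\<^bsub>B\<^esub> b) = c \<odot>\<^bsub>U\<^esub> \<phi> a b"
  "\<lbrakk>a \<in> carrier A; b \<in> carrier B\<rbrakk> \<Longrightarrow> \<phi> (c \<odot>\<^bsub>A\<^esub> a) b = c \<odot>\<^bsub>U\<^esub> \<phi> a b"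
  using \<phi> unfolding k_bilinear_def k_linear_def by auto

abbreviation (input) "F \<equiv> lin_ext U (\<lambda>(a, b). \<phi> a b)"

lemma tensor_ext_linear: "k_linear T U F"
  by (rule U.lin_ext_linear) (auto simp: DirProd_def bilinD)

lemma tensor_ext_e: "\<lbrakk>a \<in> carrier A; b \<in> carrier B\<rbrakk> \<Longrightarrow> F (e a b) = \<phi> a b"
  by (simp add: bilinD)

lemma tensor_ext_rels:
  assumes "h \<in> bilin_rels A B"
  shows "F h = \<zero>\<^bsub>U\<^esub>"
proof -
  have sum: "u \<oplus>\<^bsub>U\<^esub> v \<ominus>\<^bsub>U\<^esub> u \<ominus>\<^bsub>U\<^esub> v = \<zero>\<^bsub>U\<^esub>" if "u \<in> carrier U" "v \<in> carrier U" for u v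
  proof -
    have "u \<oplus>\<^bsub>U\<^esub> v \<ominus>\<^bsub>U\<^esub> u \<ominus>\<^bsub>U\<^esub> v = (u \<oplus>\<^bsub>U\<^esub> v) \<oplus>\<^bsub>U\<^esub> \<ominus>\<^bsub>U\<^esub> (u \<oplus>\<^bsub>U\<^esub> v)"
      using that by (simp add: a_minus_def U.minus_add U.a_assoc)
    then show ?thesis
      using that by (simp add: U.r_neg)
  qed
  have self: "u \<ominus>\<^bsub>U\<^esub> u = \<zero>\<^bsub>U\<^esub>" if "u \<in> carrier U" for u
    using that by (simp add: a_minus_def U.r_neg)
  have "F g = \<zero>\<^bsub>U\<^esub>" if "g \<in> bilin_gens" for g
    using that
    by (cases rule: bilin_gens_cases)
      (simp_all only: k_linear_minus[OF T.k_algebra_axioms U tensor_ext_linear]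
        k_linearD[OF tensor_ext_linear] tensor_ext_e e_carrier T.minus_closed T.smult_closed
        A.a_closed B.a_closed A.smult_closed B.smult_closed bilinD
        sum
        self U.smult_closed)
  with bilin_rels_image[OF U tensor_ext_linear, of "{\<zero>\<^bsub>U\<^esub>}"] assms show ?thesis
    by simp
qed

lemma tensor_lift_linear: "k_linear (tensor_alg A B) U (tensor_lift U \<phi>)"
  unfolding tensor_alg_def tensor_lift_def
  by (rule Q.quot_map_linear[OF U tensor_ext_linear tensor_ext_rels])

lemma tensor_lift_tens:
  "\<lbrakk>a \<in> carrier A; b \<in> carrier B\<rbrakk> \<Longrightarrow> tensor_lift U \<phi> (tens A B a b) = \<phi> a b"
  unfolding tens_def tensor_lift_def
  by (simp only: Q.quot_map_coset[OF U tensor_ext_linear tensor_ext_rels] e_carrier tensor_ext_e)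

lemma tensor_lift_alg_hom:
  assumes "\<phi> \<one>\<^bsub>A\<^esub> \<one>\<^bsub>B\<^esub> = \<one>\<^bsub>U\<^esub>"
    and "\<And>a a' b b'. \<lbrakk>a \<in> carrier A; a' \<in> carrier A; b \<in> carrier B; b' \<in> carrier B\<rbrakk> \<Longrightarrow>
      \<phi> (a \<otimes>\<^bsub>A\<^esub> a') (b \<otimes>\<^bsub>B\<^esub> b') = \<phi> a b \<otimes>\<^bsub>U\<^esub> \<phi> a' b'"
  shows "k_alg_hom (tensor_alg A B) U (tensor_lift U \<phi>)"
  unfolding tensor_alg_def tensor_lift_def
proof (rule Q.quot_map_alg_hom[OF U _ tensor_ext_rels])
  show "k_alg_hom T U F"
    by (rule U.lin_ext_alg_hom[OF monoid_prod]) (auto simp: DirProd_def bilinD assms)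
qed

end

end

section \<open>Powers of elements of finite order\<close>

text \<open>Below, integer powers of an element of finite order are rewritten to natural powers, against
  the direction of this rule.\<close>

declare pow_nat [simp del]

lemma root_powi:
  fixes c :: "'k::field"
  assumes "c ^ N = 1" "N > 0"
  shows "c powi z = c ^ nat (z mod int N)"
proof -
  have c: "c \<noteq> 0" using assms by (auto simp: power_0_left)
  have "c powi z = c powi (int N * (z div int N) + z mod int N)"
    by simp
  also have "\<dots> = (c powi int N) powi (z div int N) * c powi (z mod int N)"
    using c by (subst power_int_add) (auto simp: power_int_mult)
  also have "c powi (z mod int N) = c ^ nat (z mod int N)"
    using assms(2) by (simp add: power_int_def)
  also have "c powi int N = 1"
    using assms(1) by simp
  finally show ?thesis by simp
qed

lemma primitive_root_powi_eq_1_iff: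
  fixes q :: "'k::field"
  assumes "primitive_root_of_unity N q"
  shows "q powi z = 1 \<longleftrightarrow> [z = 0] (mod int N)"
proof -
  have q: "N > 0" "q ^ N = 1" "\<And>m. 0 < m \<Longrightarrow> m < N \<Longrightarrow> q ^ m \<noteq> 1"
    using assms by (auto simp: primitive_root_of_unity_def)
  have "nat (z mod int N) < N"
    using q(1) by (simp add: nat_less_iff)
  with q(3)[of "nat (z mod int N)"] have "q ^ nat (z mod int N) = 1 \<longleftrightarrow> nat (z mod int N) = 0"
    by (metis not_gr_zero power_0)
  moreover have "nat (z mod int N) = 0 \<longleftrightarrow> z mod int N = 0"
    using q(1) by (metis nat_0 nat_eq_iff2 pos_mod_sign of_nat_0_less_iff order.refl)
  ultimately show ?thesis
    using root_powi[OF q(2,1)] by (simp add: cong_def)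
qed

lemma primitive_root_powi_eq_iff:
  fixes q :: "'k::field"
  assumes "primitive_root_of_unity N q"
  shows "q powi z = q powi w \<longleftrightarrow> [z = w] (mod int N)"
proof -
  have "q \<noteq> 0"
    using assms by (auto simp: primitive_root_of_unity_def power_0_left)
  then have "q powi z = q powi w \<longleftrightarrow> q powi (z - w) = 1"
    by (simp add: power_int_diff)
  then show ?thesis
    by (simp add: primitive_root_powi_eq_1_iff[OF assms] cong_diff_iff_cong_0)
qed

lemma root_of_unity_eq_powi:
  fixes q u :: "'k::field"
  assumes "primitive_root_of_unity N q" "u ^ N = 1"
  obtains m :: int where "u = q powi m"
proof -
  have q: "N > 0" "q ^ N = 1" "\<And>m. 0 < m \<Longrightarrow> m < N \<Longrightarrow> q ^ m \<noteq> 1"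
    using assms by (auto simp: primitive_root_of_unity_def)
  then have q0: "q \<noteq> 0" by (auto simp: power_0_left)
  \<comment> \<open>The powers of \<open>q\<close> already exhaust the at most \<open>N\<close> roots of \<open>X ^ N - 1\<close>.\<close>
  let ?p = "monom 1 N - 1 :: 'k poly"
  have p: "?p \<noteq> 0" "degree ?p = N"
  proof -
    have "coeff ?p N = 1" using q(1) by simp
    then show "?p \<noteq> 0" by (metis coeff_0 zero_neq_one)
    show "degree ?p = N"
    proof (rule antisym)
      show "degree ?p \<le> N"
        by (rule degree_diff_le) (simp_all add: degree_monom_le)
      show "N \<le> degree ?p"
        using \<open>coeff ?p N = 1\<close> by (intro le_degree) simp
    qed
  qed
  have inj: "inj_on (\<lambda>i. q ^ i) {..<N}"
  proof (rule inj_onI)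
    fix i j assume ij: "i \<in> {..<N}" "j \<in> {..<N}" "q ^ i = q ^ j"
    then have "q powi int i = q powi int j" by simp
    then have "[int i = int j] (mod int N)"
      by (simp only: primitive_root_powi_eq_iff[OF assms(1)])
    with ij show "i = j" by (simp add: cong_def)
  qed
  have roots: "{x. poly ?p x = 0} = {x. x ^ N = 1}"
    by (simp add: poly_monom)
  have fin: "finite {x. x ^ N = (1::'k)}" "card {x. x ^ N = (1::'k)} \<le> N"
    using poly_roots_finite[OF p(1)] card_poly_roots_bound[OF p(1)] p(2) unfolding roots by simp_all
  have sub: "(\<lambda>i. q ^ i) ` {..<N} \<subseteq> {x. x ^ N = 1}"
  proof (clarsimp)
    show "(q ^ i) ^ N = 1" for i
      using q(2) by (metis power_mult mult.commute power_one)
  qed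
  have "card ((\<lambda>i. q ^ i) ` {..<N}) = N"
    using inj by (simp add: card_image)
  then have "(\<lambda>i. q ^ i) ` {..<N} = {x. x ^ N = 1}"
    using card_seteq[OF fin(1) sub] fin(2) by simp
  then obtain i where "u = q ^ i"
    using assms(2) by (metis (mono_tags, lifting) imageE mem_Collect_eq)
  then show ?thesis using that[of "int i"] by simp
qed

context monoid
begin

context
  fixes g and N :: nat
  assumes g: "g \<in> carrier G" and gN: "g [^] N = \<one>" and N: "N > 0"
begin

lemma pow_mod: "g [^] (n::nat) = g [^] (n mod N)"
proof -
  have "g [^] n = g [^] (N * (n div N) + n mod N)"
    by simp
  also have "\<dots> = (g [^] N) [^] (n div N) \<otimes> g [^] (n mod N)"
    using g by (simp only: nat_pow_mult[symmetric] nat_pow_pow[symmetric])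
  finally show ?thesis
    using g gN by simp
qed

text \<open>Negative powers are defined by a definite description of the inverse; for an element of finite
  order they become natural powers, about which homomorphisms and commutation rules are proved by
  induction.\<close>

lemma int_pow_mod: "g [^] (z::int) = g [^] nat (z mod int N)"
proof (cases "z < 0")
  case False
  then have "nat (z mod int N) = nat z mod N"
    by (simp add: nat_mod_distrib)
  moreover have "g [^] z = g [^] nat z"
    using False by (simp add: int_pow_def2)
  ultimately show ?thesis
    using pow_mod[of "nat z"] by metis
next
  case True
  let ?m = "nat (- z)" and ?n = "nat (z mod int N)"
  have "int (?m + ?n) = z mod int N - z"
    using True N by simp
  moreover have "int N dvd z mod int N - z"
    by (simp add: mod_eq_dvd_iff[symmetric])
  ultimately have "int N dvd int (?m + ?n)"
    by metis
  then have "(?m + ?n) mod N = 0"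
    by (metis int_dvd_int_iff mod_eq_0_iff_dvd)
  then have one: "g [^] (?m + ?n) = \<one>"
    using pow_mod[of "?m + ?n"] nat_pow_0 by metis
  then have "g [^] ?m \<otimes> g [^] ?n = \<one>" "g [^] ?n \<otimes> g [^] ?m = \<one>"
    using nat_pow_mult[OF g, of ?m ?n] nat_pow_mult[OF g, of ?n ?m] by (metis add.commute)+
  then have "inv (g [^] ?m) = g [^] ?n"
    using g by (intro inv_char) auto
  moreover have "g [^] z = inv (g [^] ?m)"
    using True by (simp add: int_pow_def2)
  ultimately show ?thesis by metis
qed

lemma finite_order_int_pow_closed: "g [^] (z::int) \<in> carrier G"
  using g by (simp add: int_pow_mod)

lemma finite_order_int_pow_cong:
  "[z = w] (mod int N) \<Longrightarrow> g [^] (z::int) = g [^] w"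
  by (simp add: int_pow_mod cong_def)

lemma finite_order_int_pow_mult: "g [^] (z::int) \<otimes> g [^] w = g [^] (z + w)"
proof -
  have "g [^] z \<otimes> g [^] w = g [^] (nat (z mod int N) + nat (w mod int N))"
    using g by (simp add: int_pow_mod nat_pow_mult)
  also have "\<dots> = g [^] int (nat (z mod int N) + nat (w mod int N))"
    by (simp only: int_pow_int)
  also have "\<dots> = g [^] (z + w)"
    using N by (intro finite_order_int_pow_cong) (simp add: cong_def mod_simps)
  finally show ?thesis .
qed

lemma finite_order_int_pow_order: "(g [^] (z::int)) [^] N = \<one>"
proof -
  have "(g [^] m) [^] N = (g [^] N) [^] m" for m :: nat
    using g by (simp add: nat_pow_pow mult.commute)
  then show ?thesis
    using gN by (simp add: int_pow_mod)
qed

lemma finite_order_inv: "inv g = g [^] (- 1 :: int)"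
  using g by (simp add: int_pow_def2)

end

lemma finite_order_int_pow_pow:
  assumes "g \<in> carrier G" "g [^] (N::nat) = \<one>" "N > 0"
  shows "(g [^] (z::int)) [^] (w::int) = g [^] (z * w)"
proof -
  have "(g [^] z) [^] w = (g [^] nat (z mod int N)) [^] nat (w mod int N)"
    using int_pow_mod[OF finite_order_int_pow_closed[OF assms] finite_order_int_pow_order[OF assms] assms(3)]
    by (simp add: int_pow_mod[OF assms])
  also have "\<dots> = g [^] int (nat (z mod int N) * nat (w mod int N))"
    using assms(1) by (simp only: nat_pow_pow int_pow_int)
  also have "\<dots> = g [^] (z * w)"
    using assms(3) by (intro finite_order_int_pow_cong[OF assms]) (simp add: cong_def mod_simps)
  finally show ?thesis .
qed

end

section \<open>Elements that commute up to a scalar\<close>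

context k_algebra
begin

lemma scalar_commute_pow_left:
  assumes "a \<in> carrier A" "b \<in> carrier A" "a \<otimes> b = c \<odot> (b \<otimes> a)"
  shows "a [^] (n::nat) \<otimes> b = c ^ n \<odot> (b \<otimes> a [^] n)"
proof (induction n)
  case 0
  then show ?case using assms by simp
next
  case (Suc n)
  have "a [^] Suc n \<otimes> b = a [^] n \<otimes> (a \<otimes> b)"
    using assms by (simp add: m_assoc)
  also have "\<dots> = c \<odot> ((a [^] n \<otimes> b) \<otimes> a)"
    using assms by (simp add: smult_mult_r m_assoc)
  also have "\<dots> = c ^ Suc n \<odot> (b \<otimes> a [^] Suc n)"
    using assms(1,2) by (simp add: Suc smult_mult_l smult_smult m_assoc)
  finally show ?case .
qed

lemma scalar_commute_pow_right:
  assumes "a \<in> carrier A" "b \<in> carrier A" "a \<otimes> b = c \<odot> (b \<otimes> a)"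
  shows "a \<otimes> b [^] (n::nat) = c ^ n \<odot> (b [^] n \<otimes> a)"
proof (induction n)
  case 0
  then show ?case using assms by simp
next
  case (Suc n)
  have "a \<otimes> b [^] Suc n = (a \<otimes> b [^] n) \<otimes> b"
    using assms by (simp add: m_assoc)
  also have "\<dots> = c ^ n \<odot> (b [^] n \<otimes> (a \<otimes> b))"
    using assms(1,2) by (simp add: Suc smult_mult_l m_assoc)
  also have "\<dots> = c ^ Suc n \<odot> (b [^] Suc n \<otimes> a)"
    using assms by (simp add: smult_mult_r smult_smult m_assoc mult.commute)
  finally show ?case .
qed

lemma scalar_commute_int_pow:
  assumes "a \<in> carrier A" "b \<in> carrier A" "a \<otimes> b = c \<odot> (b \<otimes> a)"
    and "a [^] N = \<one>" "c ^ N = 1" "N > (0::nat)"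
  shows "a [^] (z::int) \<otimes> b = (c powi z) \<odot> (b \<otimes> a [^] z)"
  using scalar_commute_pow_left[OF assms(1-3)]
  by (simp add: int_pow_mod[OF assms(1,4,6)] root_powi[OF assms(5,6)])

end

section \<open>The binomial theorem for q-commuting elements\<close>

text \<open>The \<open>q\<close>-binomial coefficients, by the Pascal rule that arises from expanding
  \<open>(a \<oplus> b) \<otimes> (a \<oplus> b) [^] n\<close>.\<close>

fun gauss_binomial :: "'k::comm_ring_1 \<Rightarrow> nat \<Rightarrow> nat \<Rightarrow> 'k" where
  "gauss_binomial p n 0 = 1"
| "gauss_binomial p 0 (Suc j) = 0"
| "gauss_binomial p (Suc n) (Suc j) = gauss_binomial p n j + p ^ Suc j * gauss_binomial p n (Suc j)"

lemma gauss_binomial_eq_0: "n < j \<Longrightarrow> gauss_binomial p n j = 0"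
proof (induction n arbitrary: j)
  case 0
  then show ?case by (cases j) auto
next
  case (Suc n)
  then obtain i where "j = Suc i" "n < i" by (cases j) auto
  with Suc.IH show ?case by simp
qed

text \<open>The quotient of neighbouring coefficients, cleared of denominators. It combines the two Pascal
  rules, of which only one is part of the definition.\<close>

lemma gauss_binomial_absorb:
  "j \<le> n \<Longrightarrow> (1 - p ^ Suc j) * gauss_binomial p n (Suc j) = (1 - p ^ (n - j)) * gauss_binomial p n j"
proof (induction n arbitrary: j)
  case 0
  then show ?case by simp
next
  case (Suc n)
  show ?case
  proof (cases j)
    case 0
    have IH: "(1 - p) * gauss_binomial p n 1 = 1 - p ^ n"
      using Suc.IH[of 0] by simp
    have "(1 - p) * (1 + p * gauss_binomial p n 1) = (1 - p) + p * ((1 - p) * gauss_binomial p n 1)"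
      by (simp add: algebra_simps)
    also have "\<dots> = 1 - p ^ Suc n"
      unfolding IH by (simp add: algebra_simps)
    finally show ?thesis using 0 by simp
  next
    case (Suc i)
    let ?G = "gauss_binomial p n"
    have i: "i \<le> n" using Suc.prems Suc by simp
    have e: "p ^ Suc i * p ^ (n - i) = p ^ Suc n"
      using i power_add[of p "Suc i" "n - i"] by (metis add_Suc le_add_diff_inverse)
    have A: "(1 - p ^ Suc (Suc i)) * ?G (Suc (Suc i)) * p ^ Suc (Suc i) =
        (p ^ Suc (Suc i) - p ^ Suc n) * ?G (Suc i)"
    proof (cases "Suc i \<le> n")
      case True
      have "p ^ Suc (Suc i) * p ^ (n - Suc i) = p ^ Suc n"
        using True power_add[of p "Suc (Suc i)" "n - Suc i"] by (metis add_Suc le_add_diff_inverse)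
      then show ?thesis
        using Suc.IH[OF True] by (simp only:) (simp add: algebra_simps)
    next
      case False
      then show ?thesis by (simp add: gauss_binomial_eq_0)
    qed
    have "(1 - p ^ Suc (Suc i)) * gauss_binomial p (Suc n) (Suc (Suc i)) =
        (1 - p ^ Suc (Suc i)) * ?G (Suc i) + (1 - p ^ Suc (Suc i)) * ?G (Suc (Suc i)) * p ^ Suc (Suc i)"
      by (simp add: algebra_simps)
    also have "\<dots> = (1 - p ^ Suc n) * ?G (Suc i)"
      unfolding A by (simp add: algebra_simps)
    finally have L: "(1 - p ^ Suc (Suc i)) * gauss_binomial p (Suc n) (Suc (Suc i)) = (1 - p ^ Suc n) * ?G (Suc i)" .
    have "(1 - p ^ (n - i)) * gauss_binomial p (Suc n) (Suc i) =
        (1 - p ^ (n - i)) * ?G i + (p ^ Suc i - p ^ Suc i * p ^ (n - i)) * ?G (Suc i)"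
      by (simp add: algebra_simps)
    also have "\<dots> = (1 - p ^ Suc n) * ?G (Suc i)"
      unfolding e Suc.IH[OF i, symmetric] by (simp add: algebra_simps)
    finally show ?thesis
      using L Suc by simp
  qed
qed

text \<open>At \<open>j = 0\<close> the right-hand side of the previous identity is \<open>1 - p ^ n = 0\<close>; the zero then
  propagates upwards, since the factors \<open>1 - p ^ Suc j\<close> are invertible for \<open>Suc j < n\<close>.\<close>

lemma gauss_binomial_root_of_unity:
  fixes p :: "'k::field"
  assumes "p ^ n = 1" "\<And>j. 0 < j \<Longrightarrow> j < n \<Longrightarrow> p ^ j \<noteq> 1" "0 < j" "j < n"
  shows "gauss_binomial p n j = 0"
  using assms(3,4)
proof (induction j)
  case (Suc j)
  have "(1 - p ^ Suc j) * gauss_binomial p n (Suc j) = (1 - p ^ (n - j)) * gauss_binomial p n j"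
    using Suc.prems by (intro gauss_binomial_absorb) simp
  also have "\<dots> = 0"
    using Suc assms(1) by (cases "j = 0") simp_all
  finally show ?case
    using assms(2)[of "Suc j"] Suc.prems by simp
qed simp

lemma (in k_algebra) gauss_binomial_theorem:
  assumes a: "a \<in> carrier A" and b: "b \<in> carrier A" and ba: "b \<otimes> a = p \<odot> (a \<otimes> b)"
  shows "(a \<oplus> b) [^] (n::nat) = (\<Oplus>j\<in>{..n}. gauss_binomial p n j \<odot> (a [^] j \<otimes> b [^] (n - j)))"
proof (induction n)
  case 0
  then show ?case using a b by simp
next
  case (Suc n)
  let ?G = "gauss_binomial p"
  let ?m = "\<lambda>(n::nat) (j::nat). a [^] j \<otimes> b [^] (n - j)"
  let ?X = "\<Oplus>j\<in>{..n}. ?G n j \<odot> ?m (Suc n) (Suc j)"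
  let ?Y = "\<Oplus>j\<in>{..n}. (p ^ Suc j * ?G n (Suc j)) \<odot> ?m (Suc n) (Suc j)"
  have m: "?m n j \<in> carrier A" for n j using a b by simp
  have "(a \<oplus> b) [^] Suc n = (a \<oplus> b) \<otimes> (\<Oplus>j\<in>{..n}. ?G n j \<odot> ?m n j)"
    using a b nat_pow_Suc2[of "a \<oplus> b" n] by (simp add: Suc)
  also have "\<dots> = (\<Oplus>j\<in>{..n}. a \<otimes> (?G n j \<odot> ?m n j)) \<oplus> (\<Oplus>j\<in>{..n}. b \<otimes> (?G n j \<odot> ?m n j))"
    using a b by (simp add: l_distr finsum_rdistr finsum_closed Pi_def)
  also have "(\<Oplus>j\<in>{..n}. a \<otimes> (?G n j \<odot> ?m n j)) = (\<Oplus>j\<in>{..n}. ?G n j \<odot> ?m (Suc n) (Suc j))"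
    using a b nat_pow_Suc2[OF a]
    by (intro finsum_cong') (auto simp: smult_mult_r m_assoc[symmetric] simp del: nat_pow_Suc)
  also have "(\<Oplus>j\<in>{..n}. b \<otimes> (?G n j \<odot> ?m n j)) = (\<Oplus>j\<in>{..n}. (p ^ j * ?G n j) \<odot> ?m (Suc n) j)"
  proof (intro finsum_cong')
    fix j assume "j \<in> {..n}"
    then have j: "Suc n - j = Suc (n - j)" by simp
    have "b \<otimes> ?m n j = (b \<otimes> a [^] j) \<otimes> b [^] (n - j)"
      using a b by (simp add: m_assoc)
    also have "\<dots> = p ^ j \<odot> (a [^] j \<otimes> (b \<otimes> b [^] (n - j)))"
      using a b scalar_commute_pow_right[OF b a ba] by (simp add: smult_mult_l m_assoc)
    also have "b \<otimes> b [^] (n - j) = b [^] (Suc n - j)"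
      unfolding j using b by (simp only: nat_pow_Suc2)
    finally show "b \<otimes> (?G n j \<odot> ?m n j) = (p ^ j * ?G n j) \<odot> ?m (Suc n) j"
      using a b by (simp add: smult_mult_r smult_smult mult.commute)
  qed (use a b in auto)
  also have "(\<Oplus>j\<in>{..n}. (p ^ j * ?G n j) \<odot> ?m (Suc n) j) =
      (\<Oplus>j\<in>{..Suc n}. (p ^ j * ?G n j) \<odot> ?m (Suc n) j)"
    using a b by (subst finsum_Suc) (auto simp: gauss_binomial_eq_0 finsum_closed Pi_def simp del: nat_pow_Suc)
  also have "\<dots> = (\<Oplus>j\<in>{..n}. (p ^ Suc j * ?G n (Suc j)) \<odot> ?m (Suc n) (Suc j)) \<oplus> ?m (Suc n) 0"
    using a b by (subst finsum_Suc2) (auto simp del: nat_pow_Suc)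
  also have "?X \<oplus> (?Y \<oplus> ?m (Suc n) 0) = (?X \<oplus> ?Y) \<oplus> ?m (Suc n) 0"
    by (intro a_assoc[symmetric] finsum_closed) (auto simp only: Pi_iff smult_closed m)
  also have "?X \<oplus> ?Y = (\<Oplus>j\<in>{..n}. ?G n j \<odot> ?m (Suc n) (Suc j) \<oplus>
      (p ^ Suc j * ?G n (Suc j)) \<odot> ?m (Suc n) (Suc j))"
    by (intro finsum_addf[symmetric]) (auto simp only: Pi_iff smult_closed m)
  also have "\<dots> = (\<Oplus>j\<in>{..n}. ?G (Suc n) (Suc j) \<odot> ?m (Suc n) (Suc j))"
    by (intro finsum_cong')
      (auto simp only: Pi_iff smult_closed m gauss_binomial.simps smult_l_distr)
  also have "(\<Oplus>j\<in>{..n}. ?G (Suc n) (Suc j) \<odot> ?m (Suc n) (Suc j)) \<oplus> ?m (Suc n) 0 =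
      (\<Oplus>j\<in>{..Suc n}. ?G (Suc n) j \<odot> ?m (Suc n) j)"
    using a b by (subst finsum_Suc2) (auto simp del: nat_pow_Suc)
  finally show ?case .
qed

text \<open>The mixed terms carry vanishing binomial coefficients, and the two pure terms vanish by
  assumption.\<close>

lemma (in k_algebra) q_commuting_nilpotent_sum:
  assumes a: "a \<in> carrier A" and b: "b \<in> carrier A" and ba: "b \<otimes> a = p \<odot> (a \<otimes> b)"
    and p: "p ^ n = 1" "\<And>j. 0 < j \<Longrightarrow> j < n \<Longrightarrow> p ^ j \<noteq> 1"
    and nil: "a [^] (n::nat) = \<zero>" "b [^] n = \<zero>"
  shows "(a \<oplus> b) [^] n = \<zero>"
proof -
  have "gauss_binomial p n j \<odot> (a [^] j \<otimes> b [^] (n - j)) = \<zero>" if "j \<le> n" for j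
  proof (cases "0 < j \<and> j < n")
    case True
    then show ?thesis using gauss_binomial_root_of_unity[OF p] a b by simp
  next
    case False
    with that consider "j = 0" | "j = n" by linarith
    then show ?thesis using nil a b by cases simp_all
  qed
  then have "(\<Oplus>j\<in>{..n}. gauss_binomial p n j \<odot> (a [^] j \<otimes> b [^] (n - j))) = (\<Oplus>j\<in>{..n}. \<zero>)"
    using a b by (intro finsum_cong') auto
  then show ?thesis
    using gauss_binomial_theorem[OF a b ba, of n] by simp
qed

section \<open>Free algebras and their quotients by relations\<close>

lemma monoid_free_monoid: "monoid free_monoid"
  by (rule monoidI) (auto simp: free_monoid_def)

lemma k_algebra_free_alg: "k_algebra (free_alg :: ('k::field, 's list \<Rightarrow>\<^sub>0 'k) module)"
  by (rule k_algebra_monoid_alg) (rule monoid_free_monoid)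

lemma free_alg_carrier [simp]: "v \<in> carrier free_alg"
  by (simp add: free_monoid_def)

lemma free_alg_word_Cons:
  "Poly_Mapping.single (s # w) 1 = free_gen s \<otimes>\<^bsub>free_alg\<^esub> Poly_Mapping.single w (1::'k::field)"
  by (simp add: free_gen_def free_monoid_def)

lemma free_hom_alg_hom:
  assumes "k_algebra B" "\<And>s. \<phi> s \<in> carrier B"
  shows "k_alg_hom free_alg B (free_hom B \<phi>)" "free_hom B \<phi> (free_gen s) = \<phi> s"
proof -
  interpret B: k_algebra B by fact
  let ?W = "\<lambda>w. foldr (\<lambda>s b. \<phi> s \<otimes>\<^bsub>B\<^esub> b) w \<one>\<^bsub>B\<^esub>"
  have closed: "?W w \<in> carrier B" for w
    by (induction w) (auto simp: assms)
  have app: "?W (v @ w) = ?W v \<otimes>\<^bsub>B\<^esub> ?W w" for v w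
    by (induction v) (simp_all add: closed assms B.m_assoc del: foldr_append)
  show "k_alg_hom free_alg B (free_hom B \<phi>)"
    unfolding free_hom_def
  proof (rule B.lin_ext_alg_hom[OF monoid_free_monoid])
    show "?W \<in> carrier free_monoid \<rightarrow> carrier B"
      using closed by blast
    show "?W (v \<otimes>\<^bsub>free_monoid\<^esub> w) = ?W v \<otimes>\<^bsub>B\<^esub> ?W w" for v w
      unfolding app[symmetric] by (simp add: free_monoid_def)
  qed (simp add: free_monoid_def)
  show "free_hom B \<phi> (free_gen s) = \<phi> s"
    by (simp add: free_hom_def free_gen_def assms)
qed

text \<open>The hypothesis of the universal property of the algebra, for images \<open>\<phi>\<close> of the generators.\<close>

definition taft_relations ::
  "nat \<Rightarrow> 'k::field \<Rightarrow> int^2^2 \<Rightarrow> ('k, 'b, 'z) module_scheme \<Rightarrow> (gen \<Rightarrow> 'b) \<Rightarrow> bool" where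
  "taft_relations N q A B \<phi> \<longleftrightarrow> (\<forall>s. \<phi> s \<in> carrier B) \<and>
     \<phi> Gen_x [^]\<^bsub>B\<^esub> taft_Nx N A = \<zero>\<^bsub>B\<^esub> \<and> \<phi> Gen_y [^]\<^bsub>B\<^esub> taft_Ny N A = \<zero>\<^bsub>B\<^esub> \<and>
     \<phi> Gen_x \<otimes>\<^bsub>B\<^esub> \<phi> Gen_y = (q powi (A$1$1 * A$2$2)) \<odot>\<^bsub>B\<^esub> (\<phi> Gen_y \<otimes>\<^bsub>B\<^esub> \<phi> Gen_x) \<and>
     \<phi> Gen_g [^]\<^bsub>B\<^esub> N = \<one>\<^bsub>B\<^esub> \<and>
     \<phi> Gen_g \<otimes>\<^bsub>B\<^esub> \<phi> Gen_x = (q powi (A$1$2)) \<odot>\<^bsub>B\<^esub> (\<phi> Gen_x \<otimes>\<^bsub>B\<^esub> \<phi> Gen_g) \<and>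
     \<phi> Gen_g \<otimes>\<^bsub>B\<^esub> \<phi> Gen_y = (q powi (A$2$2)) \<odot>\<^bsub>B\<^esub> (\<phi> Gen_y \<otimes>\<^bsub>B\<^esub> \<phi> Gen_g)"

locale taft =
  fixes N :: nat and q :: "'k::field" and A :: "int^2^2"
  assumes q: "primitive_root_of_unity N q" and A: "parameter_matrix N A"
begin

abbreviation "F \<equiv> free_alg :: ('k, gen list \<Rightarrow>\<^sub>0 'k) module"
abbreviation "J \<equiv> taft_ideal N q A"
abbreviation "H \<equiv> taft_alg N q A"
abbreviation "g \<equiv> taft_g N q A"
abbreviation "x \<equiv> taft_x N q A"
abbreviation "y \<equiv> taft_y N q A"

lemma N_pos: "N > 0" and q_N: "q ^ N = 1" and q_nonzero: "q \<noteq> 0"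
  using q by (auto simp: primitive_root_of_unity_def power_0_left)

sublocale F: k_algebra F by (rule k_algebra_free_alg)

definition rels :: "(gen list \<Rightarrow>\<^sub>0 'k) set" where
  "rels = (let g = free_gen Gen_g; x = free_gen Gen_x; y = free_gen Gen_y
     in {x [^]\<^bsub>F\<^esub> taft_Nx N A,
               y [^]\<^bsub>F\<^esub> taft_Ny N A,
               x \<otimes>\<^bsub>F\<^esub> y \<ominus>\<^bsub>F\<^esub> (q powi (A$1$1 * A$2$2)) \<odot>\<^bsub>F\<^esub> (y \<otimes>\<^bsub>F\<^esub> x),
               g [^]\<^bsub>F\<^esub> N \<ominus>\<^bsub>F\<^esub> \<one>\<^bsub>F\<^esub>,
               g \<otimes>\<^bsub>F\<^esub> x \<ominus>\<^bsub>F\<^esub> (q powi (A$1$2)) \<odot>\<^bsub>F\<^esub> (x \<otimes>\<^bsub>F\<^esub> g),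
               g \<otimes>\<^bsub>F\<^esub> y \<ominus>\<^bsub>F\<^esub> (q powi (A$2$2)) \<odot>\<^bsub>F\<^esub> (y \<otimes>\<^bsub>F\<^esub> g)})"

lemma taft_ideal_eq: "J = Idl\<^bsub>F\<^esub> rels"
  unfolding taft_ideal_def rels_def Let_def ..

sublocale Q: k_algebra_ideal F J
  unfolding taft_ideal_eq
  by (intro k_algebra_ideal.intro F.k_algebra_axioms F.genideal_ideal subsetI free_alg_carrier)

lemma rels_in_ideal: "rels \<subseteq> J"
  unfolding taft_ideal_eq by (intro F.genideal_self subsetI free_alg_carrier)

sublocale H: k_algebra H
  unfolding taft_alg_def by (rule Q.k_algebra_quot_alg)

lemma coset_hom: "k_alg_hom F H (\<lambda>v. J +>\<^bsub>F\<^esub> v)"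
  unfolding taft_alg_def by (rule Q.coset_alg_hom)

lemma H_carrier: "h \<in> carrier H \<longleftrightarrow> (\<exists>v. h = J +>\<^bsub>F\<^esub> v)"
  unfolding taft_alg_def Q.quot_alg_simps using free_alg_carrier by blast

lemma gen_closed [simp]: "taft_gen N q A s \<in> carrier H"
  unfolding H_carrier taft_gen_def by blast

lemma taft_relations_taft: "taft_relations N q A H (taft_gen N q A)"
proof -
  let ?p = "\<lambda>v. J +>\<^bsub>F\<^esub> v"
  note hom = k_alg_homD[OF coset_hom]
  have z: "?p v = \<zero>\<^bsub>H\<^esub>" if "v \<in> rels" for v
    using F.a_rcos_zero[OF Q.is_ideal, of v] F.a_rcos_zero[OF Q.is_ideal, of "\<zero>\<^bsub>F\<^esub>"]
      that rels_in_ideal additive_subgroup.zero_closed[OF Q.is_additive_subgroup]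
    by (auto simp: taft_alg_def)
  have e: "?p u = ?p v" if "u \<ominus>\<^bsub>F\<^esub> v \<in> rels" for u v
    using that rels_in_ideal Q.coset_eq_iff[of u v] free_alg_carrier by blast
  note pow = k_alg_hom_pow[OF F.k_algebra_axioms H.k_algebra_axioms coset_hom free_alg_carrier]
  note h = hom(2) hom(3)[OF free_alg_carrier free_alg_carrier] hom(6)[OF free_alg_carrier] pow
  show ?thesis
    unfolding taft_relations_def
    using gen_closed
    by (intro conjI allI gen_closed; unfold taft_gen_def h[symmetric]; intro e z)
      (simp_all add: rels_def Let_def)
qed

lemmas H_relations = taft_relations_taft[unfolded taft_relations_def]

text \<open>The kernel of the homomorphism from the free algebra is an ideal that contains the relators,
  hence contains the ideal generated by them.\<close>

lemma taft_universal:
  assumes B: "k_algebra B" and rel: "taft_relations N q A B \<phi>"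
  shows "k_alg_hom H B (quot_map (free_hom B \<phi>))"
    and "quot_map (free_hom B \<phi>) (taft_gen N q A s) = \<phi> s"
proof -
  interpret B: k_algebra B by (rule B)
  have \<phi>: "\<phi> s \<in> carrier B" for s
    using rel by (simp add: taft_relations_def)
  let ?f = "free_hom B \<phi>"
  note f = free_hom_alg_hom(1)[of B \<phi>, OF B \<phi>] and f_gen = free_hom_alg_hom(2)[of B \<phi>, OF B \<phi>]
  note fD = k_alg_homD[OF f]
  interpret rh: ring_hom_ring F B ?f
    by (intro ring_hom_ringI F.ring_axioms B.ring_axioms fD)
  note minus = k_linear_minus[OF F.k_algebra_axioms B fD(1) free_alg_carrier free_alg_carrier]
  note pow = k_alg_hom_pow[OF F.k_algebra_axioms B f free_alg_carrier]
  note c = fD(2) fD(3)[OF free_alg_carrier free_alg_carrier] fD(6)[OF free_alg_carrier] pow minus f_gen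
  have self: "u \<ominus>\<^bsub>B\<^esub> u = \<zero>\<^bsub>B\<^esub>" if "u \<in> carrier B" for u
    using that by (simp add: a_minus_def B.r_neg)
  have "?f v = \<zero>\<^bsub>B\<^esub>" if "v \<in> rels" for v
    using that rel \<phi> unfolding rels_def Let_def taft_relations_def
    by (elim insertE emptyE; simp only: c) (simp_all add: self)
  moreover have "v \<in> a_kernel F B ?f \<longleftrightarrow> ?f v = \<zero>\<^bsub>B\<^esub>" for v
    unfolding a_kernel_def' using free_alg_carrier by blast
  ultimately have "rels \<subseteq> a_kernel F B ?f"
    by blast
  then have "J \<subseteq> a_kernel F B ?f"
    unfolding taft_ideal_eq by (intro F.genideal_minimal rh.kernel_is_ideal)
  then have ker: "?f j = \<zero>\<^bsub>B\<^esub>" if "j \<in> J" for j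
    using that unfolding a_kernel_def' by blast
  show "k_alg_hom H B (quot_map ?f)"
    unfolding taft_alg_def by (rule Q.quot_map_alg_hom[OF B f ker])
  show "quot_map ?f (taft_gen N q A s) = \<phi> s"
    unfolding taft_gen_def by (simp only: Q.quot_map_coset[OF B fD(1) ker free_alg_carrier] f_gen)
qed

lemma taft_linear_eqI:
  assumes "k_algebra B" "k_linear H B f" "k_linear H B h"
    and eq: "\<And>w. f (J +>\<^bsub>F\<^esub> Poly_Mapping.single w 1) = h (J +>\<^bsub>F\<^esub> Poly_Mapping.single w 1)"
    and a: "a \<in> carrier H"
  shows "f a = h a"
proof -
  note p = k_alg_homD(1)[OF coset_hom]
  from a obtain v where v: "a = J +>\<^bsub>F\<^esub> v"
    by (auto simp: H_carrier)
  have "f (J +>\<^bsub>F\<^esub> v) = h (J +>\<^bsub>F\<^esub> v)"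
    by (rule monoid_alg_linear_eqI[OF assms(1) k_linear_comp[OF p assms(2)] k_linear_comp[OF p assms(3)]
        monoid_free_monoid eq free_alg_carrier])
  then show ?thesis using v by simp
qed

lemma word_Cons:
  "J +>\<^bsub>F\<^esub> Poly_Mapping.single (s # w) 1 = taft_gen N q A s \<otimes>\<^bsub>H\<^esub> (J +>\<^bsub>F\<^esub> Poly_Mapping.single w 1)"
  unfolding free_alg_word_Cons taft_gen_def
  by (rule k_alg_homD(3)[OF coset_hom free_alg_carrier free_alg_carrier])

lemma word_Nil: "J +>\<^bsub>F\<^esub> Poly_Mapping.single [] 1 = \<one>\<^bsub>H\<^esub>"
  using k_alg_homD(2)[OF coset_hom] by (simp add: free_monoid_def)

lemma word_closed: "J +>\<^bsub>F\<^esub> v \<in> carrier H"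
  by (auto simp: H_carrier)

lemma taft_hom_eqI:
  assumes "k_algebra B" "k_alg_hom H B f" "k_alg_hom H B h"
    and eq: "f g = h g" "f x = h x" "f y = h y"
    and a: "a \<in> carrier H"
  shows "f a = h a"
proof (rule taft_linear_eqI[OF assms(1) k_alg_homD(1)[OF assms(2)] k_alg_homD(1)[OF assms(3)] _ a])
  fix w :: "gen list"
  have gens: "f (taft_gen N q A s) = h (taft_gen N q A s)" for s
    using eq by (cases s) auto
  show "f (J +>\<^bsub>F\<^esub> Poly_Mapping.single w 1) = h (J +>\<^bsub>F\<^esub> Poly_Mapping.single w 1)"
  proof (induction w)
    case Nil
    show ?case
      by (simp only: word_Nil k_alg_homD(2)[OF assms(2)] k_alg_homD(2)[OF assms(3)])
  next
    case (Cons s w)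
    then show ?case
      by (simp only: word_Cons k_alg_homD(3)[OF assms(2) gen_closed word_closed]
          k_alg_homD(3)[OF assms(3) gen_closed word_closed] gens)
  qed
qed

section \<open>Powers of g and commutation\<close>

lemma g_N: "g [^]\<^bsub>H\<^esub> N = \<one>\<^bsub>H\<^esub>"
  using H_relations by simp

abbreviation gp :: "int \<Rightarrow> 'k taft" where "gp z \<equiv> g [^]\<^bsub>H\<^esub> z"

lemma gp_closed [simp]: "gp z \<in> carrier H"
  by (rule H.finite_order_int_pow_closed[OF gen_closed g_N N_pos])

lemma gp_mult: "gp z \<otimes>\<^bsub>H\<^esub> gp w = gp (z + w)"
  by (rule H.finite_order_int_pow_mult[OF gen_closed g_N N_pos])

lemma gp_1: "gp 1 = g"
  by (simp add: int_pow_def2)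

lemma inv_g: "inv\<^bsub>H\<^esub> g = gp (- 1)"
  by (rule H.finite_order_inv[OF gen_closed g_N N_pos])

lemma gp_gp: "gp z [^]\<^bsub>H\<^esub> (w::int) = gp (z * w)"
  by (rule H.finite_order_int_pow_pow[OF gen_closed g_N N_pos])

lemma gp_N: "gp z [^]\<^bsub>H\<^esub> N = \<one>\<^bsub>H\<^esub>"
  by (rule H.finite_order_int_pow_order[OF gen_closed g_N N_pos])

lemma q_powi_N: "(q powi z) ^ N = 1"
  using q_N by (metis power_int_mult_distrib power_int_mult power_int_of_nat mult.commute power_int_1_left)

lemma gp_x: "gp z \<otimes>\<^bsub>H\<^esub> x = (q powi (A$1$2 * z)) \<odot>\<^bsub>H\<^esub> (x \<otimes>\<^bsub>H\<^esub> gp z)"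
  using H.scalar_commute_int_pow[OF gen_closed gen_closed _ g_N q_powi_N N_pos, of Gen_x "A$1$2" z] H_relations
  by (simp add: power_int_mult)

lemma gp_y: "gp z \<otimes>\<^bsub>H\<^esub> y = (q powi (A$2$2 * z)) \<odot>\<^bsub>H\<^esub> (y \<otimes>\<^bsub>H\<^esub> gp z)"
  using H.scalar_commute_int_pow[OF gen_closed gen_closed _ g_N q_powi_N N_pos, of Gen_y "A$2$2" z] H_relations
  by (simp add: power_int_mult)

lemma x_y: "x \<otimes>\<^bsub>H\<^esub> y = (q powi (A$1$1 * A$2$2)) \<odot>\<^bsub>H\<^esub> (y \<otimes>\<^bsub>H\<^esub> x)"
  using H_relations by simp

lemma x_nilpotent: "x [^]\<^bsub>H\<^esub> taft_Nx N A = \<zero>\<^bsub>H\<^esub>" and y_nilpotent: "y [^]\<^bsub>H\<^esub> taft_Ny N A = \<zero>\<^bsub>H\<^esub>"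
  using H_relations by simp_all

text \<open>As \<open>q\<close> is a primitive root of unity, \<open>(q powi a) ^ n = 1\<close> holds exactly if \<open>n a\<close> vanishes modulo \<open>N\<close>.\<close>

lemma add_order_properties:
  assumes "\<not> [a = 0] (mod int N)"
  shows "add_order N a \<ge> 2" "(q powi a) ^ add_order N a = 1"
    "\<And>j. 0 < j \<Longrightarrow> j < add_order N a \<Longrightarrow> (q powi a) ^ j \<noteq> 1"
proof -
  let ?P = "\<lambda>n. 0 < n \<and> [int n * a = 0] (mod int N)"
  have P: "(q powi a) ^ n = 1 \<longleftrightarrow> [int n * a = 0] (mod int N)" for n
  proof -
    have "(q powi a) ^ n = q powi (int n * a)"
      by (metis power_int_mult power_int_of_nat mult.commute)
    then show ?thesis by (simp add: primitive_root_powi_eq_1_iff[OF q])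
  qed
  have "?P N"
    using N_pos by (simp add: cong_def)
  then have L: "?P (add_order N a)"
    unfolding add_order_def by (rule LeastI)
  then show "(q powi a) ^ add_order N a = 1"
    by (simp add: P)
  show "add_order N a \<ge> 2"
  proof -
    have "add_order N a \<noteq> 1"
    proof
      assume "add_order N a = 1"
      with L assms show False by simp
    qed
    with L show ?thesis by linarith
  qed
  show "(q powi a) ^ j \<noteq> 1" if "0 < j" "j < add_order N a" for j
    using not_less_Least[of j ?P] that unfolding P add_order_def by auto
qed

lemmas Nx_properties = add_order_properties[of "A$1$1 * A$1$2", folded taft_Nx_def]
lemmas Ny_properties = add_order_properties[of "A$2$1 * A$2$2", folded taft_Ny_def]

lemma A_nonzero:
  "\<not> [A$1$1 * A$1$2 = 0] (mod int N)" "\<not> [A$2$1 * A$2$2 = 0] (mod int N)"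
  using A by (simp_all add: parameter_matrix_def)

text \<open>This is where the condition \<open>a11 a22 + a12 a21 = 0\<close> on the parameter matrix enters: it makes the
  coproduct and the antipode compatible with the relation between \<open>x\<close> and \<open>y\<close>.\<close>

lemma q_A: "q powi (A$1$1 * A$2$2) * q powi (A$1$2 * A$2$1) = 1"
  using A primitive_root_powi_eq_1_iff[OF q, of "A$1$1 * A$2$2 + A$1$2 * A$2$1"] q_nonzero
  by (simp add: parameter_matrix_def power_int_add)

section \<open>The structure maps of the generalised Taft algebra\<close>

sublocale P: k_algebra_pair H H ..

abbreviation "T2 \<equiv> tensor_alg H H"
abbreviation "t \<equiv> tens H H"

sublocale T2: k_algebra T2 by (rule P.k_algebra_tensor_alg)

lemmas t_simps = P.bilinD[OF P.k_algebra_tensor_alg P.tens_bilinear]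

lemma t_pow: "\<lbrakk>a \<in> carrier H; b \<in> carrier H\<rbrakk> \<Longrightarrow>
    t a b [^]\<^bsub>T2\<^esub> (n::nat) = t (a [^]\<^bsub>H\<^esub> n) (b [^]\<^bsub>H\<^esub> n)"
  by (induction n) (simp_all add: P.tens_one P.tens_mult)

lemma t_zero: "a \<in> carrier H \<Longrightarrow> t a \<zero>\<^bsub>H\<^esub> = \<zero>\<^bsub>T2\<^esub>" "a \<in> carrier H \<Longrightarrow> t \<zero>\<^bsub>H\<^esub> a = \<zero>\<^bsub>T2\<^esub>"
  using t_simps(4)[of a "\<zero>\<^bsub>H\<^esub>" 0] t_simps(5)[of "\<zero>\<^bsub>H\<^esub>" a 0] by (simp_all add: t_simps)

text \<open>The two summands of the coproduct of a skew primitive element commute up to the scalar \<open>p\<close>,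
  whose order is the nilpotency index, so the binomial theorem leaves no mixed terms.\<close>

lemma skew_primitive_nilpotent:
  assumes z: "z \<in> carrier H" and w: "w \<in> carrier H" and wz: "w \<otimes>\<^bsub>H\<^esub> z = p \<odot>\<^bsub>H\<^esub> (z \<otimes>\<^bsub>H\<^esub> w)"
    and p: "p ^ n = 1" "\<And>j. 0 < j \<Longrightarrow> j < n \<Longrightarrow> p ^ j \<noteq> 1" and n: "z [^]\<^bsub>H\<^esub> n = \<zero>\<^bsub>H\<^esub>"
  shows "(t \<one>\<^bsub>H\<^esub> z \<oplus>\<^bsub>T2\<^esub> t z w) [^]\<^bsub>T2\<^esub> n = \<zero>\<^bsub>T2\<^esub>"
proof (rule T2.q_commuting_nilpotent_sum[OF _ _ _ p])
  show "t z w \<otimes>\<^bsub>T2\<^esub> t \<one>\<^bsub>H\<^esub> z = p \<odot>\<^bsub>T2\<^esub> (t \<one>\<^bsub>H\<^esub> z \<otimes>\<^bsub>T2\<^esub> t z w)"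
    using z w by (simp add: P.tens_mult wz t_simps)
qed (use z w n in \<open>simp_all add: t_simps t_pow t_zero\<close>)

lemma g_powers_x: "gp (A$1$1) \<otimes>\<^bsub>H\<^esub> x = (q powi (A$1$1 * A$1$2)) \<odot>\<^bsub>H\<^esub> (x \<otimes>\<^bsub>H\<^esub> gp (A$1$1))"
  and g_powers_y: "gp (A$2$1) \<otimes>\<^bsub>H\<^esub> y = (q powi (A$2$1 * A$2$2)) \<odot>\<^bsub>H\<^esub> (y \<otimes>\<^bsub>H\<^esub> gp (A$2$1))"
  using gp_x[of "A$1$1"] gp_y[of "A$2$1"] by (simp_all add: mult.commute)

lemma g_x: "g \<otimes>\<^bsub>H\<^esub> x = (q powi (A$1$2)) \<odot>\<^bsub>H\<^esub> (x \<otimes>\<^bsub>H\<^esub> g)"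
  and g_y: "g \<otimes>\<^bsub>H\<^esub> y = (q powi (A$2$2)) \<odot>\<^bsub>H\<^esub> (y \<otimes>\<^bsub>H\<^esub> g)"
  using H_relations by simp_all

lemma g_gp: "g \<otimes>\<^bsub>H\<^esub> gp z = gp (1 + z)" "gp z \<otimes>\<^bsub>H\<^esub> g = gp (1 + z)"
  using gp_mult[of 1 z] gp_mult[of z 1] by (simp_all add: gp_1 add.commute)

lemma q_A': "q powi (A$1$1 * A$2$2) * q powi (A$1$2 * A$2$1) = 1"
    "q powi (A$1$1 * A$2$2) * (q powi (A$1$2 * A$2$1) * c) = c"
  using q_A by (simp_all add: mult.assoc[symmetric])

lemma comult_relations: "taft_relations N q A T2 (taft_comult_gen N q A)"
proof -
  let ?c = "q powi (A$1$1 * A$2$2)"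
  define u v where uv: "u = gp (A$1$1)" "v = gp (A$2$1)"
  have gens: "taft_comult_gen N q A Gen_g = t g g"
    "taft_comult_gen N q A Gen_x = t \<one>\<^bsub>H\<^esub> x \<oplus>\<^bsub>T2\<^esub> t x u"
    "taft_comult_gen N q A Gen_y = t \<one>\<^bsub>H\<^esub> y \<oplus>\<^bsub>T2\<^esub> t y v"
    by (simp_all add: uv Let_def)
  have c[simp]: "u \<in> carrier H" "v \<in> carrier H"
    by (simp_all add: uv)
  have "taft_comult_gen N q A s \<in> carrier T2" for s
    by (cases s) (simp_all only: gens, simp_all add: t_simps)
  moreover have "t g g [^]\<^bsub>T2\<^esub> N = \<one>\<^bsub>T2\<^esub>"
    by (simp add: t_pow g_N P.tens_one)
  moreover have "(t \<one>\<^bsub>H\<^esub> x \<oplus>\<^bsub>T2\<^esub> t x u) [^]\<^bsub>T2\<^esub> taft_Nx N A = \<zero>\<^bsub>T2\<^esub>"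
    unfolding uv using Nx_properties[OF A_nonzero(1)] g_powers_x x_nilpotent
    by (intro skew_primitive_nilpotent) auto
  moreover have "(t \<one>\<^bsub>H\<^esub> y \<oplus>\<^bsub>T2\<^esub> t y v) [^]\<^bsub>T2\<^esub> taft_Ny N A = \<zero>\<^bsub>T2\<^esub>"
    unfolding uv using Ny_properties[OF A_nonzero(2)] g_powers_y y_nilpotent
    by (intro skew_primitive_nilpotent) auto
  moreover have "(t \<one>\<^bsub>H\<^esub> x \<oplus>\<^bsub>T2\<^esub> t x u) \<otimes>\<^bsub>T2\<^esub> (t \<one>\<^bsub>H\<^esub> y \<oplus>\<^bsub>T2\<^esub> t y v) =
      ?c \<odot>\<^bsub>T2\<^esub> ((t \<one>\<^bsub>H\<^esub> y \<oplus>\<^bsub>T2\<^esub> t y v) \<otimes>\<^bsub>T2\<^esub> (t \<one>\<^bsub>H\<^esub> x \<oplus>\<^bsub>T2\<^esub> t x u))"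
  proof -
    have uy: "u \<otimes>\<^bsub>H\<^esub> y = ?c \<odot>\<^bsub>H\<^esub> (y \<otimes>\<^bsub>H\<^esub> u)"
      using gp_y[of "A$1$1"] by (simp add: uv mult.commute)
    have vx: "v \<otimes>\<^bsub>H\<^esub> x = (q powi (A$1$2 * A$2$1)) \<odot>\<^bsub>H\<^esub> (x \<otimes>\<^bsub>H\<^esub> v)"
      using gp_x[of "A$2$1"] by (simp add: uv)
    have vu: "v \<otimes>\<^bsub>H\<^esub> u = u \<otimes>\<^bsub>H\<^esub> v"
      by (simp add: uv gp_mult add.commute)
    \<comment> \<open>The mixed terms \<open>x \<otimes> y u\<close> and \<open>y \<otimes> x v\<close> occur on both sides, the second with the factors \<open>1\<close> and
      \<open>q powi (a11 a22) * q powi (a12 a21)\<close>, which agree by the condition on the matrix.\<close>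
    have L: "(t \<one>\<^bsub>H\<^esub> x \<oplus>\<^bsub>T2\<^esub> t x u) \<otimes>\<^bsub>T2\<^esub> (t \<one>\<^bsub>H\<^esub> y \<oplus>\<^bsub>T2\<^esub> t y v) =
        (?c \<odot>\<^bsub>T2\<^esub> t \<one>\<^bsub>H\<^esub> (y \<otimes>\<^bsub>H\<^esub> x) \<oplus>\<^bsub>T2\<^esub> t y (x \<otimes>\<^bsub>H\<^esub> v)) \<oplus>\<^bsub>T2\<^esub>
        (?c \<odot>\<^bsub>T2\<^esub> t x (y \<otimes>\<^bsub>H\<^esub> u) \<oplus>\<^bsub>T2\<^esub> ?c \<odot>\<^bsub>T2\<^esub> t (y \<otimes>\<^bsub>H\<^esub> x) (u \<otimes>\<^bsub>H\<^esub> v))"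
      by (simp add: t_simps T2.l_distr T2.r_distr P.tens_mult x_y uy T2.a_ac)
    have R: "(t \<one>\<^bsub>H\<^esub> y \<oplus>\<^bsub>T2\<^esub> t y v) \<otimes>\<^bsub>T2\<^esub> (t \<one>\<^bsub>H\<^esub> x \<oplus>\<^bsub>T2\<^esub> t x u) =
        (t \<one>\<^bsub>H\<^esub> (y \<otimes>\<^bsub>H\<^esub> x) \<oplus>\<^bsub>T2\<^esub> (q powi (A$1$2 * A$2$1)) \<odot>\<^bsub>T2\<^esub> t y (x \<otimes>\<^bsub>H\<^esub> v)) \<oplus>\<^bsub>T2\<^esub>
        (t x (y \<otimes>\<^bsub>H\<^esub> u) \<oplus>\<^bsub>T2\<^esub> t (y \<otimes>\<^bsub>H\<^esub> x) (u \<otimes>\<^bsub>H\<^esub> v))"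
      by (simp add: t_simps T2.l_distr T2.r_distr P.tens_mult vx vu T2.a_ac)
    show ?thesis
      unfolding L R by (simp add: t_simps T2.smult_r_distr T2.smult_smult q_A')
  qed
  moreover have "t g g \<otimes>\<^bsub>T2\<^esub> (t \<one>\<^bsub>H\<^esub> x \<oplus>\<^bsub>T2\<^esub> t x u) =
      (q powi (A$1$2)) \<odot>\<^bsub>T2\<^esub> ((t \<one>\<^bsub>H\<^esub> x \<oplus>\<^bsub>T2\<^esub> t x u) \<otimes>\<^bsub>T2\<^esub> t g g)"
    by (simp add: uv t_simps T2.l_distr T2.r_distr P.tens_mult g_x g_gp T2.smult_r_distr)
  moreover have "t g g \<otimes>\<^bsub>T2\<^esub> (t \<one>\<^bsub>H\<^esub> y \<oplus>\<^bsub>T2\<^esub> t y v) =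
      (q powi (A$2$2)) \<odot>\<^bsub>T2\<^esub> ((t \<one>\<^bsub>H\<^esub> y \<oplus>\<^bsub>T2\<^esub> t y v) \<otimes>\<^bsub>T2\<^esub> t g g)"
    by (simp add: uv t_simps T2.l_distr T2.r_distr P.tens_mult g_y g_gp T2.smult_r_distr)
  ultimately show ?thesis
    unfolding taft_relations_def by (simp only: gens simp_thms)
qed

definition \<Delta> :: "'k taft \<Rightarrow> ('k taft \<times> 'k taft \<Rightarrow>\<^sub>0 'k) set" where
  "\<Delta> = quot_map (free_hom T2 (taft_comult_gen N q A))"

lemma \<Delta>_hom: "k_alg_hom H T2 \<Delta>"
  unfolding \<Delta>_def by (rule taft_universal(1)[OF P.k_algebra_tensor_alg comult_relations])

lemma \<Delta>_gens:
  "\<Delta> g = t g g" "\<Delta> x = t \<one>\<^bsub>H\<^esub> x \<oplus>\<^bsub>T2\<^esub> t x (gp (A$1$1))" "\<Delta> y = t \<one>\<^bsub>H\<^esub> y \<oplus>\<^bsub>T2\<^esub> t y (gp (A$2$1))"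
  unfolding \<Delta>_def taft_universal(2)[OF P.k_algebra_tensor_alg comult_relations]
  by (simp_all add: Let_def)

lemma scalar_commute_nilpotent:
  assumes z: "z \<in> carrier H" and w: "w \<in> carrier H" and wz: "w \<otimes>\<^bsub>H\<^esub> z = p \<odot>\<^bsub>H\<^esub> (z \<otimes>\<^bsub>H\<^esub> w)"
    and n: "z [^]\<^bsub>H\<^esub> n = \<zero>\<^bsub>H\<^esub>"
  shows "(z \<otimes>\<^bsub>H\<^esub> w) [^]\<^bsub>H\<^esub> (n::nat) = \<zero>\<^bsub>H\<^esub>"
proof -
  have "\<exists>d. (z \<otimes>\<^bsub>H\<^esub> w) [^]\<^bsub>H\<^esub> m = d \<odot>\<^bsub>H\<^esub> (z [^]\<^bsub>H\<^esub> m \<otimes>\<^bsub>H\<^esub> w [^]\<^bsub>H\<^esub> m)" for m :: nat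
  proof (induction m)
    case 0
    show ?case by (rule exI[of _ 1]) simp
  next
    case (Suc m)
    then obtain d where d: "(z \<otimes>\<^bsub>H\<^esub> w) [^]\<^bsub>H\<^esub> m = d \<odot>\<^bsub>H\<^esub> (z [^]\<^bsub>H\<^esub> m \<otimes>\<^bsub>H\<^esub> w [^]\<^bsub>H\<^esub> m)" ..
    have "(z [^]\<^bsub>H\<^esub> m \<otimes>\<^bsub>H\<^esub> w [^]\<^bsub>H\<^esub> m) \<otimes>\<^bsub>H\<^esub> (z \<otimes>\<^bsub>H\<^esub> w) =
        z [^]\<^bsub>H\<^esub> m \<otimes>\<^bsub>H\<^esub> ((w [^]\<^bsub>H\<^esub> m \<otimes>\<^bsub>H\<^esub> z) \<otimes>\<^bsub>H\<^esub> w)"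
      using z w by (simp add: H.m_assoc)
    also have "\<dots> = p ^ m \<odot>\<^bsub>H\<^esub> (z [^]\<^bsub>H\<^esub> Suc m \<otimes>\<^bsub>H\<^esub> w [^]\<^bsub>H\<^esub> Suc m)"
      using z w by (simp add: H.scalar_commute_pow_left[OF w z wz] H.smult_mult_l H.smult_mult_r H.m_assoc)
    finally have "(z \<otimes>\<^bsub>H\<^esub> w) [^]\<^bsub>H\<^esub> Suc m = (d * p ^ m) \<odot>\<^bsub>H\<^esub> (z [^]\<^bsub>H\<^esub> Suc m \<otimes>\<^bsub>H\<^esub> w [^]\<^bsub>H\<^esub> Suc m)"
      using z w by (simp add: d H.smult_mult_l H.smult_smult)
    then show ?case ..
  qed
  from this[of n] show ?thesis
    using n w by auto
qed

text \<open>The opposite algebra turns the antihomomorphism into a homomorphism, to which the universal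
  property applies.\<close>

lemma antipode_relations: "taft_relations N q A (opp_alg H) (taft_antipode_gen N q A)"
proof -
  let ?c = "q powi (A$1$1 * A$2$2)"
  define u v where uv: "u = gp (- (A$1$1))" "v = gp (- (A$2$1))"
  have c[simp]: "u \<in> carrier H" "v \<in> carrier H"
    by (simp_all add: uv)
  have gens: "taft_antipode_gen N q A Gen_g = gp (- 1)"
    "taft_antipode_gen N q A Gen_x = (- 1) \<odot>\<^bsub>H\<^esub> (x \<otimes>\<^bsub>H\<^esub> u)"
    "taft_antipode_gen N q A Gen_y = (- 1) \<odot>\<^bsub>H\<^esub> (y \<otimes>\<^bsub>H\<^esub> v)"
    by (simp_all add: Let_def inv_g uv H.a_inv_eq_smult)
  have "taft_antipode_gen N q A s \<in> carrier (opp_alg H)" for s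
    by (cases s) (simp_all only: gens, simp_all)
  moreover have "gp (- 1) [^]\<^bsub>opp_alg H\<^esub> N = \<one>\<^bsub>opp_alg H\<^esub>"
    by (simp add: opp_alg_pow[OF H.k_algebra_axioms] gp_N)
  moreover have "((- 1) \<odot>\<^bsub>H\<^esub> (x \<otimes>\<^bsub>H\<^esub> u)) [^]\<^bsub>opp_alg H\<^esub> taft_Nx N A = \<zero>\<^bsub>opp_alg H\<^esub>"
  proof -
    have "(x \<otimes>\<^bsub>H\<^esub> u) [^]\<^bsub>H\<^esub> taft_Nx N A = \<zero>\<^bsub>H\<^esub>"
      unfolding uv by (rule scalar_commute_nilpotent[OF gen_closed gp_closed gp_x x_nilpotent])
    then show ?thesis
      by (simp add: opp_alg_pow[OF H.k_algebra_axioms] H.nat_pow_smult)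
  qed
  moreover have "((- 1) \<odot>\<^bsub>H\<^esub> (y \<otimes>\<^bsub>H\<^esub> v)) [^]\<^bsub>opp_alg H\<^esub> taft_Ny N A = \<zero>\<^bsub>opp_alg H\<^esub>"
  proof -
    have "(y \<otimes>\<^bsub>H\<^esub> v) [^]\<^bsub>H\<^esub> taft_Ny N A = \<zero>\<^bsub>H\<^esub>"
      unfolding uv by (rule scalar_commute_nilpotent[OF gen_closed gp_closed gp_y y_nilpotent])
    then show ?thesis
      by (simp add: opp_alg_pow[OF H.k_algebra_axioms] H.nat_pow_smult)
  qed
  moreover have "((- 1) \<odot>\<^bsub>H\<^esub> (y \<otimes>\<^bsub>H\<^esub> v)) \<otimes>\<^bsub>H\<^esub> ((- 1) \<odot>\<^bsub>H\<^esub> (x \<otimes>\<^bsub>H\<^esub> u)) =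
      ?c \<odot>\<^bsub>H\<^esub> (((- 1) \<odot>\<^bsub>H\<^esub> (x \<otimes>\<^bsub>H\<^esub> u)) \<otimes>\<^bsub>H\<^esub> ((- 1) \<odot>\<^bsub>H\<^esub> (y \<otimes>\<^bsub>H\<^esub> v)))"
  proof -
    have uy: "u \<otimes>\<^bsub>H\<^esub> y = (q powi (- (A$1$1 * A$2$2))) \<odot>\<^bsub>H\<^esub> (y \<otimes>\<^bsub>H\<^esub> u)"
      using gp_y[of "- (A$1$1)"] by (simp add: uv mult.commute)
    have vx: "v \<otimes>\<^bsub>H\<^esub> x = (q powi (- (A$1$2 * A$2$1))) \<odot>\<^bsub>H\<^esub> (x \<otimes>\<^bsub>H\<^esub> v)"
      using gp_x[of "- (A$2$1)"] by (simp add: uv)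
    have vu: "v \<otimes>\<^bsub>H\<^esub> u = u \<otimes>\<^bsub>H\<^esub> v"
      by (simp add: uv gp_mult add.commute)
    have k: "q powi (- (A$1$2 * A$2$1)) = ?c" "?c * q powi (- (A$1$1 * A$2$2)) = 1"
      using q_A' q_nonzero by (simp_all add: power_int_minus field_simps)
    have "(y \<otimes>\<^bsub>H\<^esub> v) \<otimes>\<^bsub>H\<^esub> (x \<otimes>\<^bsub>H\<^esub> u) = y \<otimes>\<^bsub>H\<^esub> ((v \<otimes>\<^bsub>H\<^esub> x) \<otimes>\<^bsub>H\<^esub> u)"
      by (simp add: H.m_assoc)
    also have "\<dots> = ?c \<odot>\<^bsub>H\<^esub> (y \<otimes>\<^bsub>H\<^esub> (x \<otimes>\<^bsub>H\<^esub> (v \<otimes>\<^bsub>H\<^esub> u)))"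
      unfolding vx k by (simp add: H.smult_mult_l H.smult_mult_r H.m_assoc)
    finally have L: "(y \<otimes>\<^bsub>H\<^esub> v) \<otimes>\<^bsub>H\<^esub> (x \<otimes>\<^bsub>H\<^esub> u) = ?c \<odot>\<^bsub>H\<^esub> (y \<otimes>\<^bsub>H\<^esub> (x \<otimes>\<^bsub>H\<^esub> (u \<otimes>\<^bsub>H\<^esub> v)))"
      unfolding vu .
    have "(x \<otimes>\<^bsub>H\<^esub> u) \<otimes>\<^bsub>H\<^esub> (y \<otimes>\<^bsub>H\<^esub> v) = x \<otimes>\<^bsub>H\<^esub> ((u \<otimes>\<^bsub>H\<^esub> y) \<otimes>\<^bsub>H\<^esub> v)"
      by (simp add: H.m_assoc)
    also have "\<dots> = (q powi (- (A$1$1 * A$2$2))) \<odot>\<^bsub>H\<^esub> ((x \<otimes>\<^bsub>H\<^esub> y) \<otimes>\<^bsub>H\<^esub> (u \<otimes>\<^bsub>H\<^esub> v))"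
      unfolding uy by (simp add: H.smult_mult_l H.smult_mult_r H.m_assoc)
    also have "\<dots> = y \<otimes>\<^bsub>H\<^esub> (x \<otimes>\<^bsub>H\<^esub> (u \<otimes>\<^bsub>H\<^esub> v))"
      unfolding x_y using k(2) by (simp add: H.smult_mult_l H.smult_smult H.m_assoc mult.commute)
    finally show ?thesis
      by (simp add: L H.smult_mult_l H.smult_mult_r H.smult_smult)
  qed
  moreover have "((- 1) \<odot>\<^bsub>H\<^esub> (x \<otimes>\<^bsub>H\<^esub> u)) \<otimes>\<^bsub>H\<^esub> gp (- 1) =
      (q powi (A$1$2)) \<odot>\<^bsub>H\<^esub> (gp (- 1) \<otimes>\<^bsub>H\<^esub> ((- 1) \<odot>\<^bsub>H\<^esub> (x \<otimes>\<^bsub>H\<^esub> u)))"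
  proof -
    have "gp (- 1) \<otimes>\<^bsub>H\<^esub> (x \<otimes>\<^bsub>H\<^esub> u) = (q powi (- (A$1$2))) \<odot>\<^bsub>H\<^esub> (x \<otimes>\<^bsub>H\<^esub> (gp (- 1) \<otimes>\<^bsub>H\<^esub> u))"
      using gp_x[of "- 1"] by (simp add: H.m_assoc[symmetric] H.smult_mult_l)
    moreover have "u \<otimes>\<^bsub>H\<^esub> gp (- 1) = gp (- 1) \<otimes>\<^bsub>H\<^esub> u"
      by (simp add: uv gp_mult add.commute)
    ultimately show ?thesis
      using q_nonzero by (simp add: H.smult_mult_l H.smult_mult_r H.smult_smult H.m_assoc power_int_minus)
  qed
  moreover have "((- 1) \<odot>\<^bsub>H\<^esub> (y \<otimes>\<^bsub>H\<^esub> v)) \<otimes>\<^bsub>H\<^esub> gp (- 1) =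
      (q powi (A$2$2)) \<odot>\<^bsub>H\<^esub> (gp (- 1) \<otimes>\<^bsub>H\<^esub> ((- 1) \<odot>\<^bsub>H\<^esub> (y \<otimes>\<^bsub>H\<^esub> v)))"
  proof -
    have "gp (- 1) \<otimes>\<^bsub>H\<^esub> (y \<otimes>\<^bsub>H\<^esub> v) = (q powi (- (A$2$2))) \<odot>\<^bsub>H\<^esub> (y \<otimes>\<^bsub>H\<^esub> (gp (- 1) \<otimes>\<^bsub>H\<^esub> v))"
      using gp_y[of "- 1"] by (simp add: H.m_assoc[symmetric] H.smult_mult_l)
    moreover have "v \<otimes>\<^bsub>H\<^esub> gp (- 1) = gp (- 1) \<otimes>\<^bsub>H\<^esub> v"
      by (simp add: uv gp_mult add.commute)
    ultimately show ?thesis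
      using q_nonzero by (simp add: H.smult_mult_l H.smult_mult_r H.smult_smult H.m_assoc power_int_minus)
  qed
  ultimately show ?thesis
    unfolding taft_relations_def by (simp only: gens opp_alg_simps simp_thms)
qed

definition S :: "'k taft \<Rightarrow> 'k taft" where
  "S = quot_map (free_hom (opp_alg H) (taft_antipode_gen N q A))"

lemma S_hom: "k_alg_hom H (opp_alg H) S"
  unfolding S_def
  by (rule taft_universal(1)[OF k_algebra_opp_alg[OF H.k_algebra_axioms] antipode_relations])

lemma S_simps:
  "a \<in> carrier H \<Longrightarrow> S a \<in> carrier H"
  "\<lbrakk>a \<in> carrier H; b \<in> carrier H\<rbrakk> \<Longrightarrow> S (a \<oplus>\<^bsub>H\<^esub> b) = S a \<oplus>\<^bsub>H\<^esub> S b"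
  "a \<in> carrier H \<Longrightarrow> S (c \<odot>\<^bsub>H\<^esub> a) = c \<odot>\<^bsub>H\<^esub> S a"
  "\<lbrakk>a \<in> carrier H; b \<in> carrier H\<rbrakk> \<Longrightarrow> S (a \<otimes>\<^bsub>H\<^esub> b) = S b \<otimes>\<^bsub>H\<^esub> S a"
  "S \<one>\<^bsub>H\<^esub> = \<one>\<^bsub>H\<^esub>"
  using k_alg_homD[OF S_hom] by simp_all

lemma S_gens:
  "S g = gp (- 1)" "S x = (- 1) \<odot>\<^bsub>H\<^esub> (x \<otimes>\<^bsub>H\<^esub> gp (- (A$1$1)))" "S y = (- 1) \<odot>\<^bsub>H\<^esub> (y \<otimes>\<^bsub>H\<^esub> gp (- (A$2$1)))"
  unfolding S_def taft_universal(2)[OF k_algebra_opp_alg[OF H.k_algebra_axioms] antipode_relations]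
  by (simp_all add: Let_def inv_g H.a_inv_eq_smult)

lemma S_gp: "S (gp z) = gp (- z)"
proof -
  let ?n = "nat (z mod int N)"
  have "S (g [^]\<^bsub>H\<^esub> ?n) = S g [^]\<^bsub>H\<^esub> ?n"
    using k_alg_hom_pow[OF H.k_algebra_axioms k_algebra_opp_alg[OF H.k_algebra_axioms] S_hom gen_closed]
    by (simp add: opp_alg_pow[OF H.k_algebra_axioms] S_simps)
  also have "S g [^]\<^bsub>H\<^esub> ?n = gp (- 1) [^]\<^bsub>H\<^esub> z"
    unfolding S_gens using H.int_pow_mod[OF gp_closed gp_N N_pos] by simp
  finally show ?thesis
    using H.int_pow_mod[OF gen_closed g_N N_pos, of z] by (simp add: gp_gp)
qed

text \<open>On a skew primitive element the square of the antipode is conjugation by the group-like element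
  of its coproduct, for instance \<open>S (S x) = g\<^sup>a x g\<^sup>-\<^sup>a\<close> with \<open>a = a11\<close>.\<close>

lemma S_S_gens:
  "S (S g) = g" "S (S x) = (q powi (A$1$1 * A$1$2)) \<odot>\<^bsub>H\<^esub> x" "S (S y) = (q powi (A$2$1 * A$2$2)) \<odot>\<^bsub>H\<^esub> y"
proof -
  show "S (S g) = g"
    by (simp add: S_gens S_gp gp_1)
  have "S (S x) = gp (A$1$1) \<otimes>\<^bsub>H\<^esub> (x \<otimes>\<^bsub>H\<^esub> gp (- (A$1$1)))"
    by (simp add: S_gens S_simps S_gp H.smult_mult_r H.smult_smult)
  also have "\<dots> = (gp (A$1$1) \<otimes>\<^bsub>H\<^esub> x) \<otimes>\<^bsub>H\<^esub> gp (- (A$1$1))"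
    by (simp add: H.m_assoc)
  also have "\<dots> = (q powi (A$1$1 * A$1$2)) \<odot>\<^bsub>H\<^esub> x"
    unfolding g_powers_x by (simp add: H.smult_mult_l H.m_assoc gp_mult)
  finally show "S (S x) = (q powi (A$1$1 * A$1$2)) \<odot>\<^bsub>H\<^esub> x" .
  have "S (S y) = gp (A$2$1) \<otimes>\<^bsub>H\<^esub> (y \<otimes>\<^bsub>H\<^esub> gp (- (A$2$1)))"
    by (simp add: S_gens S_simps S_gp H.smult_mult_r H.smult_smult)
  also have "\<dots> = (gp (A$2$1) \<otimes>\<^bsub>H\<^esub> y) \<otimes>\<^bsub>H\<^esub> gp (- (A$2$1))"
    by (simp add: H.m_assoc)
  also have "\<dots> = (q powi (A$2$1 * A$2$2)) \<odot>\<^bsub>H\<^esub> y"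
    unfolding g_powers_y by (simp add: H.smult_mult_l H.m_assoc gp_mult)
  finally show "S (S y) = (q powi (A$2$1 * A$2$2)) \<odot>\<^bsub>H\<^esub> y" .
qed

lemma S_S_hom: "k_alg_hom H H (\<lambda>h. S (S h))"
  by (intro k_alg_homI k_linearI) (simp_all add: S_simps)

section \<open>Characters\<close>

definition chi_gen :: "'k \<Rightarrow> gen \<Rightarrow> 'k" where
  "chi_gen u s = (case s of Gen_g \<Rightarrow> u | _ \<Rightarrow> 0)"

text \<open>For an \<open>N\<close>-th root of unity \<open>u\<close>, the character with value \<open>u\<close> at \<open>g\<close>.\<close>

definition chi :: "'k \<Rightarrow> 'k taft \<Rightarrow> 'k" where
  "chi u = quot_map (free_hom base_alg (chi_gen u))"

lemma chi_relations:
  assumes "u ^ N = 1"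
  shows "taft_relations N q A base_alg (chi_gen u)"
  using assms Nx_properties(1)[OF A_nonzero(1)] Ny_properties(1)[OF A_nonzero(2)]
  by (auto simp: taft_relations_def chi_gen_def power_0_left)

lemma chi_hom: "u ^ N = 1 \<Longrightarrow> k_alg_hom H base_alg (chi u)"
  unfolding chi_def by (rule taft_universal(1)[OF k_algebra_base_alg chi_relations])

lemma chi_gens: "u ^ N = 1 \<Longrightarrow> chi u g = u" "u ^ N = 1 \<Longrightarrow> chi u x = 0" "u ^ N = 1 \<Longrightarrow> chi u y = 0"
  unfolding chi_def
  by (simp_all add: taft_universal(2)[OF k_algebra_base_alg chi_relations] chi_gen_def)

lemma counit_eq: "quot_map (free_hom base_alg taft_counit_gen) = chi 1"
proof -
  have "taft_counit_gen = chi_gen 1"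
  proof
    show "taft_counit_gen s = chi_gen 1 s" for s by (cases s) (simp_all add: chi_gen_def)
  qed
  then show ?thesis by (simp add: chi_def)
qed

lemma q_powi_a12: "q powi (A$1$2) \<noteq> 1" "q powi (A$2$2) \<noteq> 1"
proof -
  show "q powi (A$1$2) \<noteq> 1"
    using A_nonzero(1) cong_mult[OF cong_refl, of "A$1$2" 0 "int N" "A$1$1"]
    by (auto simp: primitive_root_powi_eq_1_iff[OF q])
  show "q powi (A$2$2) \<noteq> 1"
    using A_nonzero(2) cong_mult[OF cong_refl, of "A$2$2" 0 "int N" "A$2$1"]
    by (auto simp: primitive_root_powi_eq_1_iff[OF q])
qed

text \<open>Applying a character to \<open>g x = c x g\<close> with \<open>c \<noteq> 1\<close> leaves no value but 0 at \<open>x\<close>, because the value at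
  \<open>g\<close> is invertible.\<close>

lemma character_gens:
  assumes \<beta>: "k_alg_hom H base_alg \<beta>"
  shows "\<beta> g ^ N = 1" "\<beta> x = 0" "\<beta> y = 0"
proof -
  note D = k_alg_homD[OF \<beta>]
  show gN: "\<beta> g ^ N = 1"
    using k_alg_hom_pow[OF H.k_algebra_axioms k_algebra_base_alg \<beta> gen_closed, of Gen_g N] D(2) by (simp add: g_N)
  then have g0: "\<beta> g \<noteq> 0"
    using N_pos by (auto simp: power_0_left)
  have "\<beta> g * \<beta> x = q powi (A$1$2) * (\<beta> x * \<beta> g)" "\<beta> g * \<beta> y = q powi (A$2$2) * (\<beta> y * \<beta> g)"
    using arg_cong[OF g_x, of \<beta>] arg_cong[OF g_y, of \<beta>] D by simp_all
  then have "(q powi (A$1$2) - 1) * (\<beta> x * \<beta> g) = 0" "(q powi (A$2$2) - 1) * (\<beta> y * \<beta> g) = 0"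
    by (simp_all add: algebra_simps)
  then show "\<beta> x = 0" "\<beta> y = 0"
    using q_powi_a12 g0 by auto
qed

lemma character_eq_chi:
  assumes \<beta>: "k_alg_hom H base_alg \<beta>" and h: "h \<in> carrier H"
  shows "\<beta> h = chi (\<beta> g) h"
  using character_gens[OF \<beta>]
  by (intro taft_hom_eqI[OF k_algebra_base_alg \<beta> chi_hom _ _ _ h]) (simp_all add: chi_gens)

lemma character_gp:
  assumes "k_alg_hom H base_alg \<beta>"
  shows "\<beta> (gp z) = \<beta> g powi z"
proof -
  have "\<beta> (gp z) = \<beta> g ^ nat (z mod int N)"
    using H.int_pow_mod[OF gen_closed g_N N_pos, of z]
      k_alg_hom_pow[OF H.k_algebra_axioms k_algebra_base_alg assms gen_closed] by simp
  then show ?thesis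
    using root_powi[OF character_gens(1)[OF assms] N_pos] by simp
qed

section \<open>Monomials span\<close>

lemma y_x: "y \<otimes>\<^bsub>H\<^esub> x = (q powi (A$1$2 * A$2$1)) \<odot>\<^bsub>H\<^esub> (x \<otimes>\<^bsub>H\<^esub> y)"
  unfolding x_y using q_A by (simp add: H.smult_smult mult.commute)

text \<open>Any two generators commute up to a scalar, so the letters of a word can be sorted. The exponents
  are not bounded here.\<close>

lemma word_monomial:
  "\<exists>c i j l. J +>\<^bsub>F\<^esub> Poly_Mapping.single w 1 =
    c \<odot>\<^bsub>H\<^esub> (x [^]\<^bsub>H\<^esub> (i::nat) \<otimes>\<^bsub>H\<^esub> y [^]\<^bsub>H\<^esub> (j::nat) \<otimes>\<^bsub>H\<^esub> g [^]\<^bsub>H\<^esub> (l::nat))"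
proof (induction w)
  case Nil
  show ?case
    unfolding word_Nil by (intro exI[of _ 1] exI[of _ 0]) simp
next
  case (Cons s w)
  then obtain c i j l where IH: "J +>\<^bsub>F\<^esub> Poly_Mapping.single w 1 =
    c \<odot>\<^bsub>H\<^esub> (x [^]\<^bsub>H\<^esub> (i::nat) \<otimes>\<^bsub>H\<^esub> y [^]\<^bsub>H\<^esub> (j::nat) \<otimes>\<^bsub>H\<^esub> g [^]\<^bsub>H\<^esub> (l::nat))"
    by blast
  let ?X = "x [^]\<^bsub>H\<^esub> i" and ?Y = "y [^]\<^bsub>H\<^esub> j" and ?G = "g [^]\<^bsub>H\<^esub> l"
  have step: "J +>\<^bsub>F\<^esub> Poly_Mapping.single (s # w) 1 = c \<odot>\<^bsub>H\<^esub> (taft_gen N q A s \<otimes>\<^bsub>H\<^esub> ?X \<otimes>\<^bsub>H\<^esub> ?Y \<otimes>\<^bsub>H\<^esub> ?G)"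
    unfolding word_Cons IH by (simp add: H.smult_mult_r H.m_assoc)
  show ?case
  proof (cases s)
    case Gen_g
    have "g \<otimes>\<^bsub>H\<^esub> ?X \<otimes>\<^bsub>H\<^esub> ?Y \<otimes>\<^bsub>H\<^esub> ?G = (q powi (A$1$2)) ^ i \<odot>\<^bsub>H\<^esub> (?X \<otimes>\<^bsub>H\<^esub> (g \<otimes>\<^bsub>H\<^esub> ?Y) \<otimes>\<^bsub>H\<^esub> ?G)"
      by (simp add: H.scalar_commute_pow_right[OF gen_closed gen_closed g_x] H.smult_mult_l H.m_assoc)
    also have "\<dots> = ((q powi (A$1$2)) ^ i * (q powi (A$2$2)) ^ j) \<odot>\<^bsub>H\<^esub> (?X \<otimes>\<^bsub>H\<^esub> ?Y \<otimes>\<^bsub>H\<^esub> g [^]\<^bsub>H\<^esub> Suc l)"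
      unfolding H.nat_pow_Suc2[OF gen_closed]
      by (simp add: H.scalar_commute_pow_right[OF gen_closed gen_closed g_y] H.smult_mult_l H.smult_mult_r
          H.smult_smult H.m_assoc)
    finally have "J +>\<^bsub>F\<^esub> Poly_Mapping.single (s # w) 1 = (c * ((q powi (A$1$2)) ^ i * (q powi (A$2$2)) ^ j)) \<odot>\<^bsub>H\<^esub>
        (?X \<otimes>\<^bsub>H\<^esub> ?Y \<otimes>\<^bsub>H\<^esub> g [^]\<^bsub>H\<^esub> Suc l)"
      unfolding Gen_g step[unfolded Gen_g] by (simp add: H.smult_smult del: nat_pow_Suc)
    then show ?thesis by blast
  next
    case Gen_x
    have "J +>\<^bsub>F\<^esub> Poly_Mapping.single (s # w) 1 = c \<odot>\<^bsub>H\<^esub> (x [^]\<^bsub>H\<^esub> Suc i \<otimes>\<^bsub>H\<^esub> ?Y \<otimes>\<^bsub>H\<^esub> ?G)"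
      unfolding Gen_x step[unfolded Gen_x] H.nat_pow_Suc2[OF gen_closed] ..
    then show ?thesis by blast
  next
    case Gen_y
    have "y \<otimes>\<^bsub>H\<^esub> ?X \<otimes>\<^bsub>H\<^esub> ?Y \<otimes>\<^bsub>H\<^esub> ?G = (q powi (A$1$2 * A$2$1)) ^ i \<odot>\<^bsub>H\<^esub> (?X \<otimes>\<^bsub>H\<^esub> y [^]\<^bsub>H\<^esub> Suc j \<otimes>\<^bsub>H\<^esub> ?G)"
      unfolding H.nat_pow_Suc2[OF gen_closed]
      by (simp add: H.scalar_commute_pow_right[OF gen_closed gen_closed y_x] H.smult_mult_l H.m_assoc)
    then have "J +>\<^bsub>F\<^esub> Poly_Mapping.single (s # w) 1 = (c * (q powi (A$1$2 * A$2$1)) ^ i) \<odot>\<^bsub>H\<^esub>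
        (?X \<otimes>\<^bsub>H\<^esub> y [^]\<^bsub>H\<^esub> Suc j \<otimes>\<^bsub>H\<^esub> ?G)"
      unfolding Gen_y step[unfolded Gen_y] by (simp add: H.smult_smult del: nat_pow_Suc)
    then show ?thesis by blast
  qed
qed

lemma nilpotent_pow: "\<lbrakk>z \<in> carrier H; z [^]\<^bsub>H\<^esub> n = \<zero>\<^bsub>H\<^esub>; n \<le> i\<rbrakk> \<Longrightarrow> z [^]\<^bsub>H\<^esub> (i::nat) = \<zero>\<^bsub>H\<^esub>"
  using H.nat_pow_mult[of z n "i - n"] by simp

text \<open>Monomials with a larger exponent of \<open>x\<close> or \<open>y\<close> vanish, and exponents of \<open>g\<close> are taken modulo
  \<open>N\<close>; so the bounded monomials span.\<close>

lemma taft_functional_eqI: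
  assumes f: "k_linear H base_alg f" and h: "k_linear H base_alg h"
    and eq: "\<And>i j l. \<lbrakk>i < taft_Nx N A; j < taft_Ny N A; l < N\<rbrakk> \<Longrightarrow>
      f (x [^]\<^bsub>H\<^esub> i \<otimes>\<^bsub>H\<^esub> y [^]\<^bsub>H\<^esub> j \<otimes>\<^bsub>H\<^esub> g [^]\<^bsub>H\<^esub> l) = h (x [^]\<^bsub>H\<^esub> i \<otimes>\<^bsub>H\<^esub> y [^]\<^bsub>H\<^esub> j \<otimes>\<^bsub>H\<^esub> g [^]\<^bsub>H\<^esub> l)"
    and a: "a \<in> carrier H"
  shows "f a = h a"
proof (rule taft_linear_eqI[OF k_algebra_base_alg f h _ a])
  have mono: "f (x [^]\<^bsub>H\<^esub> i \<otimes>\<^bsub>H\<^esub> y [^]\<^bsub>H\<^esub> j \<otimes>\<^bsub>H\<^esub> g [^]\<^bsub>H\<^esub> l) = h (x [^]\<^bsub>H\<^esub> i \<otimes>\<^bsub>H\<^esub> y [^]\<^bsub>H\<^esub> j \<otimes>\<^bsub>H\<^esub> g [^]\<^bsub>H\<^esub> l)"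
    for i j l :: nat
  proof (cases "i < taft_Nx N A \<and> j < taft_Ny N A")
    case True
    then show ?thesis
      using eq[of i j "l mod N"] N_pos H.pow_mod[OF gen_closed g_N N_pos, of l] by simp
  next
    case False
    then have "x [^]\<^bsub>H\<^esub> i = \<zero>\<^bsub>H\<^esub> \<or> y [^]\<^bsub>H\<^esub> j = \<zero>\<^bsub>H\<^esub>"
      using nilpotent_pow[OF gen_closed x_nilpotent, of i] nilpotent_pow[OF gen_closed y_nilpotent, of j] by auto
    then have "x [^]\<^bsub>H\<^esub> i \<otimes>\<^bsub>H\<^esub> y [^]\<^bsub>H\<^esub> j \<otimes>\<^bsub>H\<^esub> g [^]\<^bsub>H\<^esub> l = \<zero>\<^bsub>H\<^esub>"
      by (elim disjE) simp_all
    then show ?thesis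
      using k_linear_zero[OF H.k_algebra_axioms k_algebra_base_alg f]
        k_linear_zero[OF H.k_algebra_axioms k_algebra_base_alg h] by simp
  qed
  show "f (J +>\<^bsub>F\<^esub> Poly_Mapping.single w 1) = h (J +>\<^bsub>F\<^esub> Poly_Mapping.single w 1)" for w
  proof -
    obtain c i j l where w: "J +>\<^bsub>F\<^esub> Poly_Mapping.single w 1 =
      c \<odot>\<^bsub>H\<^esub> (x [^]\<^bsub>H\<^esub> (i::nat) \<otimes>\<^bsub>H\<^esub> y [^]\<^bsub>H\<^esub> (j::nat) \<otimes>\<^bsub>H\<^esub> g [^]\<^bsub>H\<^esub> (l::nat))"
      using word_monomial by blast
    show ?thesis
      unfolding w using mono k_linearD(3)[OF f] k_linearD(3)[OF h] by simp
  qed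
qed

section \<open>Convolution of characters\<close>

lemma k_bilinearI:
  assumes "\<And>a b. \<lbrakk>a \<in> carrier B; b \<in> carrier C\<rbrakk> \<Longrightarrow> \<phi> a b \<in> carrier U"
    "\<And>a b b'. \<lbrakk>a \<in> carrier B; b \<in> carrier C; b' \<in> carrier C\<rbrakk> \<Longrightarrow> \<phi> a (b \<oplus>\<^bsub>C\<^esub> b') = \<phi> a b \<oplus>\<^bsub>U\<^esub> \<phi> a b'"
    "\<And>a a' b. \<lbrakk>a \<in> carrier B; a' \<in> carrier B; b \<in> carrier C\<rbrakk> \<Longrightarrow> \<phi> (a \<oplus>\<^bsub>B\<^esub> a') b = \<phi> a b \<oplus>\<^bsub>U\<^esub> \<phi> a' b"
    "\<And>a b c. \<lbrakk>a \<in> carrier B; b \<in> carrier C\<rbrakk> \<Longrightarrow> \<phi> a (c \<odot>\<^bsub>C\<^esub> b) = c \<odot>\<^bsub>U\<^esub> \<phi> a b"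
    "\<And>a b c. \<lbrakk>a \<in> carrier B; b \<in> carrier C\<rbrakk> \<Longrightarrow> \<phi> (c \<odot>\<^bsub>B\<^esub> a) b = c \<odot>\<^bsub>U\<^esub> \<phi> a b"
  shows "k_bilinear B C U \<phi>"
  using assms by (auto simp: k_bilinear_def k_linear_def)

text \<open>The convolution is again a character, so it suffices to evaluate it at \<open>g\<close>.\<close>

lemma convolution:
  assumes \<beta>: "k_alg_hom H base_alg \<beta>" and \<gamma>: "k_alg_hom H base_alg \<gamma>" and h: "h \<in> carrier H"
  shows "tensor_lift base_alg (\<lambda>a b. \<beta> a * \<gamma> b) (\<Delta> h) = chi (\<beta> g * \<gamma> g) h"
proof -
  note b = k_alg_homD[OF \<beta>] and c = k_alg_homD[OF \<gamma>]
  let ?f = "tensor_lift base_alg (\<lambda>a b. \<beta> a * \<gamma> b)"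
  have bil: "k_bilinear H H base_alg (\<lambda>a b. \<beta> a * \<gamma> b)"
    by (rule k_bilinearI) (use b c in \<open>simp_all add: algebra_simps\<close>)
  have hom: "k_alg_hom T2 base_alg ?f"
    by (rule P.tensor_lift_alg_hom[OF k_algebra_base_alg bil]) (use b c in simp_all)
  note f = k_alg_homD[OF hom] and ft = P.tensor_lift_tens[OF k_algebra_base_alg bil]
  have N: "(\<beta> g * \<gamma> g) ^ N = 1"
    using character_gens(1)[OF \<beta>] character_gens(1)[OF \<gamma>] by (simp add: power_mult_distrib)
  show ?thesis
    by (rule taft_hom_eqI[OF k_algebra_base_alg k_alg_hom_comp[OF \<Delta>_hom hom] chi_hom[OF N] _ _ _ h])
      (simp_all add: \<Delta>_gens f ft t_simps chi_gens[OF N] character_gens[OF \<beta>] character_gens[OF \<gamma>])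
qed

section \<open>The antipode axiom\<close>

lemma taft_induct [consumes 1, case_names one step add smult]:
  assumes a: "a \<in> carrier H"
    and one: "P \<one>\<^bsub>H\<^esub>"
    and step: "\<And>s b. \<lbrakk>b \<in> carrier H; P b\<rbrakk> \<Longrightarrow> P (taft_gen N q A s \<otimes>\<^bsub>H\<^esub> b)"
    and add: "\<And>b c. \<lbrakk>b \<in> carrier H; c \<in> carrier H; P b; P c\<rbrakk> \<Longrightarrow> P (b \<oplus>\<^bsub>H\<^esub> c)"
    and smult: "\<And>c b. \<lbrakk>b \<in> carrier H; P b\<rbrakk> \<Longrightarrow> P (c \<odot>\<^bsub>H\<^esub> b)"
  shows "P a"
proof -
  note hom = k_alg_homD[OF coset_hom]
  have word: "P (J +>\<^bsub>F\<^esub> Poly_Mapping.single w 1)" for w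
    by (induction w) (simp_all only: word_Nil word_Cons one step word_closed)
  from a obtain v where v: "a = J +>\<^bsub>F\<^esub> v"
    by (auto simp: H_carrier)
  have single: "P (J +>\<^bsub>F\<^esub> Poly_Mapping.single w c)" for w and c :: 'k
  proof -
    have "Poly_Mapping.single w c = c \<odot>\<^bsub>F\<^esub> Poly_Mapping.single w 1"
      by (simp add: pm_scale_simps)
    then show ?thesis
      using smult[OF word_closed word, of c w] hom(6)[OF free_alg_carrier, of c "Poly_Mapping.single w 1"] by simp
  qed
  have "Poly_Mapping.keys v \<subseteq> UNIV" by simp
  then have "P (J +>\<^bsub>F\<^esub> v)"
  proof (induction rule: pm_induct_on)
    case zero
    show ?case using single[of "[]" 0] by simp
  next
    case (add f h)
    then show ?case
      using assms(4)[OF word_closed word_closed, of f h] hom(5)[OF free_alg_carrier free_alg_carrier, of f h] by simp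
  qed (rule single)
  then show ?thesis using v by simp
qed

text \<open>The map \<open>h \<mapsto> S(h\<^sub>1) h\<^sub>2\<close> is not multiplicative, so agreement on generators does not carry over at
  once. Write \<open>m(a \<otimes> b) = S(a) b\<close>. As \<open>S\<close> reverses products,
  \<open>m(u (c \<otimes> d)) = S(c) m(u) d\<close>. If \<open>m(\<Delta> h)\<close> is the scalar \<open>\<epsilon>(h)\<close>, it follows that
  \<open>m((\<Delta> h) v) = \<epsilon>(h) m(v)\<close> for all \<open>v\<close>, and the axiom passes from the factors to a product.\<close>

lemma antipode_left:
  assumes "h \<in> carrier H"
  shows "tensor_lift H (\<lambda>a b. S a \<otimes>\<^bsub>H\<^esub> b) (\<Delta> h) = chi 1 h \<odot>\<^bsub>H\<^esub> \<one>\<^bsub>H\<^esub>"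
proof -
  let ?m = "tensor_lift H (\<lambda>a b. S a \<otimes>\<^bsub>H\<^esub> b)"
  have bil: "k_bilinear H H H (\<lambda>a b. S a \<otimes>\<^bsub>H\<^esub> b)"
    by (rule k_bilinearI) (simp_all add: S_simps H.l_distr H.r_distr H.smult_mult_l H.smult_mult_r)
  note lin = P.tensor_lift_linear[OF H.k_algebra_axioms bil]
  note m = k_linearD[OF lin] and mt = P.tensor_lift_tens[OF H.k_algebra_axioms bil]
  note D = k_alg_homD[OF \<Delta>_hom]
  have e: "k_alg_hom H base_alg (chi 1)" by (rule chi_hom) simp
  note E = k_alg_homD[OF e]
  have pure: "?m (u \<otimes>\<^bsub>T2\<^esub> t c d) = S c \<otimes>\<^bsub>H\<^esub> ?m u \<otimes>\<^bsub>H\<^esub> d"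
    if cd: "c \<in> carrier H" "d \<in> carrier H" and u: "u \<in> carrier T2" for u c d
  proof (rule P.tensor_linear_eqI[OF H.k_algebra_axioms _ _ _ u])
    show "k_linear T2 H (\<lambda>u. ?m (u \<otimes>\<^bsub>T2\<^esub> t c d))"
      by (rule k_linearI) (simp_all add: m cd t_simps T2.l_distr T2.smult_mult_l)
    show "k_linear T2 H (\<lambda>u. S c \<otimes>\<^bsub>H\<^esub> ?m u \<otimes>\<^bsub>H\<^esub> d)"
      by (rule k_linearI) (simp_all add: m cd S_simps H.l_distr H.r_distr H.smult_mult_l H.smult_mult_r)
  qed (simp add: P.tens_mult mt cd S_simps H.m_assoc)
  have mult: "?m (\<Delta> h \<otimes>\<^bsub>T2\<^esub> v) = chi 1 h \<odot>\<^bsub>H\<^esub> ?m v"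
    if h: "h \<in> carrier H" "?m (\<Delta> h) = chi 1 h \<odot>\<^bsub>H\<^esub> \<one>\<^bsub>H\<^esub>" and v: "v \<in> carrier T2" for h v
  proof (rule P.tensor_linear_eqI[OF H.k_algebra_axioms _ _ _ v])
    show "k_linear T2 H (\<lambda>v. ?m (\<Delta> h \<otimes>\<^bsub>T2\<^esub> v))"
      by (rule k_linearI) (simp_all add: m h D T2.r_distr T2.smult_mult_r)
    show "k_linear T2 H (\<lambda>v. chi 1 h \<odot>\<^bsub>H\<^esub> ?m v)"
      by (rule k_linearI) (simp_all add: m H.smult_r_distr H.smult_smult mult.commute)
  qed (simp add: pure h D mt S_simps H.smult_mult_l H.smult_mult_r)
  have gen: "?m (\<Delta> (taft_gen N q A s)) = chi 1 (taft_gen N q A s) \<odot>\<^bsub>H\<^esub> \<one>\<^bsub>H\<^esub>" for s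
  proof (cases s)
    case Gen_g
    then show ?thesis
      using gp_mult[of "- 1" 1] by (simp add: \<Delta>_gens mt S_gens chi_gens gp_1)
  next
    case Gen_x
    then show ?thesis
      by (simp add: \<Delta>_gens m mt t_simps S_gens S_simps chi_gens H.smult_mult_l H.m_assoc gp_mult)
        (simp flip: H.a_inv_eq_smult add: H.r_neg)
  next
    case Gen_y
    then show ?thesis
      by (simp add: \<Delta>_gens m mt t_simps S_gens S_simps chi_gens H.smult_mult_l H.m_assoc gp_mult)
        (simp flip: H.a_inv_eq_smult add: H.r_neg)
  qed
  show ?thesis using assms
  proof (induction rule: taft_induct)
    case one
    show ?case by (simp add: D E P.tens_one mt S_simps)
  next
    case (step s b)
    then show ?case
      by (simp add: D E mult[OF gen_closed gen] H.smult_smult)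
  next
    case (add b c)
    then show ?case
      by (simp add: D E m H.smult_l_distr)
  next
    case (smult c b)
    then show ?case
      by (simp add: D E m H.smult_smult)
  qed
qed

text \<open>The mirror image of the previous proof, with \<open>m(a \<otimes> b) = a S(b)\<close> and
  \<open>m((c \<otimes> d) u) = c m(u) S(d)\<close>.\<close>

lemma antipode_right:
  assumes "h \<in> carrier H"
  shows "tensor_lift H (\<lambda>a b. a \<otimes>\<^bsub>H\<^esub> S b) (\<Delta> h) = chi 1 h \<odot>\<^bsub>H\<^esub> \<one>\<^bsub>H\<^esub>"
proof -
  let ?m = "tensor_lift H (\<lambda>a b. a \<otimes>\<^bsub>H\<^esub> S b)"
  have bil: "k_bilinear H H H (\<lambda>a b. a \<otimes>\<^bsub>H\<^esub> S b)"
    by (rule k_bilinearI) (simp_all add: S_simps H.l_distr H.r_distr H.smult_mult_l H.smult_mult_r)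
  note lin = P.tensor_lift_linear[OF H.k_algebra_axioms bil]
  note m = k_linearD[OF lin] and mt = P.tensor_lift_tens[OF H.k_algebra_axioms bil]
  note D = k_alg_homD[OF \<Delta>_hom]
  have e: "k_alg_hom H base_alg (chi 1)" by (rule chi_hom) simp
  note E = k_alg_homD[OF e]
  have pure: "?m (t c d \<otimes>\<^bsub>T2\<^esub> u) = c \<otimes>\<^bsub>H\<^esub> ?m u \<otimes>\<^bsub>H\<^esub> S d"
    if cd: "c \<in> carrier H" "d \<in> carrier H" and u: "u \<in> carrier T2" for u c d
  proof (rule P.tensor_linear_eqI[OF H.k_algebra_axioms _ _ _ u])
    show "k_linear T2 H (\<lambda>u. ?m (t c d \<otimes>\<^bsub>T2\<^esub> u))"
      by (rule k_linearI) (simp_all add: m cd t_simps T2.r_distr T2.smult_mult_r)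
    show "k_linear T2 H (\<lambda>u. c \<otimes>\<^bsub>H\<^esub> ?m u \<otimes>\<^bsub>H\<^esub> S d)"
      by (rule k_linearI) (simp_all add: m cd S_simps H.l_distr H.r_distr H.smult_mult_l H.smult_mult_r)
  qed (simp add: P.tens_mult mt cd S_simps H.m_assoc)
  have mult: "?m (u \<otimes>\<^bsub>T2\<^esub> \<Delta> h) = chi 1 h \<odot>\<^bsub>H\<^esub> ?m u"
    if h: "h \<in> carrier H" "?m (\<Delta> h) = chi 1 h \<odot>\<^bsub>H\<^esub> \<one>\<^bsub>H\<^esub>" and u: "u \<in> carrier T2" for h u
  proof (rule P.tensor_linear_eqI[OF H.k_algebra_axioms _ _ _ u])
    show "k_linear T2 H (\<lambda>u. ?m (u \<otimes>\<^bsub>T2\<^esub> \<Delta> h))"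
      by (rule k_linearI) (simp_all add: m h D T2.l_distr T2.smult_mult_l)
    show "k_linear T2 H (\<lambda>u. chi 1 h \<odot>\<^bsub>H\<^esub> ?m u)"
      by (rule k_linearI) (simp_all add: m H.smult_r_distr H.smult_smult mult.commute)
  qed (simp add: pure h D mt S_simps H.smult_mult_l H.smult_mult_r)
  have gen: "?m (\<Delta> (taft_gen N q A s)) = chi 1 (taft_gen N q A s) \<odot>\<^bsub>H\<^esub> \<one>\<^bsub>H\<^esub>" for s
  proof (cases s)
    case Gen_g
    then show ?thesis
      using gp_mult[of 1 "- 1"] by (simp add: \<Delta>_gens mt S_gens chi_gens gp_1)
  next
    case Gen_x
    then show ?thesis
      by (simp add: \<Delta>_gens m mt t_simps S_gens S_simps S_gp chi_gens)
        (simp flip: H.a_inv_eq_smult add: H.l_neg)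
  next
    case Gen_y
    then show ?thesis
      by (simp add: \<Delta>_gens m mt t_simps S_gens S_simps S_gp chi_gens)
        (simp flip: H.a_inv_eq_smult add: H.l_neg)
  qed
  show ?thesis using assms
  proof (induction rule: taft_induct)
    case one
    show ?case by (simp add: D E P.tens_one mt S_simps)
  next
    case (step s b)
    then show ?case
      by (simp add: D E mult gen H.smult_smult mult.commute)
  next
    case (add b c)
    then show ?case
      by (simp add: D E m H.smult_l_distr)
  next
    case (smult c b)
    then show ?case
      by (simp add: D E m H.smult_smult)
  qed
qed

section \<open>Group-like elements\<close>

definition group_like :: "'k taft \<Rightarrow> bool" where
  "group_like l \<longleftrightarrow> l \<in> carrier H \<and> \<Delta> l = t l l \<and> chi 1 l = 1"

text \<open>At a group-like element \<open>l\<close> the antipode axiom says that \<open>S l\<close> is inverse to \<open>l\<close>.\<close>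

lemma group_like_Units:
  assumes "group_like l"
  shows "l \<in> Units H"
proof -
  have l: "l \<in> carrier H" "\<Delta> l = t l l" "chi 1 l = 1"
    using assms by (auto simp: group_like_def)
  have bil: "k_bilinear H H H (\<lambda>a b. S a \<otimes>\<^bsub>H\<^esub> b)" "k_bilinear H H H (\<lambda>a b. a \<otimes>\<^bsub>H\<^esub> S b)"
    by (rule k_bilinearI;
        simp add: S_simps H.l_distr H.r_distr H.smult_mult_l H.smult_mult_r)+
  have "S l \<otimes>\<^bsub>H\<^esub> l = \<one>\<^bsub>H\<^esub>" "l \<otimes>\<^bsub>H\<^esub> S l = \<one>\<^bsub>H\<^esub>"
    using antipode_left[OF l(1)] antipode_right[OF l(1)]
      P.tensor_lift_tens[OF H.k_algebra_axioms bil(1) l(1) l(1)]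
      P.tensor_lift_tens[OF H.k_algebra_axioms bil(2) l(1) l(1)] l by simp_all
  then show ?thesis
    unfolding Units_def using l(1) S_simps(1)[OF l(1)] by blast
qed

lemma group_like_gp: "group_like (gp z)"
proof -
  let ?n = "nat (z mod int N)"
  have "\<Delta> (g [^]\<^bsub>H\<^esub> ?n) = t (g [^]\<^bsub>H\<^esub> ?n) (g [^]\<^bsub>H\<^esub> ?n)"
    using k_alg_hom_pow[OF H.k_algebra_axioms P.k_algebra_tensor_alg \<Delta>_hom gen_closed]
    by (simp add: \<Delta>_gens t_pow)
  then show ?thesis
    unfolding group_like_def
    using H.int_pow_mod[OF gen_closed g_N N_pos, of z] character_gp[OF chi_hom, of 1 z]
    by (simp add: chi_gens)
qed

lemma chi_group_like_mult:
  assumes l: "group_like l" and u: "u ^ N = 1" "v ^ N = 1"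
  shows "chi (u * v) l = chi u l * chi v l"
proof -
  note b = k_alg_homD[OF chi_hom[OF u(1)]] and c = k_alg_homD[OF chi_hom[OF u(2)]]
  have "k_bilinear H H base_alg (\<lambda>a b. chi u a * chi v b)"
    by (rule k_bilinearI) (use b c in \<open>simp_all add: algebra_simps\<close>)
  from P.tensor_lift_tens[OF k_algebra_base_alg this, of l l] show ?thesis
    using convolution[OF chi_hom[OF u(1)] chi_hom[OF u(2)], of l] l u
    by (simp add: group_like_def chi_gens)
qed

text \<open>At a group-like element, evaluation of characters is a homomorphism from the \<open>N\<close>-th roots
  of unity to themselves.\<close>

lemma chi_group_like:
  assumes l: "group_like l"
  obtains d :: int where "\<And>z. chi (q powi z) l = q powi (d * z)"
proof -
  have nat: "chi (q ^ n) l = chi q l ^ n" for n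
  proof (induction n)
    case 0
    then show ?case using l by (simp add: group_like_def)
  next
    case (Suc n)
    have "(q ^ n) ^ N = 1"
      using q_N by (metis power_mult mult.commute power_one)
    then show ?case
      using chi_group_like_mult[OF l q_N, of "q ^ n"] Suc by simp
  qed
  have N: "chi q l ^ N = 1"
    using nat[of N] q_N l by (simp add: group_like_def)
  then obtain d where d: "chi q l = q powi d"
    by (rule root_of_unity_eq_powi[OF q])
  have "chi (q powi z) l = q powi (d * z)" for z
    using root_powi[OF q_N N_pos, of z] root_powi[OF N N_pos, of z] nat
    by (simp add: d power_int_mult)
  then show ?thesis by (rule that)
qed

end

section \<open>A representation by triangular matrices\<close>

text \<open>The triple \<open>(a, b, d)\<close> stands for the upper triangular matrix with rows
  \<open>(a, b)\<close> and \<open>(0, d)\<close>.\<close>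

definition tri_alg :: "('k::field, 'k \<times> 'k \<times> 'k) module" where
  "tri_alg = \<lparr>carrier = UNIV, monoid.mult = (\<lambda>(a, b, d) (a', b', d'). (a * a', a * b' + b * d', d * d')),
     one = (1, 0, 1), zero = (0, 0, 0),
     add = (\<lambda>(a, b, d) (a', b', d'). (a + a', b + b', d + d')),
     module.smult = (\<lambda>c (a, b, d). (c * a, c * b, c * d))\<rparr>"

lemma tri_alg_simps [simp]:
  "carrier tri_alg = UNIV" "(a, b, d) \<otimes>\<^bsub>tri_alg\<^esub> (a', b', d') = (a * a', a * b' + b * d', d * d')"
  "\<one>\<^bsub>tri_alg\<^esub> = (1, 0, 1)" "\<zero>\<^bsub>tri_alg\<^esub> = (0, 0, 0)"
  "(a, b, d) \<oplus>\<^bsub>tri_alg\<^esub> (a', b', d') = (a + a', b + b', d + d')"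
  "c \<odot>\<^bsub>tri_alg\<^esub> (a, b, d) = (c * a, c * b, c * d)"
  by (simp_all add: tri_alg_def)

lemma k_algebra_tri_alg: "k_algebra (tri_alg :: ('k::field, 'k \<times> 'k \<times> 'k) module)"
  by (rule k_algebraI) (auto simp: algebra_simps)

context taft
begin

text \<open>The generator \<open>z\<close>, which is \<open>x\<close> or \<open>y\<close>, goes to the off-diagonal matrix unit, and the other one
  of the two goes to zero.\<close>

definition tri_gen :: "gen \<Rightarrow> 'k \<Rightarrow> gen \<Rightarrow> 'k \<times> 'k \<times> 'k" where
  "tri_gen z s s' = (if s' = Gen_g then (s, 0, 1) else if s' = z then (0, 1, 0) else (0, 0, 0))"

lemma tri_relations:
  "taft_relations N q A tri_alg (tri_gen Gen_x (q powi (A$1$2)))"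
  "taft_relations N q A tri_alg (tri_gen Gen_y (q powi (A$2$2)))"
proof -
  have diag: "(s, 0, 1) [^]\<^bsub>tri_alg\<^esub> n = (s ^ n, 0, 1)" for s :: 'k and n :: nat
    by (induction n) (simp_all add: mult.commute)
  have nil: "(0, c, 0) [^]\<^bsub>tri_alg\<^esub> n = (0, 0, 0)" if n2: "n \<ge> 2" for c :: 'k and n :: nat
  proof -
    obtain m where n: "n = Suc (Suc m)"
      using le_Suc_ex[OF n2] by auto
    obtain a b d where m: "(0, c, 0) [^]\<^bsub>tri_alg\<^esub> m = (a, b, d)"
      using prod_cases3 by blast
    show ?thesis by (simp add: n m)
  qed
  note nil' = nil[OF Nx_properties(1)[OF A_nonzero(1)]] nil[OF Ny_properties(1)[OF A_nonzero(2)]]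
  define s s' where s: "s = q powi (A$1$2)" "s' = q powi (A$2$2)"
  have N: "s ^ N = 1" "s' ^ N = 1"
    unfolding s by (rule q_powi_N)+
  show "taft_relations N q A tri_alg (tri_gen Gen_x (q powi (A$1$2)))"
    "taft_relations N q A tri_alg (tri_gen Gen_y (q powi (A$2$2)))"
    unfolding taft_relations_def tri_gen_def s[symmetric]
    by (simp_all add: diag nil' N)
qed

text \<open>The diagonal entries of the representation are the characters \<open>chi s\<close> and \<open>chi 1\<close>. Comparing the
  corner entries in the image of \<open>l z = c z l\<close> gives the claim.\<close>

lemma tri_commute:
  assumes rel: "taft_relations N q A tri_alg (tri_gen z s)" and z: "z \<noteq> Gen_g" and s: "s ^ N = 1"
    and l: "l \<in> carrier H"
    and eq: "l \<otimes>\<^bsub>H\<^esub> taft_gen N q A z = c \<odot>\<^bsub>H\<^esub> (taft_gen N q A z \<otimes>\<^bsub>H\<^esub> l)"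
  shows "chi s l = c * chi 1 l"
proof -
  let ?r = "quot_map (free_hom tri_alg (tri_gen z s))"
  note r = taft_universal(1)[OF k_algebra_tri_alg rel] and r_gen = taft_universal(2)[OF k_algebra_tri_alg rel]
  note D = k_alg_homD[OF r]
  have "k_alg_hom tri_alg base_alg fst" "k_alg_hom tri_alg base_alg (\<lambda>m. snd (snd m))"
    by (auto intro!: k_alg_homI k_linearI)
  note comp = this[THEN k_alg_hom_comp[OF r]]
  have "fst (?r l) = chi s l"
    by (rule taft_hom_eqI[OF k_algebra_base_alg comp(1) chi_hom[OF s] _ _ _ l])
      (simp_all add: r_gen chi_gens[OF s] tri_gen_def)
  moreover have "snd (snd (?r l)) = chi 1 l"
    by (rule taft_hom_eqI[OF k_algebra_base_alg comp(2) chi_hom _ _ _ l])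
      (simp_all add: r_gen chi_gens tri_gen_def)
  ultimately obtain b where b: "?r l = (chi s l, b, chi 1 l)"
    by (metis prod.collapse)
  have "?r l \<otimes>\<^bsub>tri_alg\<^esub> (0, 1, 0) = c \<odot>\<^bsub>tri_alg\<^esub> ((0, 1, 0) \<otimes>\<^bsub>tri_alg\<^esub> ?r l)"
    using arg_cong[OF eq, of ?r] l z by (simp add: D r_gen tri_gen_def)
  then show ?thesis by (simp add: b)
qed

section \<open>Conjugation by a pair\<close>

abbreviation "T3 \<equiv> tensor_alg T2 H"
abbreviation "t3 \<equiv> tens T2 H"

sublocale P3: k_algebra_pair T2 H ..
sublocale T3: k_algebra T3 by (rule P3.k_algebra_tensor_alg)

lemmas t3_simps = P3.bilinD[OF P3.k_algebra_tensor_alg P3.tens_bilinear]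

definition \<Delta>3 :: "'k taft \<Rightarrow> (('k taft \<times> 'k taft \<Rightarrow>\<^sub>0 'k) set \<times> 'k taft \<Rightarrow>\<^sub>0 'k) set" where
  "\<Delta>3 h = tensor_lift T3 (\<lambda>a b. t3 (\<Delta> a) b) (\<Delta> h)"

text \<open>The right-hand side of the condition on a pair in involution.\<close>

definition pair_map :: "'k taft \<Rightarrow> ('k taft \<Rightarrow> 'k) \<Rightarrow> 'k taft \<Rightarrow> 'k taft" where
  "pair_map l \<beta> h = tensor_lift H (\<lambda>t h3. tensor_lift H
     (\<lambda>h1 h2. (\<beta> h3 * \<beta> (S h1)) \<odot>\<^bsub>H\<^esub> (l \<otimes>\<^bsub>H\<^esub> h2 \<otimes>\<^bsub>H\<^esub> inv\<^bsub>H\<^esub> l)) t) (\<Delta>3 h)"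

context
  fixes l :: "'k taft" and \<beta> :: "'k taft \<Rightarrow> 'k"
  assumes l: "l \<in> Units H" and \<beta>: "k_alg_hom H base_alg \<beta>"
begin

abbreviation (input) "adj h \<equiv> l \<otimes>\<^bsub>H\<^esub> h \<otimes>\<^bsub>H\<^esub> inv\<^bsub>H\<^esub> l"

lemma adj_simps:
  "a \<in> carrier H \<Longrightarrow> adj a \<in> carrier H"
  "\<lbrakk>a \<in> carrier H; b \<in> carrier H\<rbrakk> \<Longrightarrow> adj (a \<oplus>\<^bsub>H\<^esub> b) = adj a \<oplus>\<^bsub>H\<^esub> adj b"
  "a \<in> carrier H \<Longrightarrow> adj (c \<odot>\<^bsub>H\<^esub> a) = c \<odot>\<^bsub>H\<^esub> adj a"
  "\<lbrakk>a \<in> carrier H; b \<in> carrier H\<rbrakk> \<Longrightarrow> adj (a \<otimes>\<^bsub>H\<^esub> b) = adj a \<otimes>\<^bsub>H\<^esub> adj b"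
  "adj \<one>\<^bsub>H\<^esub> = \<one>\<^bsub>H\<^esub>"
proof -
  note c = H.Units_closed[OF l] H.Units_inv_closed[OF l]
  show "a \<in> carrier H \<Longrightarrow> adj a \<in> carrier H"
    "\<lbrakk>a \<in> carrier H; b \<in> carrier H\<rbrakk> \<Longrightarrow> adj (a \<oplus>\<^bsub>H\<^esub> b) = adj a \<oplus>\<^bsub>H\<^esub> adj b"
    "a \<in> carrier H \<Longrightarrow> adj (c \<odot>\<^bsub>H\<^esub> a) = c \<odot>\<^bsub>H\<^esub> adj a"
    using c by (simp_all add: H.l_distr H.r_distr H.smult_mult_l H.smult_mult_r)
  show "adj \<one>\<^bsub>H\<^esub> = \<one>\<^bsub>H\<^esub>"
    using c l by simp
  show "adj (a \<otimes>\<^bsub>H\<^esub> b) = adj a \<otimes>\<^bsub>H\<^esub> adj b" if "a \<in> carrier H" "b \<in> carrier H"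
  proof -
    have "adj a \<otimes>\<^bsub>H\<^esub> adj b = l \<otimes>\<^bsub>H\<^esub> a \<otimes>\<^bsub>H\<^esub> (inv\<^bsub>H\<^esub> l \<otimes>\<^bsub>H\<^esub> l) \<otimes>\<^bsub>H\<^esub> b \<otimes>\<^bsub>H\<^esub> inv\<^bsub>H\<^esub> l"
      using that c by (simp only: H.m_assoc H.m_closed)
    then show ?thesis
      using that c l by (simp add: H.m_assoc)
  qed
qed

lemma \<beta>_simps:
  "\<beta> \<one>\<^bsub>H\<^esub> = 1"
  "\<lbrakk>a \<in> carrier H; b \<in> carrier H\<rbrakk> \<Longrightarrow> \<beta> (a \<oplus>\<^bsub>H\<^esub> b) = \<beta> a + \<beta> b"
  "a \<in> carrier H \<Longrightarrow> \<beta> (c \<odot>\<^bsub>H\<^esub> a) = c * \<beta> a"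
  "\<lbrakk>a \<in> carrier H; b \<in> carrier H\<rbrakk> \<Longrightarrow> \<beta> (a \<otimes>\<^bsub>H\<^esub> b) = \<beta> a * \<beta> b"
  using k_alg_homD[OF \<beta>] by simp_all

lemma contract_bilinear:
  "k_bilinear H H H (\<lambda>h1 h2. (c * \<beta> (S h1)) \<odot>\<^bsub>H\<^esub> adj h2)"
  by (rule k_bilinearI)
    (simp_all only: adj_simps \<beta>_simps S_simps H.smult_closed H.smult_r_distr H.smult_l_distr
      H.smult_smult distrib_left mult_ac)

text \<open>The inner map, with \<open>c\<close> in place of \<open>\<beta> h3\<close>.\<close>

abbreviation (input) "contract c \<equiv> tensor_lift H (\<lambda>h1 h2. (c * \<beta> (S h1)) \<odot>\<^bsub>H\<^esub> adj h2)"

lemmas contract_linear = P.tensor_lift_linear[OF H.k_algebra_axioms contract_bilinear]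
lemmas contract_tens = P.tensor_lift_tens[OF H.k_algebra_axioms contract_bilinear]

lemma contract_scale:
  assumes "u \<in> carrier T2"
  shows "contract c u = c \<odot>\<^bsub>H\<^esub> contract 1 u"
proof (rule P.tensor_linear_eqI[OF H.k_algebra_axioms contract_linear _ _ assms])
  show "k_linear T2 H (\<lambda>u. c \<odot>\<^bsub>H\<^esub> contract 1 u)"
    by (rule k_linearI)
      (simp_all only: k_linearD[OF contract_linear] H.smult_closed H.smult_r_distr H.smult_smult mult.commute)
  show "contract c (t a b) = c \<odot>\<^bsub>H\<^esub> contract 1 (t a b)" if "a \<in> carrier H" "b \<in> carrier H" for a b
    unfolding contract_tens[OF that, of c] contract_tens[OF that, of 1]
    using adj_simps(1)[OF that(2)] by (simp add: H.smult_smult)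
qed

lemma contract_hom: "k_alg_hom T2 H (contract 1)"
proof (rule P.tensor_lift_alg_hom[OF H.k_algebra_axioms contract_bilinear])
  show "(1 * \<beta> (S \<one>\<^bsub>H\<^esub>)) \<odot>\<^bsub>H\<^esub> adj \<one>\<^bsub>H\<^esub> = \<one>\<^bsub>H\<^esub>"
    by (simp only: adj_simps S_simps \<beta>_simps mult_1_left H.smult_one H.one_closed)
qed (simp only: adj_simps S_simps \<beta>_simps mult_1_left H.smult_mult_l H.smult_mult_r H.smult_smult
    H.smult_closed H.m_closed mult_ac)

text \<open>The inner map is \<open>c\<close> times an algebra homomorphism that does not depend on \<open>c\<close>; this makes the outer
  map bilinear and, in the next lemma, multiplicative.\<close>

lemma outer_bilinear: "k_bilinear T2 H H (\<lambda>u h3. contract (\<beta> h3) u)"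
proof -
  define m where "m = contract 1"
  have scale: "contract c u = c \<odot>\<^bsub>H\<^esub> m u" if "u \<in> carrier T2" for c u
    unfolding m_def by (rule contract_scale[OF that])
  have m: "k_linear T2 H m"
    unfolding m_def by (rule contract_linear)
  show ?thesis
    by (rule k_bilinearI)
      (simp_all add: scale k_linearD[OF m] \<beta>_simps H.smult_l_distr H.smult_r_distr H.smult_smult
        mult.commute)
qed

lemma outer_hom: "k_alg_hom T3 H (tensor_lift H (\<lambda>u h3. contract (\<beta> h3) u))"
proof (rule P3.tensor_lift_alg_hom[OF H.k_algebra_axioms outer_bilinear])
  show "contract (\<beta> \<one>\<^bsub>H\<^esub>) \<one>\<^bsub>T2\<^esub> = \<one>\<^bsub>H\<^esub>"
    by (simp only: \<beta>_simps k_alg_homD(2)[OF contract_hom])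
  fix u u' b b' assume c: "u \<in> carrier T2" "u' \<in> carrier T2" "b \<in> carrier H" "b' \<in> carrier H"
  have "contract (\<beta> (b \<otimes>\<^bsub>H\<^esub> b')) (u \<otimes>\<^bsub>T2\<^esub> u') = (\<beta> b * \<beta> b') \<odot>\<^bsub>H\<^esub> (contract 1 u \<otimes>\<^bsub>H\<^esub> contract 1 u')"
    using c contract_scale[of "u \<otimes>\<^bsub>T2\<^esub> u'"] k_alg_homD(3)[OF contract_hom c(1,2)] by (simp only: \<beta>_simps T2.m_closed)
  also have "\<dots> = (\<beta> b \<odot>\<^bsub>H\<^esub> contract 1 u) \<otimes>\<^bsub>H\<^esub> (\<beta> b' \<odot>\<^bsub>H\<^esub> contract 1 u')"
    using k_alg_homD(4)[OF contract_hom c(1)] k_alg_homD(4)[OF contract_hom c(2)]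
    by (simp only: H.smult_mult_l H.smult_mult_r H.smult_smult H.smult_closed H.m_closed mult.commute)
  finally show "contract (\<beta> (b \<otimes>\<^bsub>H\<^esub> b')) (u \<otimes>\<^bsub>T2\<^esub> u') = contract (\<beta> b) u \<otimes>\<^bsub>H\<^esub> contract (\<beta> b') u'"
    using contract_scale[OF c(1), of "\<beta> b"] contract_scale[OF c(2), of "\<beta> b'"] by simp
qed

lemma \<Delta>3_bilinear: "k_bilinear H H T3 (\<lambda>a b. t3 (\<Delta> a) b)"
  by (rule k_bilinearI) (simp_all add: k_alg_homD[OF \<Delta>_hom] t3_simps)

lemma \<Delta>3_hom: "k_alg_hom H T3 \<Delta>3"
  unfolding \<Delta>3_def
proof (rule k_alg_hom_comp[OF \<Delta>_hom], rule P.tensor_lift_alg_hom[OF P3.k_algebra_tensor_alg \<Delta>3_bilinear])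
qed (simp_all add: k_alg_homD[OF \<Delta>_hom] P3.tens_one P3.tens_mult)

lemma pair_map_hom: "k_alg_hom H H (pair_map l \<beta>)"
  unfolding pair_map_def by (rule k_alg_hom_comp[OF \<Delta>3_hom outer_hom])

lemma pair_map_group_like:
  assumes z: "z \<in> carrier H" and \<Delta>: "\<Delta> z = t z z"
  shows "pair_map l \<beta> z = (\<beta> z * \<beta> (S z)) \<odot>\<^bsub>H\<^esub> adj z"
proof -
  have "\<Delta>3 z = t3 (t z z) z"
    using z P.tensor_lift_tens[OF P3.k_algebra_tensor_alg \<Delta>3_bilinear, of z z]
    by (simp add: \<Delta>3_def \<Delta>)
  then show ?thesis
    using z P3.tensor_lift_tens[OF H.k_algebra_axioms outer_bilinear, of "t z z" z] contract_tens[of z z]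
    by (simp add: pair_map_def t_simps)
qed

text \<open>In the threefold coproduct of a skew primitive element \<open>z\<close>, the terms with \<open>z\<close> in an outer
  position are killed by the character.\<close>

lemma pair_map_skew_primitive:
  assumes z: "z \<in> carrier H" and w: "w \<in> carrier H"
    and \<Delta>: "\<Delta> z = t \<one>\<^bsub>H\<^esub> z \<oplus>\<^bsub>T2\<^esub> t z w" and \<beta>z: "\<beta> z = 0" "\<beta> (S z) = 0"
  shows "pair_map l \<beta> z = \<beta> w \<odot>\<^bsub>H\<^esub> adj z"
proof -
  let ?L = "tensor_lift T3 (\<lambda>a b. t3 (\<Delta> a) b)" and ?O = "tensor_lift H (\<lambda>u h3. contract (\<beta> h3) u)"
  note L = k_linearD[OF P.tensor_lift_linear[OF P3.k_algebra_tensor_alg \<Delta>3_bilinear]]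
    P.tensor_lift_tens[OF P3.k_algebra_tensor_alg \<Delta>3_bilinear]
  note O = k_alg_homD[OF outer_hom] and Ot = P3.tensor_lift_tens[OF H.k_algebra_axioms outer_bilinear]
  note I = k_linearD[OF contract_linear]
  have D1: "\<Delta> \<one>\<^bsub>H\<^esub> = t \<one>\<^bsub>H\<^esub> \<one>\<^bsub>H\<^esub>"
    using k_alg_homD(2)[OF \<Delta>_hom] by (simp add: P.tens_one)
  have c: "t \<one>\<^bsub>H\<^esub> z \<in> carrier T2" "t z w \<in> carrier T2" "t \<one>\<^bsub>H\<^esub> \<one>\<^bsub>H\<^esub> \<in> carrier T2"
    using z w by (simp_all add: t_simps)
  have "\<Delta>3 z = t3 (t \<one>\<^bsub>H\<^esub> \<one>\<^bsub>H\<^esub>) z \<oplus>\<^bsub>T3\<^esub> (t3 (t \<one>\<^bsub>H\<^esub> z) w \<oplus>\<^bsub>T3\<^esub> t3 (t z w) w)"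
    using z w c unfolding \<Delta>3_def by (simp add: \<Delta> L D1 t3_simps)
  then have "pair_map l \<beta> z = ?O (t3 (t \<one>\<^bsub>H\<^esub> \<one>\<^bsub>H\<^esub>) z) \<oplus>\<^bsub>H\<^esub>
      (?O (t3 (t \<one>\<^bsub>H\<^esub> z) w) \<oplus>\<^bsub>H\<^esub> ?O (t3 (t z w) w))"
    using z w c by (simp add: pair_map_def O t3_simps)
  also have "\<dots> = contract (\<beta> z) (t \<one>\<^bsub>H\<^esub> \<one>\<^bsub>H\<^esub>) \<oplus>\<^bsub>H\<^esub> (contract (\<beta> w) (t \<one>\<^bsub>H\<^esub> z) \<oplus>\<^bsub>H\<^esub> contract (\<beta> w) (t z w))"
    using z w c by (simp add: Ot)
  also have "\<dots> = \<beta> w \<odot>\<^bsub>H\<^esub> adj z"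
    unfolding contract_tens[OF H.one_closed H.one_closed] contract_tens[OF H.one_closed z]
      contract_tens[OF z w]
    using adj_simps(1)[OF z] adj_simps(1)[OF w] by (simp add: adj_simps(5) \<beta>z S_simps \<beta>_simps)
  finally show ?thesis .
qed

lemma pair_map_gens:
  "pair_map l \<beta> g = adj g"
  "pair_map l \<beta> x = (\<beta> g powi (A$1$1)) \<odot>\<^bsub>H\<^esub> adj x"
  "pair_map l \<beta> y = (\<beta> g powi (A$2$1)) \<odot>\<^bsub>H\<^esub> adj y"
proof -
  have "\<beta> g \<noteq> 0"
    using character_gens(1)[OF \<beta>] N_pos by (auto simp: power_0_left)
  then have "\<beta> g * \<beta> (S g) = 1"
    by (simp add: S_gens character_gp[OF \<beta>] power_int_minus)
  then show "pair_map l \<beta> g = adj g"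
    using adj_simps(1)[of g] by (simp add: pair_map_group_like \<Delta>_gens)
  show "pair_map l \<beta> x = (\<beta> g powi (A$1$1)) \<odot>\<^bsub>H\<^esub> adj x"
    using pair_map_skew_primitive[OF gen_closed gp_closed \<Delta>_gens(2)]
    by (simp add: character_gens[OF \<beta>] S_gens \<beta>_simps character_gp[OF \<beta>])
  show "pair_map l \<beta> y = (\<beta> g powi (A$2$1)) \<odot>\<^bsub>H\<^esub> adj y"
    using pair_map_skew_primitive[OF gen_closed gp_closed \<Delta>_gens(3)]
    by (simp add: character_gens[OF \<beta>] S_gens \<beta>_simps character_gp[OF \<beta>])
qed

end

text \<open>The condition on a pair in involution compares two algebra endomorphisms, so it can be read
  off on the generators.\<close>

lemma pair_condition_iff:
  assumes l: "l \<in> Units H" and \<beta>: "k_alg_hom H base_alg \<beta>"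
  shows "(\<forall>h\<in>carrier H. S (S h) = pair_map l \<beta> h) \<longleftrightarrow>
    l \<otimes>\<^bsub>H\<^esub> g = g \<otimes>\<^bsub>H\<^esub> l \<and>
    (q powi (A$1$1 * A$1$2)) \<odot>\<^bsub>H\<^esub> (x \<otimes>\<^bsub>H\<^esub> l) = (\<beta> g powi (A$1$1)) \<odot>\<^bsub>H\<^esub> (l \<otimes>\<^bsub>H\<^esub> x) \<and>
    (q powi (A$2$1 * A$2$2)) \<odot>\<^bsub>H\<^esub> (y \<otimes>\<^bsub>H\<^esub> l) = (\<beta> g powi (A$2$1)) \<odot>\<^bsub>H\<^esub> (l \<otimes>\<^bsub>H\<^esub> y)"
    (is "?L \<longleftrightarrow> ?R")
proof -
  note c = H.Units_closed[OF l] H.Units_inv_closed[OF l]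
  have move: "a = l \<otimes>\<^bsub>H\<^esub> b \<otimes>\<^bsub>H\<^esub> inv\<^bsub>H\<^esub> l \<longleftrightarrow> a \<otimes>\<^bsub>H\<^esub> l = l \<otimes>\<^bsub>H\<^esub> b"
    if "a \<in> carrier H" "b \<in> carrier H" for a b
  proof
    assume "a = l \<otimes>\<^bsub>H\<^esub> b \<otimes>\<^bsub>H\<^esub> inv\<^bsub>H\<^esub> l"
    then show "a \<otimes>\<^bsub>H\<^esub> l = l \<otimes>\<^bsub>H\<^esub> b"
      using that c l by (simp add: H.m_assoc)
  next
    assume "a \<otimes>\<^bsub>H\<^esub> l = l \<otimes>\<^bsub>H\<^esub> b"
    then have "a \<otimes>\<^bsub>H\<^esub> l \<otimes>\<^bsub>H\<^esub> inv\<^bsub>H\<^esub> l = l \<otimes>\<^bsub>H\<^esub> b \<otimes>\<^bsub>H\<^esub> inv\<^bsub>H\<^esub> l"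
      by simp
    then show "a = l \<otimes>\<^bsub>H\<^esub> b \<otimes>\<^bsub>H\<^esub> inv\<^bsub>H\<^esub> l"
      using that c l by (simp add: H.m_assoc)
  qed
  have scal: "c \<odot>\<^bsub>H\<^esub> a = d \<odot>\<^bsub>H\<^esub> (l \<otimes>\<^bsub>H\<^esub> b \<otimes>\<^bsub>H\<^esub> inv\<^bsub>H\<^esub> l) \<longleftrightarrow> c \<odot>\<^bsub>H\<^esub> (a \<otimes>\<^bsub>H\<^esub> l) = d \<odot>\<^bsub>H\<^esub> (l \<otimes>\<^bsub>H\<^esub> b)"
    if "a \<in> carrier H" "b \<in> carrier H" for a b and c d :: 'k
    using move[of "c \<odot>\<^bsub>H\<^esub> a" "d \<odot>\<^bsub>H\<^esub> b"] that c by (simp add: H.smult_mult_l H.smult_mult_r)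
  have gens: "S (S g) = pair_map l \<beta> g \<longleftrightarrow> l \<otimes>\<^bsub>H\<^esub> g = g \<otimes>\<^bsub>H\<^esub> l"
    "S (S x) = pair_map l \<beta> x \<longleftrightarrow>
      (q powi (A$1$1 * A$1$2)) \<odot>\<^bsub>H\<^esub> (x \<otimes>\<^bsub>H\<^esub> l) = (\<beta> g powi (A$1$1)) \<odot>\<^bsub>H\<^esub> (l \<otimes>\<^bsub>H\<^esub> x)"
    "S (S y) = pair_map l \<beta> y \<longleftrightarrow>
      (q powi (A$2$1 * A$2$2)) \<odot>\<^bsub>H\<^esub> (y \<otimes>\<^bsub>H\<^esub> l) = (\<beta> g powi (A$2$1)) \<odot>\<^bsub>H\<^esub> (l \<otimes>\<^bsub>H\<^esub> y)"
    unfolding pair_map_gens[OF l \<beta>] S_S_gens using move[of g g] by (auto simp: scal)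
  show ?thesis
  proof
    assume ?L
    then have "S (S g) = pair_map l \<beta> g" "S (S x) = pair_map l \<beta> x" "S (S y) = pair_map l \<beta> y"
      using gen_closed by blast+
    then show ?R
      unfolding gens by blast
  next
    assume ?R
    then have "S (S g) = pair_map l \<beta> g" "S (S x) = pair_map l \<beta> x" "S (S y) = pair_map l \<beta> y"
      unfolding gens by blast+
    then show ?L
      using taft_hom_eqI[OF H.k_algebra_axioms S_S_hom pair_map_hom[OF l \<beta>]] by blast
  qed
qed

text \<open>With \<open>\<beta> g = q powi c\<close> the condition at \<open>x\<close> says that \<open>l\<close> commutes with \<open>x\<close> up to the scalar
  \<open>q powi (a11 a12 - a11 c)\<close>. By the triangular representation this scalar is the value
  at \<open>l\<close> of the character \<open>chi (q powi a12)\<close>, that is \<open>q powi (d a12)\<close>.\<close>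

lemma pair_condition_group_like:
  assumes l: "group_like l" and d: "\<And>z. chi (q powi z) l = q powi (d * z)"
    and \<beta>: "k_alg_hom H base_alg \<beta>" and c: "\<beta> g = q powi c"
    and pair: "\<forall>h\<in>carrier H. S (S h) = pair_map l \<beta> h"
  shows "[A$1$1 * c + A$1$2 * d = A$1$1 * A$1$2] (mod int N)"
    "[A$2$1 * c + A$2$2 * d = A$2$1 * A$2$2] (mod int N)"
proof -
  have lc: "l \<in> carrier H" "chi 1 l = 1"
    using l by (auto simp: group_like_def)
  have key: "[a * c + b * d = a * b] (mod int N)"
    if rel: "taft_relations N q A tri_alg (tri_gen s (q powi b))" and s: "s \<noteq> Gen_g"
      and eq: "(q powi (a * b)) \<odot>\<^bsub>H\<^esub> (taft_gen N q A s \<otimes>\<^bsub>H\<^esub> l) = (\<beta> g powi a) \<odot>\<^bsub>H\<^esub> (l \<otimes>\<^bsub>H\<^esub> taft_gen N q A s)"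
    for a b s
  proof -
    have "l \<otimes>\<^bsub>H\<^esub> taft_gen N q A s = q powi (- (a * c)) \<odot>\<^bsub>H\<^esub> ((q powi (a * c)) \<odot>\<^bsub>H\<^esub> (l \<otimes>\<^bsub>H\<^esub> taft_gen N q A s))"
      using lc q_nonzero by (simp add: H.smult_smult flip: power_int_add)
    also have "(q powi (a * c)) \<odot>\<^bsub>H\<^esub> (l \<otimes>\<^bsub>H\<^esub> taft_gen N q A s) = (q powi (a * b)) \<odot>\<^bsub>H\<^esub> (taft_gen N q A s \<otimes>\<^bsub>H\<^esub> l)"
      unfolding eq c by (simp add: power_int_mult[symmetric] mult.commute)
    also have "q powi (- (a * c)) \<odot>\<^bsub>H\<^esub> \<dots> = q powi (a * b - a * c) \<odot>\<^bsub>H\<^esub> (taft_gen N q A s \<otimes>\<^bsub>H\<^esub> l)"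
      using lc q_nonzero by (simp add: H.smult_smult flip: power_int_add)
    finally have "chi (q powi b) l = q powi (a * b - a * c) * chi 1 l"
      by (rule tri_commute[OF rel s q_powi_N lc(1)])
    then have "[d * b = a * b - a * c] (mod int N)"
      using lc d by (simp add: primitive_root_powi_eq_iff[OF q])
    then have "[a * c + d * b = a * c + (a * b - a * c)] (mod int N)"
      by (rule cong_add[OF cong_refl])
    then show ?thesis
      by (simp add: mult.commute)
  qed
  note P = pair_condition_iff[OF group_like_Units[OF l] \<beta>, THEN iffD1, OF pair]
  show "[A$1$1 * c + A$1$2 * d = A$1$1 * A$1$2] (mod int N)"
    using key[OF tri_relations(1)] P by blast
  show "[A$2$1 * c + A$2$2 * d = A$2$1 * A$2$2] (mod int N)"
    using key[OF tri_relations(2)] P by blast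
qed

lemma pair_condition_gp:
  assumes \<beta>: "k_alg_hom H base_alg \<beta>" and c: "\<beta> g = q powi c"
    and "[A$1$1 * c + A$1$2 * d = A$1$1 * A$1$2] (mod int N)"
      "[A$2$1 * c + A$2$2 * d = A$2$1 * A$2$2] (mod int N)"
  shows "\<forall>h\<in>carrier H. S (S h) = pair_map (gp d) \<beta> h"
proof -
  have eq: "q powi (a * b) = (\<beta> g powi a) * q powi (b * d)"
    if "[a * c + b * d = a * b] (mod int N)" for a b
  proof -
    have "q powi (a * b) = q powi (a * c + b * d)"
      using that by (simp add: primitive_root_powi_eq_iff[OF q] cong_sym)
    also have "\<dots> = (\<beta> g powi a) * q powi (b * d)"
      using q_nonzero by (simp add: c power_int_add power_int_mult[symmetric] mult.commute)
    finally show ?thesis .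
  qed
  have "gp d \<otimes>\<^bsub>H\<^esub> g = g \<otimes>\<^bsub>H\<^esub> gp d"
    by (simp add: g_gp)
  then show ?thesis
    unfolding pair_condition_iff[OF group_like_Units[OF group_like_gp] \<beta>]
    using eq[OF assms(3)] eq[OF assms(4)] by (simp add: gp_x gp_y H.smult_smult)
qed

section \<open>The Hopf algebra record\<close>

text \<open>The extended record has the operations of \<open>H\<close>, so every construction applied to it agrees with
  the one applied to \<open>H\<close>.\<close>

abbreviation "K \<equiv> taft_hopf N q A"

lemma K_fields [simp]:
  "carrier K = carrier H" "monoid.mult K = monoid.mult H" "one K = one H" "zero K = zero H"
  "add K = add H" "module.smult K = module.smult H"
  "comult K = \<Delta>" "counit K = chi 1" "antipode K = S"
  by (simp_all add: taft_hopf_def module.extend_def hopf.fields_def Let_def \<Delta>_def S_def counit_eq)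

lemma K_inv: "inv\<^bsub>K\<^esub> a = inv\<^bsub>H\<^esub> a"
  by (simp add: m_inv_def)

lemma K_pow: "a [^]\<^bsub>K\<^esub> (n::nat) = a [^]\<^bsub>H\<^esub> n"
  by (simp add: nat_pow_def)

lemma K_int_pow: "a [^]\<^bsub>K\<^esub> (z::int) = a [^]\<^bsub>H\<^esub> z"
  by (simp only: int_pow_def K_inv K_fields)

lemma K_tens: "tens K K = t" "tensor_alg K K = T2" "tens T2 K = t3" "tensor_alg T2 K = T3"
proof -
  have D: "K \<times>\<times> K = H \<times>\<times> H" "T2 \<times>\<times> K = T2 \<times>\<times> H"
    by (simp_all add: DirProd_def)
  have B: "bilin_rels K K = bilin_rels H H" "bilin_rels T2 K = bilin_rels T2 H"
    by (simp_all add: bilin_rels_def)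
  show "tens K K = t" "tens T2 K = t3"
    by (intro ext; simp add: tens_def D B)+
  show "tensor_alg K K = T2"
    unfolding tensor_alg_def D B ..
  show "tensor_alg T2 K = T3"
    unfolding tensor_alg_def[of T2 K] tensor_alg_def[of T2 H] D B ..
qed

lemma K_lin_ext: "lin_ext K \<psi> = lin_ext H \<psi>"
  by (intro ext) (simp add: lin_ext_def finsum_def finprod_def)

lemma K_tensor_lift: "tensor_lift K \<phi> = tensor_lift H \<phi>"
  by (simp add: tensor_lift_def K_lin_ext)

lemma K_functionals: "lin_functionals K = lin_functionals H" "characters K = characters H"
  by (simp_all add: lin_functionals_def characters_def)

lemma functional_linear: "f \<in> lin_functionals H \<Longrightarrow> k_linear H base_alg f"
  by (auto simp: lin_functionals_def k_linear_def)

lemma character_hom: "\<beta> \<in> characters H \<Longrightarrow> k_alg_hom H base_alg \<beta>"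
  by (auto simp: characters_def k_alg_hom_def functional_linear)

lemma group_likes_K: "group_likes K = Collect group_like"
  by (auto simp: group_likes_def group_like_def K_tens)

lemma pair_in_involution_K:
  "pair_in_involution K l \<beta> \<longleftrightarrow>
    group_like l \<and> \<beta> \<in> characters H \<and> (\<forall>h\<in>carrier H. S (S h) = pair_map l \<beta> h)"
  by (simp add: pair_in_involution_def group_likes_K K_functionals comult3_def K_tens K_tensor_lift K_inv
      pair_map_def \<Delta>3_def)

section \<open>The group of characters\<close>

text \<open>Characters take a fixed value outside of the carrier, so \<open>chi u\<close> has to be cut off there.\<close>

definition rchi :: "'k \<Rightarrow> 'k taft \<Rightarrow> 'k" where
  "rchi u = restrict (chi u) (carrier H)"

lemma rchi_hom: "u ^ N = 1 \<Longrightarrow> k_alg_hom H base_alg (rchi u)"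
  by (intro k_alg_homI k_linearI) (simp_all add: rchi_def k_alg_homD[OF chi_hom[of u], simplified])

lemma rchi_g: "u ^ N = 1 \<Longrightarrow> rchi u g = u"
  by (simp add: rchi_def chi_gens)

lemma rchi_character: "u ^ N = 1 \<Longrightarrow> rchi u \<in> characters H"
  using k_alg_homD[OF rchi_hom[of u]] by (auto simp: characters_def lin_functionals_def rchi_def)

lemma characters_eq: "characters H = rchi ` {u. u ^ N = 1}"
proof (intro equalityI subsetI)
  fix \<beta> assume \<beta>: "\<beta> \<in> characters H"
  then have ext: "\<beta> \<in> extensional (carrier H)"
    by (auto simp: characters_def lin_functionals_def)
  have "\<beta> = rchi (\<beta> g)"
    by (rule extensionalityI[OF ext]) (simp_all add: rchi_def character_eq_chi[OF character_hom[OF \<beta>], symmetric])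
  then show "\<beta> \<in> rchi ` {u. u ^ N = 1}"
    using character_gens(1)[OF character_hom[OF \<beta>]] by blast
qed (auto intro: rchi_character)

abbreviation "X \<equiv> character_group K"

lemma X_simps:
  "carrier X = rchi ` {u. u ^ N = 1}" "\<one>\<^bsub>X\<^esub> = rchi 1"
  "\<lbrakk>u ^ N = 1; v ^ N = 1\<rbrakk> \<Longrightarrow> rchi u \<otimes>\<^bsub>X\<^esub> rchi v = rchi (u * v)"
proof -
  show "carrier X = rchi ` {u. u ^ N = 1}" "\<one>\<^bsub>X\<^esub> = rchi 1"
    by (simp_all add: character_group_def K_functionals characters_eq rchi_def)
  assume "u ^ N = 1" "v ^ N = 1"
  then show "rchi u \<otimes>\<^bsub>X\<^esub> rchi v = rchi (u * v)"
    using convolution[OF rchi_hom rchi_hom, of u v]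
    by (auto simp: character_group_def rchi_g rchi_def[of "u * v"] intro!: restrict_ext)
qed

lemma monoid_X: "monoid X"
  by (rule monoidI) (auto simp: X_simps power_mult_distrib mult.assoc)

text \<open>The multiplication of the character group corresponds to that of the roots of unity; the inverses
  of its record come from the finite order of its elements.\<close>

lemma rchi_pow:
  assumes "u ^ N = 1"
  shows "rchi u [^]\<^bsub>X\<^esub> (z::int) = rchi (u powi z)"
proof -
  interpret X: monoid X by (rule monoid_X)
  have N: "(u ^ n) ^ N = 1" for n
    using assms by (metis power_mult mult.commute power_one)
  have nat: "rchi u [^]\<^bsub>X\<^esub> (n::nat) = rchi (u ^ n)" for n
    by (induction n) (simp_all add: X_simps assms N mult.commute)
  have "rchi u [^]\<^bsub>X\<^esub> z = rchi u [^]\<^bsub>X\<^esub> nat (z mod int N)"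
    by (rule X.int_pow_mod) (use assms N_pos in \<open>auto simp: X_simps nat\<close>)
  then show ?thesis
    using root_powi[OF assms N_pos] by (simp add: nat)
qed

text \<open>The character with value \<open>q powi (- 1)\<close> at \<open>g\<close> has the prescribed values on the monomials, and these
  determine a functional because the monomials span.\<close>

lemma taft_xi_eq: "taft_xi N q A = rchi (q powi (- 1))"
  unfolding taft_xi_def Let_def K_functionals K_fields K_pow
proof (rule the_equality)
  let ?u = "q powi (- 1)"
  have u: "?u ^ N = 1" by (rule q_powi_N)
  have "rchi ?u \<in> lin_functionals H"
    using rchi_character[OF u] by (simp add: characters_def)
  moreover have vals: "rchi ?u (x [^]\<^bsub>H\<^esub> i \<otimes>\<^bsub>H\<^esub> y [^]\<^bsub>H\<^esub> j \<otimes>\<^bsub>H\<^esub> g [^]\<^bsub>H\<^esub> l) =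
      (if i = 0 \<and> j = 0 then q powi (- int l) else 0)" for i j l :: nat
  proof -
    have "rchi ?u (x [^]\<^bsub>H\<^esub> i \<otimes>\<^bsub>H\<^esub> y [^]\<^bsub>H\<^esub> j \<otimes>\<^bsub>H\<^esub> g [^]\<^bsub>H\<^esub> l) = rchi ?u x ^ i * rchi ?u y ^ j * rchi ?u g ^ l"
      using k_alg_homD[OF rchi_hom[OF u]] k_alg_hom_pow[OF H.k_algebra_axioms k_algebra_base_alg rchi_hom[OF u] gen_closed]
      by simp
    also have "\<dots> = 0 ^ i * 0 ^ j * ?u ^ l"
      using character_gens[OF rchi_hom[OF u]] rchi_g[OF u] by simp
    finally show ?thesis
      by (simp add: power_0_left power_int_minus power_inverse)
  qed
  ultimately show "rchi ?u \<in> lin_functionals H \<and>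
       (\<forall>i<taft_Nx N A. \<forall>j<taft_Ny N A. \<forall>l<N.
          rchi ?u (x [^]\<^bsub>H\<^esub> i \<otimes>\<^bsub>H\<^esub> y [^]\<^bsub>H\<^esub> j \<otimes>\<^bsub>H\<^esub> g [^]\<^bsub>H\<^esub> l) =
            (if i = 0 \<and> j = 0 then q powi (- int l) else 0))"
    by blast
  fix f assume f: "f \<in> lin_functionals H \<and>
       (\<forall>i<taft_Nx N A. \<forall>j<taft_Ny N A. \<forall>l<N.
          f (x [^]\<^bsub>H\<^esub> i \<otimes>\<^bsub>H\<^esub> y [^]\<^bsub>H\<^esub> j \<otimes>\<^bsub>H\<^esub> g [^]\<^bsub>H\<^esub> l) =
            (if i = 0 \<and> j = 0 then q powi (- int l) else 0))"
  show "f = rchi ?u"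
  proof (rule extensionalityI)
    show "f \<in> extensional (carrier H)" "rchi ?u \<in> extensional (carrier H)"
      using f by (auto simp: lin_functionals_def rchi_def)
    show "f a = rchi ?u a" if "a \<in> carrier H" for a
      by (rule taft_functional_eqI[OF functional_linear k_alg_homD(1)[OF rchi_hom[OF u]] _ that])
        (use f vals in auto)
  qed
qed

lemma xi_pow: "taft_xi N q A [^]\<^bsub>X\<^esub> (- c) = rchi (q powi c)"
proof -
  have "(q powi (- 1)) powi (- c) = q powi c"
    unfolding power_int_mult[symmetric] by simp
  then show ?thesis
    unfolding taft_xi_eq rchi_pow[OF q_powi_N] by (simp only:)
qed

lemma pair_exists_iff:
  "(\<exists>l \<beta>. pair_in_involution K l \<beta>) \<longleftrightarrow>
    (\<exists>c d. [A$1$1 * c + A$1$2 * d = A$1$1 * A$1$2] (mod int N) \<and>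
           [A$2$1 * c + A$2$2 * d = A$2$1 * A$2$2] (mod int N))" (is "?L \<longleftrightarrow> ?R")
  and pair_of_solution:
  "\<lbrakk>[A$1$1 * c + A$1$2 * d = A$1$1 * A$1$2] (mod int N);
    [A$2$1 * c + A$2$2 * d = A$2$1 * A$2$2] (mod int N)\<rbrakk> \<Longrightarrow>
    pair_in_involution K (gp d) (rchi (q powi c))"
proof -
  show *: "pair_in_involution K (gp d) (rchi (q powi c))"
    if "[A$1$1 * c + A$1$2 * d = A$1$1 * A$1$2] (mod int N)"
      "[A$2$1 * c + A$2$2 * d = A$2$1 * A$2$2] (mod int N)" for c d
    unfolding pair_in_involution_K
    using group_like_gp rchi_character[OF q_powi_N]
      pair_condition_gp[OF rchi_hom[OF q_powi_N] rchi_g[OF q_powi_N] that] by blast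
  show "?L \<longleftrightarrow> ?R"
  proof
    assume ?L
    then obtain l \<beta> where l: "group_like l" and \<beta>: "\<beta> \<in> characters H"
      and pair: "\<forall>h\<in>carrier H. S (S h) = pair_map l \<beta> h"
      by (auto simp: pair_in_involution_K)
    obtain d where d: "\<And>z. chi (q powi z) l = q powi (d * z)"
      using chi_group_like[OF l] by blast
    obtain c where c: "\<beta> g = q powi c"
      using root_of_unity_eq_powi[OF q character_gens(1)[OF character_hom[OF \<beta>]]] by blast
    show ?R
      using pair_condition_group_like[OF l d character_hom[OF \<beta>] c pair] by blast
  next
    assume ?R
    then show ?L using * by blast
  qed
qed

lemma modular_of_solution:
  "rchi (q powi c) (gp d) = 1 \<longleftrightarrow> [c * d = 0] (mod int N)"
  using primitive_root_powi_eq_1_iff[OF q, of "c * d"]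
  by (simp add: character_gp[OF rchi_hom[OF q_powi_N]] rchi_g[OF q_powi_N] power_int_mult)

end

theorem theorem4p5:
  fixes N :: nat and q :: "'k::{alg_closed_field, field_char_0}" and A :: "int^2^2"
  assumes "N \<ge> 2"
    and "primitive_root_of_unity N q"
    and "parameter_matrix N A"
  shows "((\<exists>l \<beta>. pair_in_involution (taft_hopf N q A) l \<beta>) \<longleftrightarrow>
      (\<exists>c d :: int. [A$1$1 * c + A$1$2 * d = A$1$1 * A$1$2] (mod int N) \<and>
                    [A$2$1 * c + A$2$2 * d = A$2$1 * A$2$2] (mod int N))) \<and>
    (\<forall>c d :: int.
      [A$1$1 * c + A$1$2 * d = A$1$1 * A$1$2] (mod int N) \<and>
      [A$2$1 * c + A$2$2 * d = A$2$1 * A$2$2] (mod int N) \<longrightarrow>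
      (let H = taft_hopf N q A;
           l = taft_g N q A [^]\<^bsub>H\<^esub> d;
           \<beta> = taft_xi N q A [^]\<^bsub>character_group H\<^esub> (- c)
       in pair_in_involution H l \<beta> \<and>
          (modular_pair H l \<beta> \<longleftrightarrow> [c * d = 0] (mod int N))))"
proof -
  interpret taft N q A
    by unfold_locales (use assms in auto)
  show ?thesis
    unfolding Let_def modular_pair_def K_int_pow xi_pow
    using pair_exists_iff pair_of_solution modular_of_solution by blast
qed

end
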